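(* Let $P$ and $Q$ be non-uniform probability distributions on finite sets. For all $s_2,t_2\in\mathbb R$, $F^{\mathcal D}_{P,Q,s_2}(t_2)=F^{\mathcal M}_{P,Q,s_2}(t_2)$, and the common value $F_{P,Q,s_2}(t_2)$ satisfies $$F_{P,Q,s_2}(t_2)=\sqrt{1-Z_{C_{P,Q},\,\frac{s_2}{\sqrt{V(P)}}}\big(t_2D_{P,Q}\big)}.$$
   Context: All logarithms are to base $2$. $\mathcal P(\mathcal X)$ is the set of probability distributions on a finite set $\mathcal X$; $P^n$ is the $n$-fold i.i.d. product. $H(P)=-\sum_x P(x)\log P(x)$, $V(P)=\sum_x P(x)(-\log P(x)-H(P))^2$. Non-uniform means not uniform on its support, i.e. $V>0$. $C_{P,Q}=\frac{H(P)}{V(P)}\left(\frac{H(Q)}{V(Q)}\right)^{-1}$ and $D_{P,Q}=\frac{H(Q)}{\sqrt{V(P)}}$. For a map $f:\mathcal X\to\mathcal Y$, $W_f(P)(y)=\sum_{x\in f^{-1}(y)}P(x)$. Fidelity: $F(Q,Q')=\sum_y\sqrt{Q(y)}\sqrt{Q'(y)}$. $P^{\downarrow}_i$ is the $i$-th largest value of $P$ (and $0$ beyond the size of the set). $P\prec Q$ means $\sum_{i=1}^l P^{\downarrow}_i\le\sum_{i=1}^l Q^{\downarrow}_i$ for all $l$ (the finite sets may differ). A storage of $N$ bits is $K_N=\{0,1\}^N$; for real $N\ge0$ it is a set of $\lfloor 2^N\rfloor$ elements. A real exponent $Q^t$ means $Q^{\lfloor t\rfloor}$. For $P\in\mathcal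 P(\mathcal X)$, $Q\in\mathcal P(\mathcal Y)$, $F^{\mathcal D}(P\to Q|N)=\sup_{f:\mathcal X\to K_N,\ f':K_N\to\mathcal Y}F(W_{f'}\circ W_f(P),Q)$ and $F^{\mathcal M}(P\to Q|N)=\sup\{F(P'',Q)\mid P''\in\mathcal P(\mathcal Y),\ \exists P'\in\mathcal P(K_N):\ P\prec P'\prec P''\}$. For $i\in\{\mathcal D,\mathcal M\}$, $F^i_{P,Q,s_2}(t_2)=\liminf_{n\to\infty}F^i\big(P^n\to Q^{\frac{H(P)}{H(Q)}n+t_2\sqrt n}\,\big|\,H(P)n+s_2\sqrt n\big)$ (only large $n$ matter). Generalized Rayleigh-normal distribution function: $\Phi_{\mu,v},\phi_{\mu,v}$ are the cumulative distribution function and density of the normal distribution with mean $\mu$ and variance $v$; $\Phi=\Phi_{0,1}$. For densities, $\mathcal F(p,q)=\int_{\mathbb R}\sqrt{p(x)q(x)}\,dx$. For $v>0$, $s\in\mathbb R$, $$Z_{v,s}(\mu)=1-\sup_{A\in\mathcal A_s}\mathcal F\Big(\frac{dA}{dx},\phi_{\mu,v}\Big)^2,$$ where $\mathcal A_s$ is the set of continuously differentiable monotone increasing $A:\mathbb R\to[0,1]$ with $A(s)=1$ and $\Phi\le A\le1$. *)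

theory Defs
  imports "HOL-Probability.Probability"
begin

text \<open>
  A distribution on a finite set \<open>X\<close> is a pmf whose support is contained in \<open>X\<close>. The carrier
  is kept explicit because product spaces and storages are not types of their own.
\<close>

definition dists_on :: "'a set \<Rightarrow> 'a pmf set" where
  "dists_on X = {P. set_pmf P \<subseteq> X}"

definition pmf_entropy :: "'a pmf \<Rightarrow> real" where
  "pmf_entropy P = - (\<Sum>x\<in>set_pmf P. pmf P x * log 2 (pmf P x))"

definition pmf_varentropy :: "'a pmf \<Rightarrow> real" where
  "pmf_varentropy P = (\<Sum>x\<in>set_pmf P. pmf P x * (- log 2 (pmf P x) - pmf_entropy P)\<^sup>2)"

definition non_uniform :: "'a pmf \<Rightarrow> bool" where
  "non_uniform P \<longleftrightarrow> P \<noteq> pmf_of_set (set_pmf P)"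

definition coeff_C :: "'a pmf \<Rightarrow> 'b pmf \<Rightarrow> real" where
  "coeff_C P Q =
     pmf_entropy P / pmf_varentropy P * inverse (pmf_entropy Q / pmf_varentropy Q)"

definition coeff_D :: "'a pmf \<Rightarrow> 'b pmf \<Rightarrow> real" where
  "coeff_D P Q = pmf_entropy Q / sqrt (pmf_varentropy P)"

definition iid_carrier :: "nat \<Rightarrow> 'a set \<Rightarrow> (nat \<Rightarrow> 'a) set" where
  "iid_carrier n X = {..<n} \<rightarrow>\<^sub>E X"

definition iid_pmf :: "nat \<Rightarrow> 'a pmf \<Rightarrow> (nat \<Rightarrow> 'a) pmf" where
  "iid_pmf n P = Pi_pmf {..<n} undefined (\<lambda>_. P)"

definition fidelity :: "'a set \<Rightarrow> 'a pmf \<Rightarrow> 'a pmf \<Rightarrow> real" where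
  "fidelity Y Q Q' = (\<Sum>y\<in>Y. sqrt (pmf Q y) * sqrt (pmf Q' y))"

text \<open>
  Only the support is listed: further points of a carrier contribute trailing zeros, which
  \<open>sorted_prob\<close> supplies anyway. Indices start at 0.
\<close>

definition sorted_probs :: "'a pmf \<Rightarrow> real list" where
  "sorted_probs P =
     rev (sorted_list_of_multiset (image_mset (pmf P) (mset_set (set_pmf P))))"

definition sorted_prob :: "'a pmf \<Rightarrow> nat \<Rightarrow> real" where
  "sorted_prob P i = (if i < length (sorted_probs P) then sorted_probs P ! i else 0)"

definition majorized :: "'a pmf \<Rightarrow> 'b pmf \<Rightarrow> bool" where
  "majorized P Q \<longleftrightarrow> (\<forall>l. (\<Sum>i<l. sorted_prob P i) \<le> (\<Sum>i<l. sorted_prob Q i))"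

definition storage :: "real \<Rightarrow> nat set" where
  "storage N = {..<nat \<lfloor>2 powr N\<rfloor>}"

text \<open>
  The map \<open>W\<^sub>f\<close> is \<^term>\<open>map_pmf f\<close>. The suprema below are over sets that are bounded above by 1,
  and nonempty if \<open>N \<ge> 0\<close> and the carrier \<open>Y\<close> is nonempty.
\<close>

definition fid_det :: "'a set \<Rightarrow> 'b set \<Rightarrow> 'a pmf \<Rightarrow> 'b pmf \<Rightarrow> real \<Rightarrow> real" where
  "fid_det X Y P Q N =
     Sup {fidelity Y (map_pmf f' (map_pmf f P)) Q | f f'.
            f \<in> X \<rightarrow> storage N \<and> f' \<in> storage N \<rightarrow> Y}"

definition fid_maj :: "'b set \<Rightarrow> 'a pmf \<Rightarrow> 'b pmf \<Rightarrow> real \<Rightarrow> real" where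
  "fid_maj Y P Q N =
     Sup {fidelity Y P'' Q | P''. P'' \<in> dists_on Y \<and>
            (\<exists>P'\<in>dists_on (storage N). majorized P P' \<and> majorized P' P'')}"

text \<open>
  The conversion to \<^typ>\<open>nat\<close> in \<open>target_len\<close> truncates negative lengths. For non-uniform \<open>P\<close>
  and \<open>Q\<close> these, like negative storage sizes, occur for finitely many \<open>n\<close> only and so do not
  affect the limits inferior.
\<close>

definition target_len :: "'a pmf \<Rightarrow> 'b pmf \<Rightarrow> real \<Rightarrow> nat \<Rightarrow> nat" where
  "target_len P Q t n =
     nat \<lfloor>pmf_entropy P / pmf_entropy Q * real n + t * sqrt (real n)\<rfloor>"

definition storage_bits :: "'a pmf \<Rightarrow> real \<Rightarrow> nat \<Rightarrow> real" where
  "storage_bits P s n = pmf_entropy P * real n + s * sqrt (real n)"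

definition asym_fid_det ::
  "'a set \<Rightarrow> 'b set \<Rightarrow> 'a pmf \<Rightarrow> 'b pmf \<Rightarrow> real \<Rightarrow> real \<Rightarrow> ereal" where
  "asym_fid_det X Y P Q s t = liminf (\<lambda>n.
     ereal (fid_det (iid_carrier n X) (iid_carrier (target_len P Q t n) Y)
              (iid_pmf n P) (iid_pmf (target_len P Q t n) Q) (storage_bits P s n)))"

definition asym_fid_maj :: "'b set \<Rightarrow> 'a pmf \<Rightarrow> 'b pmf \<Rightarrow> real \<Rightarrow> real \<Rightarrow> ereal" where
  "asym_fid_maj Y P Q s t = liminf (\<lambda>n.
     ereal (fid_maj (iid_carrier (target_len P Q t n) Y)
              (iid_pmf n P) (iid_pmf (target_len P Q t n) Q) (storage_bits P s n)))"

definition std_normal_cdf :: "real \<Rightarrow> real" where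
  "std_normal_cdf = cdf std_normal_distribution"

definition density_fidelity :: "(real \<Rightarrow> real) \<Rightarrow> (real \<Rightarrow> real) \<Rightarrow> real" where
  "density_fidelity p q = (\<integral>x. sqrt (p x * q x) \<partial>lborel)"

definition admissible :: "real \<Rightarrow> (real \<Rightarrow> real) set" where
  "admissible s = {A. A C1_differentiable_on UNIV \<and> mono A \<and> A s = 1 \<and>
                      (\<forall>x. 0 \<le> A x \<and> std_normal_cdf x \<le> A x \<and> A x \<le> 1)}"

text \<open>
  \<^const>\<open>normal_density\<close> takes the standard deviation, whereas \<open>v\<close> is the variance.
\<close>

definition rayleigh_normal :: "real \<Rightarrow> real \<Rightarrow> real \<Rightarrow> real" where
  "rayleigh_normal v s \<mu> =
     1 - (SUP A\<in>admissible s. (density_fidelity (deriv A) (normal_density \<mu> (sqrt v)))\<^sup>2)"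

end

theory Submission
  imports Defs "HOL-Real_Asymp.Real_Asymp"
begin

text \<open>
  Write \<open>\<Phi>\<close> and \<open>U\<close> for the distribution functions of the normal laws with parameters \<open>(0, 1)\<close> and
  \<open>(\<mu>, v)\<close>, where \<open>\<mu> = t\<^sub>2 D\<close> and \<open>v = C\<close>. On the scale \<open>x \<mapsto> 2\<^bsup>H(P) n + x sqrt(V(P) n)\<^esup>\<close> of ranks and of
  inverse probabilities, the central limit theorem turns the sorted distributions of the source and
  of the target into \<open>\<Phi>\<close> and \<open>U\<close>. Cut the half line below \<open>s\<close> into \<open>k\<close> bins of equal \<open>U\<close>-mass \<open>\<delta>\<close>.

  Converse: majorization makes the cumulative masses \<open>a\<^sub>j\<close> of the output distribution at the grid points
  dominate \<open>\<Phi>\<close>, the storage forces \<open>a\<^sub>k = 1\<close>, and the rearrangement and Cauchy-Schwarz inequalities bound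
  the fidelity by \<open>\<Sum>\<^sub>j sqrt((a\<^sub>j - a\<^sub>j\<^sub>-\<^sub>1) \<delta>)\<close>. Such a discrete profile is smoothed to an admissible \<open>A\<close> of almost
  the same fidelity, because shifting the profile by one bin costs only \<open>O(sqrt \<delta>)\<close>.

  Achievability: an admissible \<open>A\<close> is discretized by Cauchy-Schwarz, and the resulting profile is
  realized, shifted by three bins, by a deterministic map that greedily collects source strings into
  target strings of the same bin; after the shift the source probabilities are exponentially smaller
  than the target probabilities they have to fill, so that rounding is negligible. A deterministic
  conversion is in particular a majorization conversion, so both limits agree.
\<close>

section \<open>Sorted probabilities and greedy allocation\<close>

text \<open>The bins carry equal \<open>U\<close>-mass because every term of the discrete sum is
  then at most 1 / sqrt k, whatever the profile: a fixed number of bins can be given up at a cost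
  that vanishes for large k. This buys two margins. The converse knows a profile only at grid
  points, while an admissible function must dominate \<Phi> everywhere, so mass has to be released
  early. In achievability, the strings light enough for bin j, taken at the level of x_(j+1), have
  mass about 1 - \<Phi>(x_(j+1)) and must supply bin j and all higher ones; a profile shifted by r
  bins demands 1 - a_(j-1+r) from them. For r = 2 the required inequality a_(j+1) \<ge>
  \<Phi>(x_(j+1)) may be an equality, which leaves no room for passing to the limit; r = 3 makes the
  gap strict. The order of limits is k first, then n: for fixed k the central limit theorem is
  applied at finitely many points, so neither rates nor uniformity enter.\<close>

lemma sum_le_sum_lessThan_antimono:
  fixes v :: "nat \<Rightarrow> real"
  assumes "finite I" "card I \<le> l" "antimono v" "\<And>i. 0 \<le> v i"
  shows "sum v I \<le> sum v {..<l}"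
proof -
  have "sum v I \<le> sum v {..<card I}"
    using \<open>finite I\<close>
  proof (induction "card I" arbitrary: I)
    case 0
    then show ?case by simp
  next
    case (Suc c)
    define m where "m = Max I"
    have "I \<noteq> {}" using Suc.hyps by auto
    hence m: "m \<in> I" using Suc.prems by (simp add: m_def)
    \<comment> \<open>The largest of c + 1 distinct naturals is at least c, so its value is at most
      \<open>v c\<close>, the value it is matched with.\<close>
    have "I \<subseteq> {..m}" using Suc.prems by (auto simp: m_def)
    hence "card I \<le> Suc m" using card_mono[of "{..m}" I] by simp
    hence "v m \<le> v c" using Suc.hyps antimonoD[OF assms(3), of c m] by simp
    moreover have "sum v (I - {m}) \<le> sum v {..<c}"
    proof -
      have "c = card (I - {m})" using Suc.hyps(2) m Suc.prems by simp
      thus ?thesis using Suc.hyps(1)[of "I - {m}"] Suc.prems by simp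
    qed
    moreover have "sum v I = v m + sum v (I - {m})"
      using m Suc.prems by (simp add: sum.remove)
    ultimately show ?case by (simp flip: Suc.hyps(2))
  qed
  also have "\<dots> \<le> sum v {..<l}"
    using assms by (intro sum_mono2) auto
  finally show ?thesis .
qed

lemma sum_mult_le_of_partial_sums:
  fixes a a' b :: "nat \<Rightarrow> real"
  assumes "\<And>l. l \<le> n \<Longrightarrow> sum a {..<l} \<le> sum a' {..<l}" "antimono b" "\<And>i. 0 \<le> b i"
  shows "(\<Sum>i<n. a i * b i) \<le> (\<Sum>i<n. a' i * b i)"
proof -
  \<comment> \<open>Abel summation. The boundary term on the left makes the induction close;
    afterwards only its sign is used.\<close>
  have "b n * (sum a' {..<n} - sum a {..<n}) \<le> (\<Sum>i<n. a' i * b i) - (\<Sum>i<n. a i * b i)"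
    using assms(1)
  proof (induction n)
    case (Suc n)
    have "b (Suc n) * (sum a' {..<Suc n} - sum a {..<Suc n}) \<le> b n * (sum a' {..<Suc n} - sum a {..<Suc n})"
      using Suc.prems[of "Suc n"] antimonoD[OF assms(2), of n "Suc n"]
      by (intro mult_right_mono) auto
    also have "\<dots> = b n * (sum a' {..<n} - sum a {..<n}) + (a' n - a n) * b n"
      by (simp add: algebra_simps)
    also have "\<dots> \<le> (\<Sum>i<Suc n. a' i * b i) - (\<Sum>i<Suc n. a i * b i)"
      using Suc.IH Suc.prems by (simp add: algebra_simps)
    finally show ?case .
  qed simp
  moreover have "0 \<le> b n * (sum a' {..<n} - sum a {..<n})"
    using assms(1)[of n] assms(3) by simp
  ultimately show ?thesis by linarith
qed

lemma pmf_enumeration: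
  assumes "finite (set_pmf P)"
  obtains zs where "distinct zs" "set zs = set_pmf P" "map (pmf P) zs = sorted_probs P"
proof -
  obtain xs where xs: "distinct xs" "set xs = set_pmf P"
    using finite_distinct_list[OF assms] by blast
  have "sorted_list_of_multiset (image_mset (pmf P) (mset_set (set_pmf P))) = map (pmf P) (sort_key (pmf P) xs)"
  proof -
    have "mset_set (set_pmf P) = mset xs" using xs mset_set_set by metis
    hence "image_mset (pmf P) (mset_set (set_pmf P)) = mset (map (pmf P) (sort_key (pmf P) xs))"
      by simp
    thus ?thesis
      by (simp only: sorted_list_of_multiset_mset sorted_sort_id[OF sorted_sort_key])
  qed
  hence "map (pmf P) (rev (sort_key (pmf P) xs)) = sorted_probs P"
    by (simp add: sorted_probs_def rev_map)
  with xs show ?thesis by (intro that[of "rev (sort_key (pmf P) xs)"]) auto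
qed

lemma sorted_prob_nonneg: "0 \<le> sorted_prob P i"
proof (cases "i < length (sorted_probs P)")
  case True
  hence "sorted_probs P ! i \<in> set (sorted_probs P)" by simp
  also have "\<dots> \<subseteq> range (pmf P)"
    by (cases "finite (set_pmf P)") (auto simp: sorted_probs_def)
  finally show ?thesis using True by (auto simp: sorted_prob_def)
qed (simp add: sorted_prob_def)

lemma antimono_sorted_prob: "antimono (sorted_prob P)"
proof (rule antimonoI)
  fix i j :: nat assume "i \<le> j"
  have s: "sorted (rev (sorted_probs P))" by (simp add: sorted_probs_def)
  show "sorted_prob P j \<le> sorted_prob P i"
  proof (cases "j < length (sorted_probs P)")
    case True
    thus ?thesis using \<open>i \<le> j\<close> sorted_rev_nth_mono[OF s] by (simp add: sorted_prob_def)
  next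
    case False
    thus ?thesis using sorted_prob_nonneg[of P i] by (simp add: sorted_prob_def)
  qed
qed

text \<open>The Lorenz curve of \<open>P\<close>, read from the largest value down; majorization is
  its pointwise order.\<close>

definition top_sum :: "'a pmf \<Rightarrow> nat \<Rightarrow> real" where
  "top_sum P l = (\<Sum>i<l. sorted_prob P i)"

lemma majorized_iff_top_sum: "majorized P Q \<longleftrightarrow> (\<forall>l. top_sum P l \<le> top_sum Q l)"
  by (simp add: majorized_def top_sum_def)

lemma top_sum_mono: "l \<le> l' \<Longrightarrow> top_sum P l \<le> top_sum P l'"
  unfolding top_sum_def by (intro sum_mono2) (auto simp: sorted_prob_nonneg)

lemma top_sum_nonneg: "0 \<le> top_sum P l"
  unfolding top_sum_def by (intro sum_nonneg) (auto simp: sorted_prob_nonneg)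

text \<open>Stated for a monotone \<open>\<phi>\<close> because two instances are used: the identity
  for masses and the square root for the fidelity. By \<open>\<phi> 0 = 0\<close>, outcomes off the
  support contribute nothing, and the others occupy at most \<open>l\<close> distinct ranks.\<close>

lemma sum_le_sum_sorted_prob:
  fixes \<phi> :: "real \<Rightarrow> real"
  assumes "finite (set_pmf P)" "finite S" "card S \<le> l"
    and "mono \<phi>" "\<phi> 0 = 0"
  shows "(\<Sum>y\<in>S. \<phi> (pmf P y)) \<le> (\<Sum>i<l. \<phi> (sorted_prob P i))"
proof -
  obtain zs where zs: "distinct zs" "set zs = set_pmf P" "map (pmf P) zs = sorted_probs P"
    using pmf_enumeration[OF assms(1)] by blast
  define I where "I = {i. i < length zs \<and> zs ! i \<in> S}"
  have bij: "bij_betw ((!) zs) I (S \<inter> set_pmf P)"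
    unfolding bij_betw_def
  proof (intro conjI)
    show "inj_on ((!) zs) I" using zs(1) by (auto simp: inj_on_def I_def nth_eq_iff_index_eq)
    show "(!) zs ` I = S \<inter> set_pmf P"
    proof (intro equalityI subsetI)
      fix y assume "y \<in> (!) zs ` I"
      thus "y \<in> S \<inter> set_pmf P" unfolding zs(2)[symmetric] by (auto simp: I_def)
    next
      fix y assume y: "y \<in> S \<inter> set_pmf P"
      hence "y \<in> set zs" using zs(2) by simp
      then obtain i where "i < length zs" "zs ! i = y" by (auto simp: in_set_conv_nth)
      thus "y \<in> (!) zs ` I" using y by (auto simp: I_def)
    qed
  qed
  have len: "length zs = length (sorted_probs P)" using zs(3) by (metis length_map)
  have val: "sorted_prob P i = pmf P (zs ! i)" if "i < length zs" for i
    using that len zs(3) by (metis nth_map sorted_prob_def)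
  have fI: "finite I" by (simp add: I_def)
  have "(\<Sum>y\<in>S. \<phi> (pmf P y)) = (\<Sum>y\<in>S \<inter> set_pmf P. \<phi> (pmf P y))"
    using assms(2,5) by (intro sum.mono_neutral_right) (auto simp: set_pmf_iff)
  also have "\<dots> = (\<Sum>i\<in>I. \<phi> (pmf P (zs ! i)))"
    by (rule sum.reindex_bij_betw[OF bij, symmetric])
  also have "\<dots> = (\<Sum>i\<in>I. \<phi> (sorted_prob P i))"
    by (rule sum.cong) (auto simp: I_def val)
  also have "\<dots> \<le> (\<Sum>i<l. \<phi> (sorted_prob P i))"
  proof (rule sum_le_sum_lessThan_antimono[OF fI])
    have "card I = card (S \<inter> set_pmf P)" using bij by (rule bij_betw_same_card)
    also have "\<dots> \<le> card S" using assms(2) by (intro card_mono) auto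
    finally show "card I \<le> l" using assms(3) by simp
    show "antimono (\<lambda>i. \<phi> (sorted_prob P i))"
      using antimono_sorted_prob[of P] assms(4) by (auto simp: monotone_on_def)
    show "0 \<le> \<phi> (sorted_prob P i)" for i
      using monoD[OF assms(4) sorted_prob_nonneg[of P i]] assms(5) by simp
  qed
  finally show ?thesis .
qed

lemma sum_pmf_le_top_sum:
  assumes "finite (set_pmf P)" "finite S" "card S \<le> l"
  shows "sum (pmf P) S \<le> top_sum P l"
  using sum_le_sum_sorted_prob[OF assms, of "\<lambda>x. x"] by (simp add: top_sum_def monoI)

lemma top_sum_attained:
  assumes "finite (set_pmf P)"
  obtains S where "S \<subseteq> set_pmf P" "card S \<le> l" "sum (pmf P) S = top_sum P l"
proof -
  obtain zs where zs: "distinct zs" "set zs = set_pmf P" "map (pmf P) zs = sorted_probs P"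
    using pmf_enumeration[OF assms(1)] by blast
  have len: "length zs = length (sorted_probs P)" using zs(3) by (metis length_map)
  have val: "sorted_prob P i = pmf P (zs ! i)" if "i < length zs" for i
    using that len zs(3) by (metis nth_map sorted_prob_def)
  define S where "S = (!) zs ` {..<min l (length zs)}"
  have inj: "inj_on ((!) zs) {..<min l (length zs)}"
    using zs(1) by (auto simp: inj_on_def nth_eq_iff_index_eq)
  have "sum (pmf P) S = (\<Sum>i<min l (length zs). sorted_prob P i)"
    unfolding S_def sum.reindex[OF inj] by (intro sum.cong) (auto simp: val)
  also have "\<dots> = top_sum P l"
    unfolding top_sum_def
    by (intro sum.mono_neutral_left) (auto simp: sorted_prob_def len)
  finally have "sum (pmf P) S = top_sum P l" .
  moreover have "card S \<le> l"
    unfolding S_def using card_image_le[of "{..<min l (length zs)}" "(!) zs"] by simp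
  moreover have "S \<subseteq> set_pmf P" unfolding zs(2)[symmetric] S_def by auto
  ultimately show ?thesis using that by blast
qed

lemma top_sum_le_1:
  assumes "finite (set_pmf P)"
  shows "top_sum P l \<le> 1"
proof -
  obtain S where "S \<subseteq> set_pmf P" "sum (pmf P) S = top_sum P l"
    using top_sum_attained[OF assms] by metis
  moreover have "sum (pmf P) S \<le> sum (pmf P) (set_pmf P)"
    using calculation assms by (intro sum_mono2) auto
  ultimately show ?thesis using assms sum_pmf_eq_1[of "set_pmf P" P] by simp
qed

lemma top_sum_eq_1:
  assumes "finite (set_pmf P)" "card (set_pmf P) \<le> l"
  shows "top_sum P l = 1"
  using sum_pmf_le_top_sum[OF assms(1,1,2)] top_sum_le_1[OF assms(1), of l]
    sum_pmf_eq_1[of "set_pmf P" P] assms(1) by simp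

text \<open>A heaviest set \<open>S\<close> of at most \<open>l\<close> outcomes is sent to at most
  \<open>l\<close> points, and the preimage of these points contains \<open>S\<close>.\<close>

lemma majorized_map_pmf:
  assumes "finite (set_pmf P)"
  shows "majorized P (map_pmf f P)"
  unfolding majorized_iff_top_sum
proof
  fix l
  obtain S where S: "S \<subseteq> set_pmf P" "card S \<le> l" "sum (pmf P) S = top_sum P l"
    using top_sum_attained[OF assms] by metis
  have fS: "finite S" using S(1) assms finite_subset by blast
  have "top_sum P l = measure P S"
    using S(3) fS by (simp add: measure_measure_pmf_finite)
  also have "\<dots> \<le> measure P (f -` f ` S)"
    by (intro measure_pmf.finite_measure_mono) auto
  also have "\<dots> = measure (map_pmf f P) (f ` S)" by simp
  also have "\<dots> = sum (pmf (map_pmf f P)) (f ` S)"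
    using fS by (intro measure_measure_pmf_finite) simp
  also have "\<dots> \<le> top_sum (map_pmf f P) l"
    using assms fS S(2) card_image_le[OF fS, of f]
    by (intro sum_pmf_le_top_sum) auto
  finally show "top_sum P l \<le> top_sum (map_pmf f P) l" .
qed

text \<open>Rearrangement: list the outcomes in the order of \<open>Q\<close>. Along any initial
  stretch of this list the roots of \<open>P\<close> add up to at most those of its largest values,
  and Abel summation against the decreasing roots of \<open>Q\<close> does the rest.\<close>

lemma fidelity_le_sorted:
  assumes "finite (set_pmf P)" "finite (set_pmf Q)" "finite Y" "card (set_pmf Q) \<le> l"
  shows "fidelity Y P Q \<le> (\<Sum>i<l. sqrt (sorted_prob P i) * sqrt (sorted_prob Q i))"
proof -
  obtain zs where zs: "distinct zs" "set zs = set_pmf Q" "map (pmf Q) zs = sorted_probs Q"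
    using pmf_enumeration[OF assms(2)] by blast
  have len: "length zs = length (sorted_probs Q)" using zs(3) by (metis length_map)
  have val: "sorted_prob Q i = pmf Q (zs ! i)" if "i < length zs" for i
    using that len zs(3) by (metis nth_map sorted_prob_def)
  have "length zs = card (set_pmf Q)" using zs(1,2) distinct_card by metis
  hence lenl: "length zs \<le> l" using assms(4) by simp
  have bij: "bij_betw ((!) zs) {..<length zs} (set_pmf Q)"
    using zs by (intro bij_betw_nth) auto
  have "fidelity Y P Q \<le> (\<Sum>y\<in>set_pmf Q. sqrt (pmf P y) * sqrt (pmf Q y))"
  proof -
    have "fidelity Y P Q = (\<Sum>y\<in>Y \<inter> set_pmf Q. sqrt (pmf P y) * sqrt (pmf Q y))"
      unfolding fidelity_def using assms(3)
      by (intro sum.mono_neutral_right) (auto simp: set_pmf_iff)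
    also have "\<dots> \<le> (\<Sum>y\<in>set_pmf Q. sqrt (pmf P y) * sqrt (pmf Q y))"
      using assms(2) by (intro sum_mono2) auto
    finally show ?thesis .
  qed
  also have "\<dots> = (\<Sum>i<length zs. sqrt (pmf P (zs ! i)) * sqrt (pmf Q (zs ! i)))"
    by (rule sum.reindex_bij_betw[OF bij, symmetric])
  also have "\<dots> = (\<Sum>i<length zs. sqrt (pmf P (zs ! i)) * sqrt (sorted_prob Q i))"
    by (intro sum.cong) (auto simp: val)
  also have "\<dots> \<le> (\<Sum>i<length zs. sqrt (sorted_prob P i) * sqrt (sorted_prob Q i))"
  proof (rule sum_mult_le_of_partial_sums)
    show "antimono (\<lambda>i. sqrt (sorted_prob Q i))"
      using antimono_sorted_prob[of Q] by (auto simp: monotone_on_def)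
    fix k assume k: "k \<le> length zs"
    have inj: "inj_on ((!) zs) {..<k}"
      using zs(1) k by (auto simp: inj_on_def nth_eq_iff_index_eq)
    have "(\<Sum>i<k. sqrt (pmf P (zs ! i))) = (\<Sum>y\<in>(!) zs ` {..<k}. sqrt (pmf P y))"
      by (simp add: sum.reindex[OF inj])
    also have "\<dots> \<le> (\<Sum>i<k. sqrt (sorted_prob P i))"
      using assms(1) card_image_le[of "{..<k}" "(!) zs"]
      by (intro sum_le_sum_sorted_prob) (auto intro: monoI)
    finally show "(\<Sum>i<k. sqrt (pmf P (zs ! i))) \<le> (\<Sum>i<k. sqrt (sorted_prob P i))" .
  qed (simp add: sorted_prob_nonneg)
  also have "\<dots> \<le> (\<Sum>i<l. sqrt (sorted_prob P i) * sqrt (sorted_prob Q i))"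
    using lenl by (intro sum_mono2) (auto simp: sorted_prob_nonneg)
  finally show ?thesis .
qed

section \<open>Subset sums and the allocation of source outcomes\<close>

text \<open>Adding the elements one at a time, the last sum before \<open>\<tau>\<close> is passed
  falls short of it by at most one weight.\<close>

lemma exists_subset_sum_between:
  fixes w :: "'a \<Rightarrow> real"
  assumes "finite S" "\<And>x. x \<in> S \<Longrightarrow> 0 \<le> w x" "\<And>x. x \<in> S \<Longrightarrow> w x \<le> \<kappa>"
    and "0 \<le> \<tau>" "\<tau> \<le> sum w S" "0 \<le> \<kappa>"
  obtains R where "R \<subseteq> S" "sum w R \<le> \<tau>" "\<tau> - \<kappa> \<le> sum w R"
proof -
  have "\<exists>R\<subseteq>S. sum w R \<le> \<tau> \<and> \<tau> - \<kappa> \<le> sum w R"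
    using assms(1,2,3,5)
  proof (induction S)
    case empty
    thus ?case using assms(4,6) by (intro exI[of _ "{}"]) auto
  next
    case (insert x S)
    show ?case
    proof (cases "\<tau> \<le> sum w S")
      case True
      thus ?thesis using insert.IH insert.prems by (meson insertCI subset_insertI2)
    next
      case False
      have "\<tau> \<le> w x + sum w S" "w x \<le> \<kappa>" using insert.prems insert.hyps by auto
      hence "\<tau> - \<kappa> \<le> sum w S" by linarith
      thus ?thesis using False by (intro exI[of _ S] conjI) auto
    qed
  qed
  thus ?thesis using that by blast
qed

text \<open>Demands are served in order of increasing threshold, so that the scarce small weights are
  not used up by demands that could be met with larger ones.\<close>
lemma greedy_allocation:
  fixes w :: "'a \<Rightarrow> real" and \<tau> \<kappa> :: "'b \<Rightarrow> real"
  assumes "finite T" and X: "finite X" "\<And>x. x \<in> X \<Longrightarrow> 0 \<le> w x"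
    and "\<And>y. y \<in> T \<Longrightarrow> 0 \<le> \<tau> y" "\<And>y. y \<in> T \<Longrightarrow> 0 \<le> \<kappa> y"
    and "\<And>y\<^sub>0. y\<^sub>0 \<in> T \<Longrightarrow> (\<Sum>y\<in>{y\<in>T. \<kappa> y \<le> \<kappa> y\<^sub>0}. \<tau> y) \<le> (\<Sum>x\<in>{x\<in>X. w x \<le> \<kappa> y\<^sub>0}. w x)"
  shows "\<exists>S. (\<forall>y\<in>T. S y \<subseteq> X \<and> sum w (S y) \<le> \<tau> y \<and> \<tau> y - \<kappa> y \<le> sum w (S y))
           \<and> disjoint_family_on S T"
  using assms(1,4-6)
proof (induction T rule: finite_ranking_induct[where f = \<kappa>])
  case empty
  then show ?case by (auto simp: disjoint_family_on_def)
next
  case (insert y\<^sub>1 T)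
  show ?case
  proof (cases "y\<^sub>1 \<in> T")
    case True
    hence eq: "insert y\<^sub>1 T = T" by auto
    show ?thesis unfolding eq
      by (rule insert.IH) (use insert.prems[unfolded eq] in blast)+
  next
    case False
    have "\<exists>S. (\<forall>y\<in>T. S y \<subseteq> X \<and> sum w (S y) \<le> \<tau> y \<and> \<tau> y - \<kappa> y \<le> sum w (S y))
           \<and> disjoint_family_on S T"
    proof (rule insert.IH)
      fix y\<^sub>0 assume y0: "y\<^sub>0 \<in> T"
      have "(\<Sum>y\<in>{y\<in>T. \<kappa> y \<le> \<kappa> y\<^sub>0}. \<tau> y) \<le> (\<Sum>y\<in>{y\<in>insert y\<^sub>1 T. \<kappa> y \<le> \<kappa> y\<^sub>0}. \<tau> y)"
        using insert.hyps insert.prems by (intro sum_mono2) auto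
      also have "\<dots> \<le> (\<Sum>x\<in>{x\<in>X. w x \<le> \<kappa> y\<^sub>0}. w x)" using insert.prems(3) y0 by blast
      finally show "(\<Sum>y\<in>{y\<in>T. \<kappa> y \<le> \<kappa> y\<^sub>0}. \<tau> y) \<le> (\<Sum>x\<in>{x\<in>X. w x \<le> \<kappa> y\<^sub>0}. w x)" .
    qed (use insert.prems in auto)
    then obtain S where S: "\<And>y. y \<in> T \<Longrightarrow> S y \<subseteq> X" "\<And>y. y \<in> T \<Longrightarrow> sum w (S y) \<le> \<tau> y"
      "\<And>y. y \<in> T \<Longrightarrow> \<tau> y - \<kappa> y \<le> sum w (S y)" "disjoint_family_on S T" by blast
    \<comment> \<open>The admissible weights that no earlier demand has taken. As
      \<open>y\<^sub>1\<close> has the largest threshold, the hypothesis at \<open>y\<^sub>1\<close>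
      bounds the total demand, of which the earlier ones took at most \<open>sum \<tau> T\<close>;
      so \<open>A\<close> still holds \<open>\<tau> y\<^sub>1\<close>.\<close>
    define A where "A = {x\<in>X. w x \<le> \<kappa> y\<^sub>1} - (\<Union>y\<in>T. S y)"
    have finS: "finite (S y)" if "y \<in> T" for y using S(1)[OF that] X(1) finite_subset by blast
    have "{y\<in>insert y\<^sub>1 T. \<kappa> y \<le> \<kappa> y\<^sub>1} = insert y\<^sub>1 T" using insert.hyps by auto
    hence "\<tau> y\<^sub>1 + sum \<tau> T \<le> (\<Sum>x\<in>{x\<in>X. w x \<le> \<kappa> y\<^sub>1}. w x)"
      using insert.prems(3)[of y\<^sub>1] False insert.hyps by simp
    also have "\<dots> \<le> (\<Sum>x\<in>A \<union> (\<Union>y\<in>T. S y). w x)"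
    proof (rule sum_mono2)
      show "finite (A \<union> (\<Union>y\<in>T. S y))" using insert.hyps finS X(1) by (auto simp: A_def)
      show "{x \<in> X. w x \<le> \<kappa> y\<^sub>1} \<subseteq> A \<union> \<Union> (S ` T)" by (auto simp: A_def)
      show "0 \<le> w b" if "b \<in> A \<union> \<Union> (S ` T) - {x \<in> X. w x \<le> \<kappa> y\<^sub>1}" for b
        using that S(1) X(2) by (auto simp: A_def)
    qed
    also have "\<dots> = sum w A + sum w (\<Union>y\<in>T. S y)"
      using insert.hyps finS X(1) by (intro sum.union_disjoint) (auto simp: A_def)
    also have "sum w (\<Union>y\<in>T. S y) = (\<Sum>y\<in>T. sum w (S y))"
      using insert.hyps finS S(4) by (intro sum.UNION_disjoint_family) auto
    also have "\<dots> \<le> sum \<tau> T" by (intro sum_mono S(2))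
    finally have le: "\<tau> y\<^sub>1 \<le> sum w A" by simp
    have fA: "finite A" using X(1) by (simp add: A_def)
    have A: "0 \<le> w x" "w x \<le> \<kappa> y\<^sub>1" if "x \<in> A" for x using that X(2) by (simp_all add: A_def)
    have pos: "0 \<le> \<tau> y\<^sub>1" "0 \<le> \<kappa> y\<^sub>1" using insert.prems(1,2) by simp_all
    obtain R where R: "R \<subseteq> A" "sum w R \<le> \<tau> y\<^sub>1" "\<tau> y\<^sub>1 - \<kappa> y\<^sub>1 \<le> sum w R"
      using exists_subset_sum_between[OF fA A pos(1) le pos(2)] by metis
    define S' where "S' = S(y\<^sub>1 := R)"
    have S'T: "S' y = S y" if "y \<in> T" for y using that False by (auto simp: S'_def)
    have "disjoint_family_on S' (insert y\<^sub>1 T)"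
    proof -
      have "R \<inter> (\<Union>y\<in>T. S y) = {}" using R(1) by (auto simp: A_def)
      hence "S' y\<^sub>1 \<inter> (\<Union>y\<in>T. S' y) = {}" using S'T by (simp add: S'_def)
      moreover have "disjoint_family_on S' T"
        using S(4) S'T by (simp add: disjoint_family_on_def)
      ultimately show ?thesis using False by (simp add: disjoint_family_on_insert)
    qed
    moreover have "\<forall>y\<in>insert y\<^sub>1 T. S' y \<subseteq> X \<and> sum w (S' y) \<le> \<tau> y \<and> \<tau> y - \<kappa> y \<le> sum w (S' y)"
      using S R S'T by (auto simp: S'_def A_def)
    ultimately show ?thesis by blast
  qed
qed

section \<open>The central limit theorem for product distributions\<close>

interpretation std_normal: real_distribution std_normal_distribution
  by (rule real_dist_normal_dist)

lemma std_normal_cdf_mono: "x \<le> y \<Longrightarrow> std_normal_cdf x \<le> std_normal_cdf y"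
  unfolding std_normal_cdf_def by (rule std_normal.cdf_nondecreasing)

lemma std_normal_cdf_nonneg: "0 \<le> std_normal_cdf x"
  unfolding std_normal_cdf_def by (rule std_normal.cdf_nonneg)

lemma std_normal_cdf_le_1: "std_normal_cdf x \<le> 1"
  unfolding std_normal_cdf_def by (rule std_normal.cdf_bounded_prob)

lemma std_normal_cdf_at_bot: "(std_normal_cdf \<longlongrightarrow> 0) at_bot"
  unfolding std_normal_cdf_def by (rule std_normal.cdf_lim_at_bot)

lemma std_normal_cdf_at_top: "(std_normal_cdf \<longlongrightarrow> 1) at_top"
  unfolding std_normal_cdf_def by (rule std_normal.cdf_lim_at_top_prob)

lemma continuous_on_normal_density: "\<sigma> \<noteq> 0 \<Longrightarrow> continuous_on S (normal_density \<mu> \<sigma>)"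
  unfolding normal_density_def by (intro continuous_intros) auto

lemma std_normal_cdf_diff:
  assumes "a < b"
  shows "std_normal_cdf b - std_normal_cdf a = integral {a..b} std_normal_density"
proof -
  have int: "set_integrable lborel {a..b} std_normal_density"
    by (rule borel_integrable_atLeastAtMost') (rule continuous_on_normal_density, simp)
  have "std_normal_cdf b - std_normal_cdf a = measure std_normal_distribution {a<..b}"
    unfolding std_normal_cdf_def by (rule std_normal.cdf_diff_eq[OF assms])
  also have "\<dots> = (LINT x|std_normal_distribution. indicator {a<..b} x)"
    by simp
  also have "\<dots> = (LINT x|lborel. std_normal_density x * indicator {a<..b} x)"
    by (subst integral_density) auto
  also have "\<dots> = (LINT x:{a<..b}|lborel. std_normal_density x)"
    unfolding set_lebesgue_integral_def by (simp add: mult.commute)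
  also have "\<dots> = (LBINT x=ereal a..ereal b. std_normal_density x)"
    using assms by (subst interval_integral_Ioc) auto
  also have "\<dots> = integral {a..b} std_normal_density"
    using assms int by (subst interval_integral_eq_integral) auto
  finally show ?thesis .
qed

lemma std_normal_cdf_DERIV: "(std_normal_cdf has_real_derivative std_normal_density x) (at x)"
proof -
  define a where "a = x - 1"
  have "((\<lambda>u. integral {a..u} std_normal_density) has_real_derivative std_normal_density x) (at x within {a..x+1})"
    by (rule integral_has_real_derivative) (auto intro!: continuous_on_normal_density simp: a_def)
  hence "((\<lambda>u. integral {a..u} std_normal_density) has_real_derivative std_normal_density x) (at x)"
    by (subst (asm) at_within_Icc_at) (auto simp: a_def)
  hence "((\<lambda>u. std_normal_cdf a + integral {a..u} std_normal_density) has_real_derivative std_normal_density x) (at x)"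
    by (auto intro!: derivative_eq_intros)
  thus ?thesis
  proof (rule DERIV_cong_ev[OF refl _ refl, THEN iffD1, rotated])
    have "eventually (\<lambda>u. u \<in> {a<..}) (nhds x)"
      by (rule eventually_nhds_in_open) (auto simp: a_def)
    thus "eventually (\<lambda>u. std_normal_cdf a + integral {a..u} std_normal_density = std_normal_cdf u) (nhds x)"
      by eventually_elim (simp flip: std_normal_cdf_diff)
  qed
qed

lemma isCont_std_normal_cdf: "isCont std_normal_cdf x"
  using std_normal_cdf_DERIV by (rule DERIV_isCont)

text \<open>The central limit theorem speaks of one infinite sequence on one space, whereas
  \<open>iid_pmf n P\<close> is a different space for each \<open>n\<close>. The transfer goes
  through characteristic functions: for both sums it is the n-th power of the one of
  \<open>f\<close> under \<open>P\<close>.\<close>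

lemma distr_sum_iid:
  fixes f :: "'a \<Rightarrow> real" and n :: nat
  shows "distr (measure_pmf (iid_pmf n P)) borel (\<lambda>y. \<Sum>i<n. f (y i)) =
         distr (PiM UNIV (\<lambda>_::nat. measure_pmf P)) borel (\<lambda>\<omega>. \<Sum>i<n. f (\<omega> i))"
    and "prob_space.indep_vars (PiM UNIV (\<lambda>_::nat. measure_pmf P)) (\<lambda>_. borel) (\<lambda>i \<omega>. f (\<omega> i)) UNIV"
    and "distr (PiM UNIV (\<lambda>_::nat. measure_pmf P)) borel (\<lambda>\<omega>. f (\<omega> i)) = distr (measure_pmf P) borel f"
proof -
  let ?M = "PiM UNIV (\<lambda>_::nat. measure_pmf P)"
  interpret M: product_prob_space "\<lambda>_::nat. measure_pmf P" UNIV
    by unfold_locales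
  have [measurable]: "(\<lambda>\<omega>. \<omega> i) \<in> measurable ?M (measure_pmf P)" for i :: nat
    by (rule measurable_component_singleton) simp
  have [measurable]: "(\<lambda>\<omega>. f (\<omega> i)) \<in> borel_measurable ?M" for i :: nat
    by (rule measurable_compose[of "\<lambda>\<omega>. \<omega> i" _ "measure_pmf P"]) simp_all
  have comp: "distr ?M borel (\<lambda>\<omega>. f (\<omega> i)) = distr (measure_pmf P) borel f" for i :: nat
  proof -
    have "distr ?M borel (\<lambda>\<omega>. f (\<omega> i)) = distr (distr ?M (measure_pmf P) (\<lambda>\<omega>. \<omega> i)) borel f"
      by (subst distr_distr) (auto simp: comp_def)
    thus ?thesis by (simp add: M.PiM_component)
  qed
  have "M.indep_vars (\<lambda>_. measure_pmf P) (\<lambda>i \<omega>. \<omega> i) UNIV"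
    by (subst M.indep_vars_iff_distr_eq_PiM) (simp_all add: M.PiM_component restrict_def distr_id)
  hence indM: "M.indep_vars (\<lambda>_. borel) (\<lambda>i \<omega>. f (\<omega> i)) UNIV"
    by (rule M.indep_vars_compose2) simp
  hence indM': "M.indep_vars (\<lambda>_. borel) (\<lambda>i \<omega>. f (\<omega> i)) {..<n}"
    by (rule M.indep_vars_subset) simp
  have "prob_space.indep_vars (measure_pmf (iid_pmf n P)) (\<lambda>_. count_space UNIV) (\<lambda>i y. y i) {..<n}"
    unfolding iid_pmf_def by (rule indep_vars_Pi_pmf) simp
  hence indN: "prob_space.indep_vars (measure_pmf (iid_pmf n P)) (\<lambda>_. borel) (\<lambda>i y. f (y i)) {..<n}"
    by (rule prob_space.indep_vars_compose2[OF measure_pmf.prob_space_axioms]) simp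
  have compN: "distr (measure_pmf (iid_pmf n P)) borel (\<lambda>y. f (y i)) = distr (measure_pmf P) borel f"
    if "i < n" for i
  proof -
    have "distr (measure_pmf (iid_pmf n P)) borel (\<lambda>y. f (y i)) =
          distr (distr (measure_pmf (iid_pmf n P)) (count_space UNIV) (\<lambda>y. y i)) borel f"
      by (subst distr_distr) (auto simp: comp_def)
    also have "distr (measure_pmf (iid_pmf n P)) (count_space UNIV) (\<lambda>y. y i) = measure_pmf P"
      using that by (simp add: iid_pmf_def Pi_pmf_component flip: map_pmf_rep_eq)
    finally show ?thesis .
  qed
  show "M.indep_vars (\<lambda>_. borel) (\<lambda>i \<omega>. f (\<omega> i)) UNIV" by (rule indM)
  show "distr ?M borel (\<lambda>\<omega>. f (\<omega> i)) = distr (measure_pmf P) borel f" by (rule comp)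
  show "distr (measure_pmf (iid_pmf n P)) borel (\<lambda>y. \<Sum>i<n. f (y i)) =
        distr ?M borel (\<lambda>\<omega>. \<Sum>i<n. f (\<omega> i))"
  proof (rule Levy_uniqueness)
    show "real_distribution (distr (measure_pmf (iid_pmf n P)) borel (\<lambda>y. \<Sum>i<n. f (y i)))"
      by (rule prob_space.real_distribution_distr[OF measure_pmf.prob_space_axioms]) simp
    show "real_distribution (distr ?M borel (\<lambda>\<omega>. \<Sum>i<n. f (\<omega> i)))"
      by (rule M.real_distribution_distr) measurable
    show "char (distr (measure_pmf (iid_pmf n P)) borel (\<lambda>y. \<Sum>i<n. f (y i))) =
          char (distr ?M borel (\<lambda>\<omega>. \<Sum>i<n. f (\<omega> i)))"
      by (intro ext) (simp add: prob_space.char_distr_sum[OF measure_pmf.prob_space_axioms indN] M.char_distr_sum[OF indM'] comp compN)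
  qed
qed

lemma clt_iid_pmf:
  fixes f :: "'a \<Rightarrow> real"
  assumes fin: "finite (set_pmf P)"
    and m: "(\<Sum>x\<in>set_pmf P. pmf P x * f x) = m"
    and v: "(\<Sum>x\<in>set_pmf P. pmf P x * (f x - m)\<^sup>2) = v" "v > 0"
  shows "(\<lambda>n. measure (iid_pmf n P) {y. (\<Sum>i<n. f (y i) - m) / sqrt (real n * v) \<le> z})
           \<longlonglongrightarrow> std_normal_cdf z"
proof -
  let ?M = "PiM UNIV (\<lambda>_::nat. measure_pmf P)"
  let ?X = "\<lambda>i \<omega>. f (\<omega> i)"
  interpret M: product_prob_space "\<lambda>_::nat. measure_pmf P" UNIV
    by unfold_locales
  have [measurable]: "(\<lambda>\<omega>. f (\<omega> i)) \<in> borel_measurable ?M" for i :: nat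
    by (rule measurable_compose[of "\<lambda>\<omega>. \<omega> i" _ "measure_pmf P"])
       (simp_all add: measurable_component_singleton)
  have trans: "(LINT \<omega>|?M. g (f (\<omega> i))) = (\<Sum>x\<in>set_pmf P. pmf P x * g (f x))"
    if [measurable]: "g \<in> borel_measurable borel" for g :: "real \<Rightarrow> real" and i :: nat
  proof -
    have "(LINT \<omega>|?M. g (f (\<omega> i))) = (LINT x|distr ?M borel (\<lambda>\<omega>. f (\<omega> i)). g x)"
      by (subst integral_distr) auto
    also have "\<dots> = (LINT x|distr (measure_pmf P) borel f. g x)"
      by (simp only: distr_sum_iid(3))
    also have "\<dots> = (LINT x|measure_pmf P. g (f x))"
      by (subst integral_distr) auto
    also have "\<dots> = (\<Sum>x\<in>set_pmf P. pmf P x * g (f x))"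
      using fin by (subst integral_measure_pmf[of "set_pmf P"]) auto
    finally show ?thesis .
  qed
  have int: "integrable ?M (\<lambda>\<omega>. (f (\<omega> i))\<^sup>2)" for i :: nat
  proof -
    have "integrable (distr (measure_pmf P) borel f) (\<lambda>x. x\<^sup>2)"
      using fin by (subst integrable_distr_eq) (auto intro: integrable_measure_pmf_finite)
    hence "integrable (distr ?M borel (\<lambda>\<omega>. f (\<omega> i))) (\<lambda>x. x\<^sup>2)"
      by (simp only: distr_sum_iid(3))
    thus ?thesis by (subst (asm) integrable_distr_eq) auto
  qed
  have mean: "M.expectation (?X i) = m" for i using trans[of "\<lambda>x. x" i] m by simp
  have "weak_conv_m (\<lambda>n. distr ?M borel (\<lambda>\<omega>. (\<Sum>i<n. ?X i \<omega> - m) / sqrt (real n * (sqrt v)\<^sup>2)))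
          std_normal_distribution"
  proof (rule M.central_limit_theorem)
    show "M.indep_vars (\<lambda>_. borel) ?X UNIV" by (rule distr_sum_iid(2))
    show "sqrt v > 0" using v by simp
    show "M.variance (?X i) = (sqrt v)\<^sup>2" for i
      using trans[of "\<lambda>x. (x - m)\<^sup>2" i] v by (simp add: mean)
    show "distr ?M borel (?X i) = distr (measure_pmf P) borel f" for i by (rule distr_sum_iid(3))
  qed (simp_all add: mean int)
  hence "(\<lambda>n. cdf (distr ?M borel (\<lambda>\<omega>. (\<Sum>i<n. ?X i \<omega> - m) / sqrt (real n * (sqrt v)\<^sup>2))) z)
          \<longlonglongrightarrow> std_normal_cdf z"
    using isCont_std_normal_cdf[of z]
    unfolding weak_conv_m_def weak_conv_def std_normal_cdf_def by blast
  moreover have "cdf (distr ?M borel (\<lambda>\<omega>. (\<Sum>i<n. ?X i \<omega> - m) / sqrt (real n * (sqrt v)\<^sup>2))) z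
      = measure (iid_pmf n P) {y. (\<Sum>i<n. f (y i) - m) / sqrt (real n * v) \<le> z}" for n
  proof -
    have "distr ?M borel (\<lambda>\<omega>. (\<Sum>i<n. ?X i \<omega> - m) / sqrt (real n * (sqrt v)\<^sup>2)) =
          distr (distr ?M borel (\<lambda>\<omega>. \<Sum>i<n. ?X i \<omega> - m)) borel (\<lambda>x. x / sqrt (n * v))"
      using v by (subst distr_distr) (auto simp: comp_def)
    also have "\<dots> = distr (distr (measure_pmf (iid_pmf n P)) borel (\<lambda>y. \<Sum>i<n. f (y i) - m)) borel (\<lambda>x. x / sqrt (n * v))"
      using distr_sum_iid(1)[of n P "\<lambda>x. f x - m"] by simp
    also have "\<dots> = distr (measure_pmf (iid_pmf n P)) borel (\<lambda>y. (\<Sum>i<n. f (y i) - m) / sqrt (n * v))"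
      by (subst distr_distr) (auto simp: comp_def)
    finally show ?thesis by (simp add: cdf_def measure_distr vimage_def)
  qed
  ultimately show ?thesis by simp
qed

text \<open>Needed since the threshold moves with \<open>n\<close> and the number of factors is
  \<open>m n\<close>. Monotonicity and continuity of the limit replace uniform convergence: the
  value at the moving threshold is compared with the value at a fixed \<open>u\<close> close to
  \<open>x\<close>.\<close>

lemma tendsto_mono_compose:
  fixes F :: "nat \<Rightarrow> real \<Rightarrow> real"
  assumes "\<And>x. (\<lambda>n. F n x) \<longlonglongrightarrow> G x" "\<And>n. mono (F n)" "isCont G x"
    and "filterlim m at_top sequentially" "z \<longlonglongrightarrow> x"
  shows "(\<lambda>n. F (m n) (z n)) \<longlonglongrightarrow> G x"
proof (rule order_tendstoI)
  fix a assume "a < G x"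
  hence "eventually (\<lambda>u. a < G u) (at_left x)"
    using assms(3) by (intro order_tendstoD) (auto simp: isCont_def intro: tendsto_mono[OF at_le])
  moreover have "eventually (\<lambda>u. u < x) (at_left x)" by (simp add: eventually_at_filter)
  ultimately obtain u where u: "a < G u" "u < x"
    using eventually_happens[OF eventually_conj] trivial_limit_at_left_real by blast
  have "eventually (\<lambda>n. a < F (m n) u) sequentially"
    using order_tendstoD(1)[OF filterlim_compose[OF assms(1,4)] u(1)] .
  moreover have "eventually (\<lambda>n. u < z n) sequentially" using order_tendstoD(1)[OF assms(5) u(2)] .
  ultimately show "eventually (\<lambda>n. a < F (m n) (z n)) sequentially"
    by eventually_elim (use assms(2) in \<open>meson less_le_trans less_imp_le monoD\<close>)
next
  fix a assume "a > G x"
  hence "eventually (\<lambda>u. a > G u) (at_right x)"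
    using assms(3) by (intro order_tendstoD) (auto simp: isCont_def intro: tendsto_mono[OF at_le])
  moreover have "eventually (\<lambda>u. u > x) (at_right x)" by (simp add: eventually_at_filter)
  ultimately obtain u where u: "a > G u" "u > x"
    using eventually_happens[OF eventually_conj] trivial_limit_at_right_real by blast
  have "eventually (\<lambda>n. a > F (m n) u) sequentially"
    using order_tendstoD(2)[OF filterlim_compose[OF assms(1,4)] u(1)] .
  moreover have "eventually (\<lambda>n. u > z n) sequentially" using order_tendstoD(2)[OF assms(5) u(2)] .
  ultimately show "eventually (\<lambda>n. a > F (m n) (z n)) sequentially"
    by eventually_elim (use assms(2) in \<open>meson le_less_trans less_imp_le monoD\<close>)
qed

lemma set_iid_pmf: "set_pmf (iid_pmf n P) = PiE_dflt {..<n} undefined (\<lambda>_. set_pmf P)"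
  by (simp add: iid_pmf_def set_Pi_pmf comp_def)

lemma finite_set_iid_pmf: "finite (set_pmf P) \<Longrightarrow> finite (set_pmf (iid_pmf n P))"
  by (simp add: set_iid_pmf finite_PiE_dflt)

lemma log_pmf_iid:
  assumes "y \<in> set_pmf (iid_pmf n P)"
  shows "log 2 (pmf (iid_pmf n P) y) = (\<Sum>i<n. log 2 (pmf P (y i)))"
proof -
  have y: "y i \<in> set_pmf P" if "i < n" for i using assms that by (auto simp: set_iid_pmf PiE_dflt_def)
  have "pmf (iid_pmf n P) y = (\<Prod>i<n. pmf P (y i))"
    using assms unfolding iid_pmf_def by (subst pmf_Pi') (auto simp: set_Pi_pmf PiE_dflt_def)
  moreover have "ln (\<Prod>i<n. pmf P (y i)) = (\<Sum>i<n. ln (pmf P (y i)))"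
    using y unfolding set_pmf_iff by (intro ln_prod) auto
  ultimately show ?thesis by (simp add: log_def sum_divide_distrib)
qed

text \<open>The self-information of a string is a sum of independent copies with mean
  \<open>pmf_entropy P\<close> and variance \<open>pmf_varentropy P\<close>, so a lower bound on its
  probability is an upper bound on a normalized sum. The length \<open>m n\<close> is kept general
  for the sake of the target, whose length is not \<open>n\<close>.\<close>

lemma iid_pmf_mass_tendsto:
  fixes m :: "nat \<Rightarrow> nat" and E :: "nat \<Rightarrow> real"
  assumes fin: "finite (set_pmf P)" and v: "pmf_varentropy P > 0"
    and m: "filterlim m at_top sequentially"
    and E: "(\<lambda>n. (E n - real (m n) * pmf_entropy P) / sqrt (real (m n) * pmf_varentropy P)) \<longlonglongrightarrow> z"
  shows "(\<lambda>n. measure (iid_pmf (m n) P) {y. 2 powr (- E n) \<le> pmf (iid_pmf (m n) P) y})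
           \<longlonglongrightarrow> std_normal_cdf z"
proof -
  define f where "f x = - log 2 (pmf P x)" for x
  define H where "H = pmf_entropy P"
  define V where "V = pmf_varentropy P"
  define F where "F n u = measure (iid_pmf n P) {y. (\<Sum>i<n. f (y i) - H) / sqrt (real n * V) \<le> u}" for n u
  have "(\<lambda>n. F n u) \<longlonglongrightarrow> std_normal_cdf u" for u
    unfolding F_def using fin v
    by (intro clt_iid_pmf) (auto simp: f_def H_def V_def pmf_entropy_def pmf_varentropy_def simp flip: sum_negf)
  hence "(\<lambda>n. F (m n) ((E n - real (m n) * H) / sqrt (real (m n) * V))) \<longlonglongrightarrow> std_normal_cdf z"
  proof (rule tendsto_mono_compose)
    show "mono (F n)" for n
      unfolding F_def by (intro monoI measure_pmf.finite_measure_mono) auto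
  qed (use E m isCont_std_normal_cdf in \<open>auto simp: H_def V_def\<close>)
  moreover have "eventually (\<lambda>n. F (m n) ((E n - real (m n) * H) / sqrt (real (m n) * V)) =
      measure (iid_pmf (m n) P) {y. 2 powr (- E n) \<le> pmf (iid_pmf (m n) P) y}) sequentially"
  proof -
    have "eventually (\<lambda>n. m n \<ge> 1) sequentially" using m by (simp add: filterlim_at_top)
    thus ?thesis
    proof eventually_elim
      case (elim n)
      define k where "k = m n"
      have pos: "sqrt (real k * V) > 0" using elim v by (simp add: k_def V_def)
      have "(\<Sum>i<k. f (y i) - H) / sqrt (real k * V) \<le> (E n - real k * H) / sqrt (real k * V)
          \<longleftrightarrow> 2 powr (- E n) \<le> pmf (iid_pmf k P) y" if y: "y \<in> set_pmf (iid_pmf k P)" for y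
      proof -
        have "(\<Sum>i<k. f (y i) - H) / sqrt (real k * V) \<le> (E n - real k * H) / sqrt (real k * V)
            \<longleftrightarrow> (\<Sum>i<k. f (y i)) \<le> E n"
          using pos by (simp add: divide_le_cancel sum_subtractf)
        also have "(\<Sum>i<k. f (y i)) = - log 2 (pmf (iid_pmf k P) y)"
          using log_pmf_iid[OF y] by (simp add: f_def sum_negf)
        also have "- log 2 (pmf (iid_pmf k P) y) \<le> E n \<longleftrightarrow> 2 powr (- E n) \<le> pmf (iid_pmf k P) y"
          using pmf_positive[OF y] le_log_iff[of 2 "pmf (iid_pmf k P) y" "- E n"] by auto
        finally show ?thesis .
      qed
      \<comment> \<open>The logarithm is additive only for strings of positive probability, so the
        two events are compared almost surely.\<close>
      hence "measure (iid_pmf k P) {y. (\<Sum>i<k. f (y i) - H) / sqrt (real k * V) \<le> (E n - real k * H) / sqrt (real k * V)}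
        = measure (iid_pmf k P) {y. 2 powr (- E n) \<le> pmf (iid_pmf k P) y}"
        by (intro measure_pmf.finite_measure_eq_AE) (auto simp: AE_measure_pmf_iff)
      thus ?case by (simp add: F_def k_def)
    qed
  qed
  ultimately show ?thesis by (rule Lim_transform_eventually)
qed

text \<open>A vanishing variance makes \<open>log 2 (pmf P x)\<close> constant on the support, and
  normalization then makes \<open>P\<close> uniform there.\<close>

lemma varentropy_pos:
  assumes "finite (set_pmf P)" "non_uniform P"
  shows "pmf_varentropy P > 0"
proof -
  have "pmf_varentropy P \<ge> 0" unfolding pmf_varentropy_def by (intro sum_nonneg) auto
  moreover have "pmf_varentropy P \<noteq> 0"
  proof
    assume "pmf_varentropy P = 0"
    hence z: "\<forall>x\<in>set_pmf P. pmf P x * (- log 2 (pmf P x) - pmf_entropy P)\<^sup>2 = 0"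
      unfolding pmf_varentropy_def using assms(1) by (subst (asm) sum_nonneg_eq_0_iff) auto
    have l: "log 2 (pmf P x) = - pmf_entropy P" if "x \<in> set_pmf P" for x
    proof -
      have "pmf P x * (- log 2 (pmf P x) - pmf_entropy P)\<^sup>2 = 0" "pmf P x \<noteq> 0"
        using z that by (auto simp: set_pmf_iff)
      thus ?thesis by simp
    qed
    have c: "pmf P x = 2 powr (- pmf_entropy P)" if "x \<in> set_pmf P" for x
    proof -
      have "pmf P x = 2 powr (log 2 (pmf P x))" using pmf_positive[OF that] by simp
      thus ?thesis using l[OF that] by simp
    qed
    define k where "k = 2 powr (- pmf_entropy P)"
    have "(\<Sum>x\<in>set_pmf P. pmf P x) = 1" using assms(1) by (intro sum_pmf_eq_1) auto
    hence "real (card (set_pmf P)) * k = 1" using c by (simp add: k_def)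
    moreover have "real (card (set_pmf P)) \<noteq> 0" using assms(1) set_pmf_not_empty[of P] by simp
    ultimately have k: "k = 1 / real (card (set_pmf P))" by (simp add: field_simps)
    have "P = pmf_of_set (set_pmf P)"
    proof (rule pmf_eqI)
      fix x
      show "pmf P x = pmf (pmf_of_set (set_pmf P)) x"
        using c[of x] k assms(1) set_pmf_not_empty[of P]
        by (cases "x \<in> set_pmf P") (auto simp: k_def set_pmf_iff indicator_def)
    qed
    thus False using assms(2) by (simp add: non_uniform_def)
  qed
  ultimately show ?thesis by simp
qed

text \<open>The entropy is a sum of nonnegative terms; if all vanish, so do the logarithms on the
  support and with them the varentropy.\<close>

lemma entropy_pos:
  assumes "finite (set_pmf P)" "non_uniform P"
  shows "pmf_entropy P > 0"
proof -
  have nn: "0 \<le> - (pmf P x * log 2 (pmf P x))" if "x \<in> set_pmf P" for x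
  proof -
    have "log 2 (pmf P x) \<le> 0" using pmf_positive[OF that] pmf_le_1[of P x] by simp
    thus ?thesis by (simp add: mult_nonneg_nonpos)
  qed
  have eq: "pmf_entropy P = (\<Sum>x\<in>set_pmf P. - (pmf P x * log 2 (pmf P x)))"
    by (simp add: pmf_entropy_def sum_negf)
  have "pmf_entropy P \<ge> 0" unfolding eq using nn by (rule sum_nonneg)
  moreover have "pmf_entropy P \<noteq> 0"
  proof
    assume z: "pmf_entropy P = 0"
    hence "\<forall>x\<in>set_pmf P. - (pmf P x * log 2 (pmf P x)) = 0"
      unfolding eq using assms(1) nn by (subst (asm) sum_nonneg_eq_0_iff) auto
    hence "\<forall>x\<in>set_pmf P. log 2 (pmf P x) = 0" by (auto simp: set_pmf_iff)
    hence "pmf_varentropy P = 0" using z by (simp add: pmf_varentropy_def)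
    thus False using varentropy_pos[OF assms] by simp
  qed
  ultimately show ?thesis by simp
qed

lemma set_iid_subset: "set_pmf R \<subseteq> Z \<Longrightarrow> set_pmf (iid_pmf n R) \<subseteq> iid_carrier n Z"
  by (auto simp: set_iid_pmf iid_carrier_def PiE_dflt_def PiE_def extensional_def)

section \<open>Admissible functions and discrete profiles\<close>

lemma mono_tendsto_at_bot:
  fixes F :: "real \<Rightarrow> real"
  assumes "mono F" "\<And>x. b \<le> F x"
  shows "(F \<longlongrightarrow> Inf (range F)) at_bot"
proof (rule order_tendstoI)
  have bdd: "bdd_below (range F)" using assms(2) unfolding bdd_below_def by blast
  fix a assume "a < Inf (range F)"
  thus "eventually (\<lambda>x. a < F x) at_bot"
    using cINF_lower[OF bdd] by (intro always_eventually) (auto intro: less_le_trans)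
next
  have bdd: "bdd_below (range F)" using assms(2) unfolding bdd_below_def by blast
  fix a assume "Inf (range F) < a"
  then obtain x where "F x < a" using cInf_lessD[of "range F" a] by auto
  moreover have "F y \<le> F x" if "y \<le> x" for y using assms(1) that by (rule monoD)
  ultimately show "eventually (\<lambda>x. F x < a) at_bot"
    unfolding eventually_at_bot_linorder by (meson le_less_trans)
qed

lemma mono_tendsto_at_top:
  fixes F :: "real \<Rightarrow> real"
  assumes "mono F" "\<And>x. F x \<le> b"
  shows "(F \<longlongrightarrow> Sup (range F)) at_top"
proof (rule order_tendstoI)
  have bdd: "bdd_above (range F)" using assms(2) unfolding bdd_above_def by blast
  fix a assume "Sup (range F) < a"
  thus "eventually (\<lambda>x. F x < a) at_top"
    using cSUP_upper[OF _ bdd] by (intro always_eventually) (auto intro: le_less_trans)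
next
  fix a assume "a < Sup (range F)"
  then obtain x where "a < F x" using less_cSupD[of "range F" a] by auto
  moreover have "F x \<le> F y" if "x \<le> y" for y using assms(1) that by (rule monoD)
  ultimately show "eventually (\<lambda>x. a < F x) at_top"
    unfolding eventually_at_top_linorder by (meson less_le_trans)
qed

text \<open>An admissible function may keep a positive limit at minus infinity, so the integral over
  a half line is only bounded by \<open>F b\<close>. Equality is recorded separately for functions
  that tend to 0, such as the normal ones.\<close>

lemma mono_deriv_integrals:
  fixes F f :: "real \<Rightarrow> real"
  assumes F: "mono F" "\<And>x. 0 \<le> F x" "\<And>x. F x \<le> 1"
    and D: "\<And>x. (F has_real_derivative f x) (at x)" and f: "continuous_on UNIV f"
  shows "\<And>x. 0 \<le> f x" "integrable lborel f"
    and "\<And>a b. a \<le> b \<Longrightarrow> (LINT x:{a<..b}|lborel. f x) = F b - F a"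
    and "\<And>b. (LINT x:{..b}|lborel. f x) \<le> F b"
    and "\<And>b. (F \<longlongrightarrow> 0) at_bot \<Longrightarrow> (LINT x:{..b}|lborel. f x) = F b"
proof -
  show nn: "0 \<le> f x" for x
    using mono_on_imp_deriv_nonneg[of UNIV F "f x" x] F(1) D by simp
  have cont: "isCont f x" for x using f by (simp add: continuous_on_eq_continuous_at)
  have contF: "isCont F x" for x using D DERIV_isCont by blast
  note lim = mono_tendsto_at_bot[OF F(1,2)] mono_tendsto_at_top[OF F(1,3)]
  have "set_integrable lborel (einterval (-\<infinity>) \<infinity>) f"
    by (rule interval_integral_FTC_nonneg(1)[of _ _ F f "Inf (range F)" "Sup (range F)"])
       (use D cont nn lim in \<open>auto simp: ereal_tendsto_simps\<close>)
  thus int: "integrable lborel f" by (simp add: set_integrable_def einterval_def)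
  have fin: "(LINT x:{..b}|lborel. f x) = F b - Inf (range F)" for b
  proof -
    have "(LBINT x=-\<infinity>..ereal b. f x) = F b - Inf (range F)"
      by (rule interval_integral_FTC_nonneg(2))
         (use D cont contF nn lim in \<open>auto simp: ereal_tendsto_simps isCont_def intro: tendsto_mono[OF at_le]\<close>)
    moreover have "(LBINT x=-\<infinity>..ereal b. f x) = (LBINT x:{..b}. f x)"
      by (auto intro!: set_integral_discrete_difference[where X="{b}"]
           simp add: interval_lebesgue_integral_def einterval_iff)
    ultimately show ?thesis by simp
  qed
  show "(LINT x:{..b}|lborel. f x) \<le> F b" for b
  proof -
    have "0 \<le> Inf (range F)" using F(2) by (intro cINF_greatest) auto
    thus ?thesis using fin[of b] by simp
  qed
  show "(LINT x:{..b}|lborel. f x) = F b" if "(F \<longlongrightarrow> 0) at_bot" for b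
    using tendsto_unique[OF _ that lim(1)] fin[of b] by simp
  show "(LINT x:{a<..b}|lborel. f x) = F b - F a" if "a \<le> b" for a b
  proof -
    have *: "set_integrable lborel B f" if "B \<in> sets borel" for B
      unfolding set_integrable_def using int that by (intro integrable_mult_indicator) auto
    have "(LINT x:{..a} \<union> {a<..b}|lborel. f x) = (LINT x:{..a}|lborel. f x) + (LINT x:{a<..b}|lborel. f x)"
      by (rule set_integral_Un) (auto intro: *)
    moreover have "{..a} \<union> {a<..b} = {..b}" using that by auto
    ultimately show ?thesis using fin[of a] fin[of b] by simp
  qed
qed

text \<open>The function \<open>U\<close> of the overview; the second parameter is the standard
  deviation, as for \<open>normal_density\<close>.\<close>

definition normal_cdf :: "real \<Rightarrow> real \<Rightarrow> real \<Rightarrow> real" where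
  "normal_cdf \<mu> \<sigma> x = std_normal_cdf ((x - \<mu>) / \<sigma>)"

context
  fixes \<mu> \<sigma> :: real
  assumes \<sigma>: "\<sigma> > 0"
begin

lemma normal_cdf_DERIV: "(normal_cdf \<mu> \<sigma> has_real_derivative normal_density \<mu> \<sigma> x) (at x)"
proof -
  have "normal_density \<mu> \<sigma> x = std_normal_density ((x - \<mu>) / \<sigma>) * (1 / \<sigma>)"
    using \<sigma> by (simp add: normal_density_def real_sqrt_mult power_divide divide_simps)
  moreover have "((\<lambda>x. (x - \<mu>) / \<sigma>) has_real_derivative 1 / \<sigma>) (at x)"
    using \<sigma> by (auto intro!: derivative_eq_intros)
  ultimately show ?thesis
    unfolding normal_cdf_def[abs_def] using DERIV_chain2[OF std_normal_cdf_DERIV] by metis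
qed

lemma isCont_normal_cdf: "isCont (normal_cdf \<mu> \<sigma>) x"
  using normal_cdf_DERIV by (rule DERIV_isCont)

lemma normal_cdf_strict_mono: "x < y \<Longrightarrow> normal_cdf \<mu> \<sigma> x < normal_cdf \<mu> \<sigma> y"
  by (rule DERIV_pos_imp_increasing) (use normal_cdf_DERIV normal_density_pos[OF \<sigma>] in blast)+

lemma normal_cdf_less_iff: "normal_cdf \<mu> \<sigma> x < normal_cdf \<mu> \<sigma> y \<longleftrightarrow> x < y"
  using normal_cdf_strict_mono[of x y] normal_cdf_strict_mono[of y x] by (cases x y rule: linorder_cases) auto

lemma normal_cdf_le_iff: "normal_cdf \<mu> \<sigma> x \<le> normal_cdf \<mu> \<sigma> y \<longleftrightarrow> x \<le> y"
  using normal_cdf_less_iff[of y x] by (simp flip: not_less)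

lemma normal_cdf_at_bot: "(normal_cdf \<mu> \<sigma> \<longlongrightarrow> 0) at_bot"
proof -
  have "filterlim (\<lambda>x. (x - \<mu>) / \<sigma>) at_bot at_bot"
    using \<sigma> by real_asymp
  thus ?thesis unfolding normal_cdf_def[abs_def]
    by (rule filterlim_compose[OF std_normal_cdf_at_bot])
qed

lemma normal_cdf_at_top: "(normal_cdf \<mu> \<sigma> \<longlongrightarrow> 1) at_top"
proof -
  have "filterlim (\<lambda>x. (x - \<mu>) / \<sigma>) at_top at_top"
    using \<sigma> by real_asymp
  thus ?thesis unfolding normal_cdf_def[abs_def]
    by (rule filterlim_compose[OF std_normal_cdf_at_top])
qed

lemma normal_cdf_bounds: "0 < normal_cdf \<mu> \<sigma> x" "normal_cdf \<mu> \<sigma> x < 1"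
proof -
  have "0 \<le> normal_cdf \<mu> \<sigma> (x - 1)" "normal_cdf \<mu> \<sigma> (x + 1) \<le> 1"
    by (simp_all add: normal_cdf_def std_normal_cdf_nonneg std_normal_cdf_le_1)
  thus "0 < normal_cdf \<mu> \<sigma> x" "normal_cdf \<mu> \<sigma> x < 1"
    using normal_cdf_strict_mono[of "x - 1" x] normal_cdf_strict_mono[of x "x + 1"] by simp_all
qed

lemma normal_quantile:
  assumes "0 < u" "u < 1"
  obtains x where "normal_cdf \<mu> \<sigma> x = u"
proof -
  obtain a where a: "normal_cdf \<mu> \<sigma> a < u"
    using order_tendstoD(2)[OF normal_cdf_at_bot assms(1)] eventually_happens trivial_limit_at_bot_linorder by blast
  obtain b where b: "u < normal_cdf \<mu> \<sigma> b"
    using order_tendstoD(1)[OF normal_cdf_at_top assms(2)] eventually_happens trivial_limit_at_top_linorder by blast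
  have "a \<le> b" using a b normal_cdf_less_iff[of a b] by simp
  then obtain x where "normal_cdf \<mu> \<sigma> x = u"
    using IVT[of "normal_cdf \<mu> \<sigma>" a u b] a b isCont_normal_cdf by auto
  thus ?thesis using that by blast
qed

lemma normal_density_integrals:
  shows "a \<le> b \<Longrightarrow> (LINT x:{a<..b}|lborel. normal_density \<mu> \<sigma> x) = normal_cdf \<mu> \<sigma> b - normal_cdf \<mu> \<sigma> a"
    and "(LINT x:{..b}|lborel. normal_density \<mu> \<sigma> x) = normal_cdf \<mu> \<sigma> b"
proof -
  have "mono (normal_cdf \<mu> \<sigma>)" by (simp add: monoI normal_cdf_le_iff)
  note * = mono_deriv_integrals[OF this _ _ normal_cdf_DERIV continuous_on_normal_density]
  show "a \<le> b \<Longrightarrow> (LINT x:{a<..b}|lborel. normal_density \<mu> \<sigma> x) = normal_cdf \<mu> \<sigma> b - normal_cdf \<mu> \<sigma> a"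
    using \<sigma> by (intro *(3)) (auto simp: less_imp_le normal_cdf_bounds)
  show "(LINT x:{..b}|lborel. normal_density \<mu> \<sigma> x) = normal_cdf \<mu> \<sigma> b"
    using \<sigma> by (intro *(5)) (auto simp: less_imp_le normal_cdf_bounds normal_cdf_at_bot)
qed

end

section \<open>Cauchy-Schwarz inequality and discretization\<close>

text \<open>The infimum over \<open>c\<close> of the bound is the geometric mean. This scalar fact
  yields Cauchy-Schwarz for integrals as well as for finite sums.\<close>

lemma le_sqrt_mult_of_AM_GM:
  fixes I p q :: real
  assumes "0 \<le> p" "0 \<le> q" "\<And>c. c > 0 \<Longrightarrow> I \<le> (c * p + q / c) / 2"
  shows "I \<le> sqrt (p * q)"
proof (cases "p = 0 \<or> q = 0")
  case False
  hence pq: "p > 0" "q > 0" using assms by auto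
  \<comment> \<open>The minimizer, where the two summands coincide.\<close>
  define c where "c = sqrt q / sqrt p"
  have "c * p = sqrt p * sqrt q" "q / c = sqrt p * sqrt q"
    using pq real_sqrt_mult_self[of p] real_sqrt_mult_self[of q] by (simp_all add: c_def field_simps)
  moreover have "c > 0" using pq by (simp add: c_def)
  ultimately show ?thesis using assms(3)[of c] by (simp add: real_sqrt_mult)
next
  case True
  have "I \<le> 0"
  proof (rule field_le_epsilon)
    fix e :: real assume e: "e > 0"
    show "I \<le> 0 + e"
    proof (cases "p = 0")
      case True
      \<comment> \<open>Here the infimum need not be attained: \<open>c\<close> is taken large if
        \<open>p = 0\<close> and small if \<open>q = 0\<close>. The added 1 keeps \<open>c\<close>
        positive when both vanish.\<close>
      have "I \<le> (q / ((q + 1) / e)) / 2" using assms(3)[of "(q + 1) / e"] True assms(2) e by simp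
      also have "\<dots> = e * (q / (q + 1)) / 2" using e assms(2) by (simp add: field_simps)
      also have "\<dots> \<le> e * 1 / 2" using e assms(2) by (intro divide_right_mono mult_left_mono) auto
      finally show ?thesis using e by simp
    next
      case False
      hence "q = 0" using \<open>p = 0 \<or> q = 0\<close> by simp
      hence "I \<le> (e / (p + 1) * p) / 2" using assms(3)[of "e / (p + 1)"] assms(1) e by simp
      also have "\<dots> = e * (p / (p + 1)) / 2" by simp
      also have "\<dots> \<le> e * 1 / 2" using e assms(1) by (intro divide_right_mono mult_left_mono) auto
      finally show ?thesis using e by simp
    qed
  qed
  moreover have "sqrt (p * q) = 0" using True by auto
  ultimately show ?thesis by (simp only:)
qed

lemma sqrt_mult_le_AM_GM:
  fixes f g c :: real
  assumes "0 \<le> f" "0 \<le> g" "c > 0"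
  shows "sqrt (f * g) \<le> (c * f + g / c) / 2"
  using arith_geo_mean_sqrt[of "c * f" "g / c"] assms by simp

lemma integrable_sqrt_mult:
  fixes f g :: "real \<Rightarrow> real"
  assumes "integrable lborel f" "integrable lborel g" "\<And>x. 0 \<le> f x" "\<And>x. 0 \<le> g x"
  shows "integrable lborel (\<lambda>x. sqrt (f x * g x))"
proof (rule Bochner_Integration.integrable_bound)
  show "integrable lborel (\<lambda>x. (f x + g x) / 2)" using assms by simp
  have [measurable]: "f \<in> borel_measurable borel" "g \<in> borel_measurable borel"
    using assms(1,2) borel_measurable_integrable by fastforce+
  show "(\<lambda>x. sqrt (f x * g x)) \<in> borel_measurable lborel" by measurable
  show "AE x in lborel. norm (sqrt (f x * g x)) \<le> norm ((f x + g x) / 2)"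
    using sqrt_mult_le_AM_GM[of "f _" "g _" 1] assms by (intro always_eventually) (auto simp: abs_of_nonneg)
qed

lemma set_integrable_of_integrable:
  fixes f :: "real \<Rightarrow> real"
  shows "integrable lborel f \<Longrightarrow> B \<in> sets borel \<Longrightarrow> set_integrable lborel B f"
  unfolding set_integrable_def by (intro integrable_mult_indicator) auto

lemma set_integral_sqrt_mult_le:
  fixes f g :: "real \<Rightarrow> real"
  assumes "integrable lborel f" "integrable lborel g" "\<And>x. 0 \<le> f x" "\<And>x. 0 \<le> g x" "B \<in> sets borel"
  shows "(LINT x:B|lborel. sqrt (f x * g x)) \<le> sqrt ((LINT x:B|lborel. f x) * (LINT x:B|lborel. g x))"
proof (rule le_sqrt_mult_of_AM_GM)
  note si = set_integrable_of_integrable[OF _ assms(5)]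
  show "0 \<le> (LINT x:B|lborel. f x)" "0 \<le> (LINT x:B|lborel. g x)"
    unfolding set_lebesgue_integral_def using assms by (auto intro!: Bochner_Integration.integral_nonneg)
  fix c :: real assume c: "c > 0"
  have "(LINT x:B|lborel. sqrt (f x * g x)) \<le> (LINT x:B|lborel. (c * f x + g x / c) / 2)"
    using assms c integrable_sqrt_mult[OF assms(1-4)]
    by (intro set_integral_mono si sqrt_mult_le_AM_GM) auto
  also have "\<dots> = (c * (LINT x:B|lborel. f x) + (LINT x:B|lborel. g x) / c) / 2"
    using si[OF assms(1)] si[OF assms(2)] by (simp add: set_integral_add)
  finally show "(LINT x:B|lborel. sqrt (f x * g x)) \<le> (c * (LINT x:B|lborel. f x) + (LINT x:B|lborel. g x) / c) / 2" .
qed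

lemma admissibleD:
  assumes "A \<in> admissible s"
  shows "mono A" "A s = 1" "\<And>x. 0 \<le> A x" "\<And>x. std_normal_cdf x \<le> A x" "\<And>x. A x \<le> 1"
    and "\<And>x. (A has_real_derivative deriv A x) (at x)" "continuous_on UNIV (deriv A)"
proof -
  show "mono A" "A s = 1" "\<And>x. 0 \<le> A x" "\<And>x. std_normal_cdf x \<le> A x" "\<And>x. A x \<le> 1"
    using assms by (auto simp: admissible_def)
  obtain D where D: "\<And>x. (A has_real_derivative D x) (at x)" "continuous_on UNIV D"
    using assms by (auto simp: admissible_def C1_differentiable_on_def has_real_derivative_iff_has_vector_derivative)
  have "deriv A = D" using D(1) by (intro ext DERIV_imp_deriv)
  thus "\<And>x. (A has_real_derivative deriv A x) (at x)" "continuous_on UNIV (deriv A)"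
    using D by auto
qed

text \<open>Cauchy-Schwarz bin by bin, the first bin being the half line up to \<open>x 1\<close>.
  Putting \<open>a 0 = 0\<close> credits whatever mass \<open>A\<close> has at minus infinity to
  this bin, which only enlarges the right-hand side. Beyond \<open>s\<close> the function is
  constantly 1 and its density vanishes.\<close>

lemma density_fidelity_le_discrete:
  fixes x :: "nat \<Rightarrow> real"
  assumes \<sigma>: "\<sigma> > 0" and A: "A \<in> admissible s" and k: "k \<ge> 1" and \<delta>: "\<delta> > 0"
    and x: "\<And>j. 1 \<le> j \<Longrightarrow> j \<le> k \<Longrightarrow> normal_cdf \<mu> \<sigma> (x j) = real j * \<delta>" "x k = s"
  defines "a \<equiv> \<lambda>j. if j = 0 then 0 else A (x j)"
  shows "density_fidelity (deriv A) (normal_density \<mu> \<sigma>) \<le> (\<Sum>j=1..k. sqrt ((a j - a (j - 1)) * \<delta>))"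
proof -
  note AD = admissibleD[OF A]
  note I = mono_deriv_integrals[OF AD(1,3,5,6,7)]
  let ?p = "normal_density \<mu> \<sigma>"
  let ?h = "\<lambda>x. sqrt (deriv A x * ?p x)"
  have int: "integrable lborel ?h" by (rule integrable_sqrt_mult[OF I(2) _ I(1)]) (use \<sigma> in auto)
  note si = set_integrable_of_integrable[OF int]
  note cs = set_integral_sqrt_mult_le[OF I(2) integrable_normal_density[OF \<sigma>] I(1) normal_density_nonneg]
  have main: "(LINT y:{..x j}|lborel. ?h y) \<le> (\<Sum>i=1..j. sqrt ((a i - a (i - 1)) * \<delta>))"
    if "1 \<le> j" "j \<le> k" for j
    using that
  proof (induction j rule: nat_induct_at_least)
    case base
    have "(LINT y:{..x 1}|lborel. ?h y) \<le> sqrt ((LINT y:{..x 1}|lborel. deriv A y) * (LINT y:{..x 1}|lborel. ?p y))"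
      by (rule cs) auto
    also have "\<dots> \<le> sqrt (A (x 1) * \<delta>)"
      using normal_density_integrals(2)[OF \<sigma>, of "x 1" \<mu>] x(1)[of 1] k I(4)[of "x 1"] \<delta>
      by (intro real_sqrt_le_mono) simp
    finally show ?case by (simp add: a_def)
  next
    case (Suc j)
    have "normal_cdf \<mu> \<sigma> (x j) < normal_cdf \<mu> \<sigma> (x (Suc j))"
      using x(1)[of j] x(1)[of "Suc j"] Suc.prems Suc.hyps \<delta> by simp
    hence le: "x j \<le> x (Suc j)" using normal_cdf_less_iff[OF \<sigma>] by fastforce
    hence "{..x (Suc j)} = {..x j} \<union> {x j<..x (Suc j)}" by auto
    hence "(LINT y:{..x (Suc j)}|lborel. ?h y) = (LINT y:{..x j}|lborel. ?h y) + (LINT y:{x j<..x (Suc j)}|lborel. ?h y)"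
      by (simp only:) (rule set_integral_Un, auto intro: si)
    also have "(LINT y:{x j<..x (Suc j)}|lborel. ?h y) \<le>
       sqrt ((LINT y:{x j<..x (Suc j)}|lborel. deriv A y) * (LINT y:{x j<..x (Suc j)}|lborel. ?p y))"
      by (rule cs) auto
    also have "(LINT y:{x j<..x (Suc j)}|lborel. deriv A y) = a (Suc j) - a j"
      using I(3)[OF le] Suc.hyps by (simp add: a_def)
    also have "(LINT y:{x j<..x (Suc j)}|lborel. ?p y) = \<delta>"
      using normal_density_integrals(1)[OF \<sigma> le, of \<mu>] x(1)[of j] x(1)[of "Suc j"] Suc.prems Suc.hyps
      by (simp add: algebra_simps)
    finally show ?case using Suc.IH Suc.prems by simp
  qed
  have zero: "deriv A y = 0" if "y > s" for y
  proof -
    have "eventually (\<lambda>z. z \<in> {s<..}) (nhds y)"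
      by (rule eventually_nhds_in_open) (use that in auto)
    hence "eventually (\<lambda>z. A z = 1) (nhds y)"
    proof eventually_elim
      case (elim z)
      thus ?case using monoD[OF AD(1), of s z] AD(2) AD(5)[of z] by simp
    qed
    hence "(A has_real_derivative 0) (at y)"
      by (subst DERIV_cong_ev[OF refl _ refl, of _ "\<lambda>_. 1"]) auto
    thus ?thesis by (rule DERIV_imp_deriv)
  qed
  have "density_fidelity (deriv A) ?p = (LINT y:{..x k}|lborel. ?h y)"
    unfolding density_fidelity_def set_lebesgue_integral_def
    by (rule Bochner_Integration.integral_cong) (auto simp: indicator_def x(2) zero)
  also have "\<dots> \<le> (\<Sum>i=1..k. sqrt ((a i - a (i - 1)) * \<delta>))" using main[of k] k by simp
  finally show ?thesis .
qed

section \<open>Smoothing a discrete profile\<close>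

text \<open>Integrate a trapezoid of height 1 over the unit interval and normalize. Its area is at
  most 1, so normalization can only raise the slope, which is thus at least 1 away from the two
  ends.\<close>

lemma smooth_step:
  fixes \<eta> :: real
  assumes "0 < \<eta>" "\<eta> < 1 / 2"
  obtains S S' :: "real \<Rightarrow> real" where
    "\<And>x. (S has_real_derivative S' x) (at x)" "continuous_on UNIV S'" "\<And>x. 0 \<le> S' x"
    "\<And>x. x \<le> 0 \<Longrightarrow> S x = 0" "\<And>x. 1 \<le> x \<Longrightarrow> S x = 1"
    "\<And>x. \<eta> \<le> x \<Longrightarrow> x \<le> 1 - \<eta> \<Longrightarrow> 1 \<le> S' x"
proof -
  define g where "g x = max 0 (min 1 (min (x / \<eta>) ((1 - x) / \<eta>)))" for x :: real
  define T where "T = integral {-1..1} g"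
  have cont: "continuous_on B g" for B
    unfolding g_def using assms by (intro continuous_intros) auto
  have gint: "g integrable_on {a..b}" for a b by (rule integrable_continuous_real[OF cont])
  have g0: "g x = 0" if "x \<le> 0 \<or> 1 \<le> x" for x
    using that assms by (auto simp: g_def max_def min_def divide_simps)
  have g1: "g x = 1" if "\<eta> \<le> x" "x \<le> 1 - \<eta>" for x
    using that assms by (auto simp: g_def max_def min_def divide_simps)
  have gle: "0 \<le> g x" "g x \<le> 1" for x by (auto simp: g_def)
  have z: "integral {a..b} g = 0" if "b \<le> 0 \<or> 1 \<le> a" for a b
  proof -
    have "integral {a..b} g = integral {a..b} (\<lambda>_. 0)"
      using that by (intro Henstock_Kurzweil_Integration.integral_cong) (auto intro!: g0)
    thus ?thesis by simp
  qed
  have "T = integral {-1..0} g + integral {0..1} g"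
    unfolding T_def by (rule Henstock_Kurzweil_Integration.integral_combine[symmetric]) (auto intro: gint)
  also have "integral {0..1} g \<le> integral {0..1} (\<lambda>_::real. 1 :: real)"
    by (rule Henstock_Kurzweil_Integration.integral_le) (auto simp: gle intro: gint)
  also have "integral {-1..0} g + integral {0..1} (\<lambda>_::real. 1 :: real) = 1" using z[of 0 "-1"] by simp
  finally have T1: "T \<le> 1" by simp
  have "1 - 2 * \<eta> = integral {\<eta>..1-\<eta>} (\<lambda>_. 1 :: real)" using assms by simp
  also have "\<dots> = integral {\<eta>..1-\<eta>} g"
    by (intro Henstock_Kurzweil_Integration.integral_cong) (auto simp: g1)
  also have "\<dots> \<le> T"
    unfolding T_def using assms by (intro integral_subset_le gint) (auto simp: gle)
  finally have T0: "0 < T" using assms by simp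
  define S where "S x = integral {-1..x} g / T" for x
  define S' where "S' x = g x / T" for x
  have S0: "S x = 0" if "x \<le> 0" for x using z[of x "-1"] that by (simp add: S_def)
  show ?thesis
  proof (rule that[of S S'])
    fix x :: real
    show "(S has_real_derivative S' x) (at x)"
    \<comment> \<open>The integral starts at -1 and gives the derivative only to the right of that
      point; left of 0 the function is locally constant.\<close>
    proof (cases "x < 0")
      case True
      have "eventually (\<lambda>u. u \<in> {..<0}) (nhds x)"
        by (rule eventually_nhds_in_open) (use True in auto)
      hence "eventually (\<lambda>u. S u = 0) (nhds x)" by eventually_elim (simp add: S0)
      hence "(S has_real_derivative 0) (at x)"
        by (subst DERIV_cong_ev[OF refl _ refl, of _ "\<lambda>_. 0"]) auto
      thus ?thesis using True by (simp add: S'_def g0)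
    next
      case False
      have "((\<lambda>u. integral {-1..u} g) has_real_derivative g x) (at x within {-1..x+1})"
        using False by (intro integral_has_real_derivative cont) auto
      hence "((\<lambda>u. integral {-1..u} g) has_real_derivative g x) (at x)"
        using False by (subst (asm) at_within_Icc_at) auto
      thus ?thesis unfolding S_def[abs_def] S'_def by (rule DERIV_cdivide)
    qed
    show "0 \<le> S' x" using gle T0 by (simp add: S'_def)
    show "S x = 0" if "x \<le> 0" using S0[OF that] .
    show "S x = 1" if "1 \<le> x"
    proof -
      have "integral {-1..x} g = T + integral {1..x} g"
        unfolding T_def using that
        by (intro Henstock_Kurzweil_Integration.integral_combine[symmetric] gint) auto
      thus ?thesis using z[of x 1] T0 by (simp add: S_def)
    qed
    show "1 \<le> S' x" if "\<eta> \<le> x" "x \<le> 1 - \<eta>"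
      using that T0 T1 by (simp add: S'_def g1)
  next
    show "continuous_on UNIV S'" unfolding S'_def[abs_def] using T0
      by (intro continuous_intros cont) auto
  qed
qed

lemma mono_of_deriv_nonneg:
  fixes F f :: "real \<Rightarrow> real"
  assumes "\<And>x. (F has_real_derivative f x) (at x)" "\<And>x. 0 \<le> f x"
  shows "mono F"
proof (rule monoI)
  fix u v :: real assume "u \<le> v"
  thus "F u \<le> F v" by (rule DERIV_nonneg_imp_nondecreasing) (use assms in blast)
qed

lemma sum_increments:
  fixes a :: "nat \<Rightarrow> real"
  assumes "m \<le> n"
  shows "(\<Sum>j=Suc m..n. a j - a (j - 1)) = a n - a m"
  using assms by (induction n rule: dec_induct) auto

text \<open>Mass is released one bin earlier than the discrete profile prescribes, so that the
  domination of the normal distribution at the grid points extends to the points between.\<close>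
lemma discrete_le_density_fidelity:
  fixes x a :: "nat \<Rightarrow> real"
  assumes \<sigma>: "\<sigma> > 0" and k: "k \<ge> 2" and \<delta>: "\<delta> > 0"
    and x: "\<And>j. 1 \<le> j \<Longrightarrow> j \<le> k \<Longrightarrow> normal_cdf \<mu> \<sigma> (x j) = real j * \<delta>" "x k = s"
    and a: "\<And>i j. i \<le> j \<Longrightarrow> j \<le> k \<Longrightarrow> a i \<le> a j" "a k = 1"
      "\<And>j. 1 \<le> j \<Longrightarrow> j \<le> k \<Longrightarrow> std_normal_cdf (x j) \<le> a j"
    and \<eta>: "0 < \<eta>" "\<eta> < 1 / 2"
  shows "\<exists>A\<in>admissible s. (1 - 2 * \<eta>) * (\<Sum>j=3..k. sqrt ((a j - a (j - 1)) * \<delta>))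
           \<le> density_fidelity (deriv A) (normal_density \<mu> \<sigma>)"
proof -
  obtain S S' :: "real \<Rightarrow> real" where
    S: "\<And>x. (S has_real_derivative S' x) (at x)" "continuous_on UNIV S'" "\<And>x. 0 \<le> S' x"
    "\<And>x. x \<le> 0 \<Longrightarrow> S x = 0" "\<And>x. 1 \<le> x \<Longrightarrow> S x = 1"
    "\<And>x. \<eta> \<le> x \<Longrightarrow> x \<le> 1 - \<eta> \<Longrightarrow> 1 \<le> S' x"
    using smooth_step[OF \<eta>] by metis
  have Smono: "mono S"
    using S(1,3) by (rule mono_of_deriv_nonneg)
  have S01: "0 \<le> S y" "S y \<le> 1" for y
  proof -
    have "S (min y 0) \<le> S y" "S y \<le> S (max y 1)" by (intro monoD[OF Smono] min.cobounded1 max.cobounded1)+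
    moreover have "S (min y 0) = 0" by (rule S(4)) simp
    moreover have "S (max y 1) = 1" by (rule S(5)) simp
    ultimately show "0 \<le> S y" "S y \<le> 1" by simp_all
  qed
  let ?\<Phi> = std_normal_cdf and ?\<phi> = std_normal_density and ?q = "normal_density \<mu> \<sigma>"
  define p where "p j = a j - a (j - 1)" for j
  \<comment> \<open>A time change that turns the bins into unit intervals. Steps in \<open>w\<close>
    spread the mass of a bin in proportion to the target density, the case of equality in
    Cauchy-Schwarz.\<close>
  define w where "w y = normal_cdf \<mu> \<sigma> y / \<delta>" for y
  \<comment> \<open>The increment \<open>p j\<close> belongs to the range of \<open>w\<close> from j
    - 1 to j and is released from j - 2 to j - 1. The mass of the first two bins is present from the
    start as \<open>a 2\<close>, so the sum begins at 3.\<close>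
  define B where "B y = a 2 + (\<Sum>j=3..k. p j * S (w y - (real j - 2)))" for y
  define B' where "B' y = (\<Sum>j=3..k. p j * (S' (w y - (real j - 2)) * (?q y / \<delta>)))" for y
  \<comment> \<open>Within the first bin the function passes from \<Phi> to \<open>B\<close>, so
    that it still tends to 0 at minus infinity.\<close>
  define A where "A y = ?\<Phi> y * (1 - S (w y)) + S (w y) * B y" for y
  \<comment> \<open>Grouped so that every summand is nonnegative once \<open>B\<close> dominates
    \<Phi>.\<close>
  define A' where "A' y = ?\<phi> y * (1 - S (w y)) + (S' (w y) * (?q y / \<delta>)) * (B y - ?\<Phi> y) + S (w y) * B' y" for y
  have p: "0 \<le> p j" if "j \<in> {3..k}" for j using a(1)[of "j - 1" j] that by (simp add: p_def)
  have Dw: "(w has_real_derivative ?q y / \<delta>) (at y)" for y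
    unfolding w_def[abs_def] by (rule DERIV_cdivide[OF normal_cdf_DERIV[OF \<sigma>]])
  have Dws: "((\<lambda>y. w y - c) has_real_derivative ?q y / \<delta>) (at y)" for y c
    using DERIV_diff[OF Dw DERIV_const[of c]] by simp
  have DSw: "((\<lambda>y. S (w y - c)) has_real_derivative S' (w y - c) * (?q y / \<delta>)) (at y)" for y c
    by (rule DERIV_chain2[OF S(1) Dws])
  have DSw0: "((\<lambda>y. S (w y)) has_real_derivative S' (w y) * (?q y / \<delta>)) (at y)" for y
    by (rule DERIV_chain2[OF S(1) Dw])
  have DB: "(B has_real_derivative B' y) (at y)" for y
  proof -
    have "((\<lambda>y. a 2 + (\<Sum>j=3..k. p j * S (w y - (real j - 2)))) has_real_derivative
        0 + (\<Sum>j=3..k. p j * (S' (w y - (real j - 2)) * (?q y / \<delta>)))) (at y)"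
      by (intro DERIV_add DERIV_const DERIV_sum DERIV_cmult DSw)
    thus ?thesis by (simp add: B_def[abs_def] B'_def)
  qed
  have DA: "(A has_real_derivative A' y) (at y)" for y
  proof -
    have "((\<lambda>y. ?\<Phi> y * (1 - S (w y)) + S (w y) * B y) has_real_derivative
        (?\<phi> y * (1 - S (w y)) + (0 - S' (w y) * (?q y / \<delta>)) * ?\<Phi> y)
        + (S' (w y) * (?q y / \<delta>) * B y + B' y * S (w y))) (at y)"
      by (intro DERIV_add DERIV_mult DERIV_diff DERIV_const DSw0 DB std_normal_cdf_DERIV)
    moreover have "(?\<phi> y * (1 - S (w y)) + (0 - S' (w y) * (?q y / \<delta>)) * ?\<Phi> y)
        + (S' (w y) * (?q y / \<delta>) * B y + B' y * S (w y)) = A' y"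
      by (simp add: A'_def algebra_simps diff_divide_distrib)
    ultimately show ?thesis by (simp add: A_def[abs_def])
  qed
  have cont_of_D: "continuous_on UNIV F" if "\<And>y. (F has_real_derivative F' y) (at y)" for F F' :: "real \<Rightarrow> real"
    using that by (meson DERIV_isCont continuous_at_imp_continuous_on)
  have contS': "continuous_on UNIV (\<lambda>y. S' (w y - c))" for c
    by (rule continuous_on_compose2[OF S(2) cont_of_D[OF Dws]]) auto
  have cq: "continuous_on UNIV ?q" and c\<phi>: "continuous_on UNIV ?\<phi>"
    using \<sigma> by (auto intro!: continuous_on_normal_density)
  have contB': "continuous_on UNIV B'"
    unfolding B'_def[abs_def] using \<delta> by (intro continuous_intros contS' cq) auto
  have contA': "continuous_on UNIV A'"
    unfolding A'_def[abs_def] using \<delta> contS'[of 0]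
    by (intro continuous_intros contB' cq c\<phi> cont_of_D[OF DSw0] cont_of_D[OF DB] cont_of_D[OF std_normal_cdf_DERIV]) auto
  have wpos: "0 < w y" for y using normal_cdf_bounds[OF \<sigma>] \<delta> by (simp add: w_def)
  have wx: "w (x j) = real j" if "1 \<le> j" "j \<le> k" for j using x(1)[OF that] \<delta> by (simp add: w_def)
  have w_le: "w y \<le> w z \<longleftrightarrow> y \<le> z" for y z
    using normal_cdf_le_iff[OF \<sigma>] \<delta> by (simp add: w_def divide_le_cancel)
  have Bge: "a i \<le> B y" if "2 \<le> i" "i \<le> k" "real i - 1 \<le> w y" for i y
  proof -
    have "a i - a 2 = (\<Sum>j=3..i. p j)" using sum_increments[of 2 i a] that by (simp add: p_def numeral_3_eq_3 numeral_2_eq_2)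
    also have "\<dots> = (\<Sum>j=3..i. p j * S (w y - (real j - 2)))"
      using that by (intro sum.cong refl) (auto simp: S(5))
    also have "\<dots> \<le> (\<Sum>j=3..k. p j * S (w y - (real j - 2)))"
      using that p S01 by (intro sum_mono2) auto
    finally show ?thesis by (simp add: B_def)
  qed
  have ge\<Phi>: "?\<Phi> y \<le> B y" for y
  proof (cases "w y \<le> real k")
    case True
    \<comment> \<open>A grid point at or to the right of \<open>y\<close>: monotonicity moves \<Phi>
      up to \<open>x i\<close>, and by the early release \<open>B y\<close> has already reached
      \<open>a i\<close>.\<close>
    define i where "i = max 2 (nat \<lceil>w y\<rceil>)"
    have c: "nat \<lceil>w y\<rceil> \<le> k" using True by (simp add: ceiling_le_iff)
    have i: "2 \<le> i" "i \<le> k" using k c by (auto simp: i_def)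
    have "real (nat \<lceil>w y\<rceil>) < w y + 1" using wpos[of y] ceiling_correct[of "w y"] by simp
    have up: "w y \<le> real i"
    proof -
      have "w y \<le> real (nat \<lceil>w y\<rceil>)" by (rule real_nat_ceiling_ge)
      also have "\<dots> \<le> real i" by (simp add: i_def)
      finally show ?thesis .
    qed
    have "y \<le> x i" using w_le[of y "x i"] wx[of i] i up by simp
    hence "?\<Phi> y \<le> ?\<Phi> (x i)" by (rule std_normal_cdf_mono)
    also have "\<dots> \<le> a i" using a(3) i by simp
    also have "\<dots> \<le> B y"
    proof (cases "i = 2")
      case True
      have "0 \<le> (\<Sum>j=3..k. p j * S (w y - (real j - 2)))"
        by (intro sum_nonneg mult_nonneg_nonneg p S01)
      thus ?thesis using True by (simp add: B_def)
    next
      case False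
      hence "real i - 1 \<le> w y" using \<open>real (nat \<lceil>w y\<rceil>) < w y + 1\<close> by (auto simp: i_def max_def split: if_splits)
      thus ?thesis using Bge i by simp
    qed
    finally show ?thesis .
  next
    case False
    hence "a k \<le> B y" using k by (intro Bge) auto
    thus ?thesis using std_normal_cdf_le_1[of y] a(2) by simp
  qed
  have Ble: "B y \<le> 1" for y
  proof -
    have "(\<Sum>j=3..k. p j * S (w y - (real j - 2))) \<le> (\<Sum>j=3..k. p j)"
      using p S01 by (intro sum_mono) (simp add: mult_left_le)
    also have "\<dots> = a k - a 2" using sum_increments[of 2 k a] k by (simp add: p_def numeral_3_eq_3 numeral_2_eq_2)
    finally show ?thesis using a(2) by (simp add: B_def)
  qed
  have B'nn: "0 \<le> B' y" for y
    unfolding B'_def using p S(3) \<delta> by (intro sum_nonneg mult_nonneg_nonneg) auto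
  have A'nn: "0 \<le> A' y" for y
    unfolding A'_def using S01[of "w y"] S(3) \<delta> ge\<Phi>[of y] B'nn[of y] by (intro add_nonneg_nonneg mult_nonneg_nonneg) auto
  have Age: "?\<Phi> y \<le> A y" for y
  proof -
    have "A y - ?\<Phi> y = S (w y) * (B y - ?\<Phi> y)" by (simp add: A_def algebra_simps)
    also have "\<dots> \<ge> 0" using S01 ge\<Phi>[of y] by (intro mult_nonneg_nonneg) auto
    finally show ?thesis by simp
  qed
  have Ale: "A y \<le> 1" for y
  proof -
    have "1 - A y = (1 - ?\<Phi> y) * (1 - S (w y)) + S (w y) * (1 - B y)" by (simp add: A_def algebra_simps)
    also have "\<dots> \<ge> 0" using S01[of "w y"] Ble[of y] std_normal_cdf_le_1[of y] by (intro add_nonneg_nonneg mult_nonneg_nonneg) auto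
    finally show ?thesis by simp
  qed
  have As: "A s = 1"
  proof -
    have ws: "w s = real k" using wx[of k] k x(2) by simp
    hence "a k \<le> B s" using k by (intro Bge) auto
    hence "B s = 1" using Ble[of s] a(2) by simp
    moreover have "S (w s) = 1" using ws k by (intro S(5)) simp
    ultimately show ?thesis by (simp add: A_def)
  qed
  have Amono: "mono A"
    using DA A'nn by (rule mono_of_deriv_nonneg)
  have A0: "0 \<le> A y" for y using Age[of y] std_normal_cdf_nonneg[of y] by simp
  have adm: "A \<in> admissible s"
    unfolding admissible_def C1_differentiable_on_def
    using Amono As A0 Age Ale DA contA' by (auto simp flip: has_real_derivative_iff_has_vector_derivative)
  have dA: "deriv A = A'" using DA by (intro ext DERIV_imp_deriv)
  note I = mono_deriv_integrals[OF Amono A0 Ale DA contA']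
  have int: "integrable lborel (\<lambda>y. sqrt (A' y * ?q y))"
    by (rule integrable_sqrt_mult[OF I(2) _ A'nn]) (use \<sigma> in auto)
  have "\<exists>y. w y = t" if "0 < t" "t < real k" for t
  proof -
    have "t * \<delta> < real k * \<delta>" using that \<delta> by simp
    also have "\<dots> < 1" using x(1)[of k] k normal_cdf_bounds(2)[OF \<sigma>, of \<mu> "x k"] by simp
    finally have "t * \<delta> < 1" .
    moreover have "0 < t * \<delta>" using that \<delta> by simp
    ultimately obtain y where "normal_cdf \<mu> \<sigma> y = t * \<delta>"
      using normal_quantile[OF \<sigma>] by metis
    thus ?thesis using \<delta> by (intro exI[of _ y]) (simp add: w_def)
  qed
  hence "\<forall>t. \<exists>y. 0 < t \<and> t < real k \<longrightarrow> w y = t" by blast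
  then obtain y where y: "\<And>t. 0 < t \<Longrightarrow> t < real k \<Longrightarrow> w (y t) = t" by metis
  \<comment> \<open>The points where \<open>p j\<close> is being released at slope at least 1. This
    set has \<open>U\<close>-mass \<open>(1 - 2 * \<eta>) * \<delta>\<close>, and the sets for
    different \<open>j\<close> are disjoint.\<close>
  define E where "E j = {y (real j - 2 + \<eta>) <.. y (real j - 1 - \<eta>)}" for j :: nat
  have yl: "w (y (real j - 2 + \<eta>)) = real j - 2 + \<eta>" and yr: "w (y (real j - 1 - \<eta>)) = real j - 1 - \<eta>"
    if "j \<in> {3..k}" for j using that \<eta> by (auto intro!: y)
  have E: "real j - 2 + \<eta> \<le> w z \<and> w z \<le> real j - 1 - \<eta>" if "j \<in> {3..k}" "z \<in> E j" for j z
    using that yl[OF that(1)] yr[OF that(1)] w_le[of "y (real j - 2 + \<eta>)" z] w_le[of z "y (real j - 1 - \<eta>)"]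
    by (auto simp: E_def)
  have lb: "(\<Sum>j=3..k. sqrt (p j / \<delta>) * (indicator (E j) z * ?q z)) \<le> sqrt (A' z * ?q z)" for z
  proof (cases "\<exists>i\<in>{3..k}. z \<in> E i")
    case True
    then obtain i where i: "i \<in> {3..k}" "z \<in> E i" by blast
    have uniq: "z \<notin> E j" if "j \<in> {3..k}" "j \<noteq> i" for j
    proof
      assume "z \<in> E j"
      hence "real j - 2 + \<eta> \<le> real i - 1 - \<eta>" "real i - 2 + \<eta> \<le> real j - 1 - \<eta>"
        using E[OF that(1), of z] E[OF i] by linarith+
      hence "real j < real i + 1" "real i < real j + 1" using \<eta> by linarith+
      thus False using that(2) by simp
    qed
    have "(\<Sum>j=3..k. sqrt (p j / \<delta>) * (indicator (E j) z * ?q z)) = (\<Sum>j=3..k. if j = i then sqrt (p i / \<delta>) * ?q z else 0)"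
      using uniq i by (intro sum.cong refl) auto
    also have "\<dots> = sqrt (p i / \<delta>) * ?q z" using i by simp
    also have "\<dots> = sqrt (p i * (?q z / \<delta>) * ?q z)"
      by (simp add: real_sqrt_mult real_sqrt_divide flip: power2_eq_square)
    also have "\<dots> \<le> sqrt (A' z * ?q z)"
    proof (intro real_sqrt_le_mono mult_right_mono)
      \<comment> \<open>From here on the passage from \<Phi> to \<open>B\<close> is complete, so
        \<open>A'\<close> contains \<open>B'\<close> in full.\<close>
      have w1: "1 \<le> w z" using E[OF i] i \<eta> by auto
      have "p i * (?q z / \<delta>) \<le> p i * (S' (w z - (real i - 2)) * (?q z / \<delta>))"
      proof -
        have "1 \<le> S' (w z - (real i - 2))" using E[OF i] by (intro S(6)) auto
        hence "1 * (?q z / \<delta>) \<le> S' (w z - (real i - 2)) * (?q z / \<delta>)" using \<delta> by (intro mult_right_mono) auto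
        thus ?thesis using p[OF i(1)] by (intro mult_left_mono) auto
      qed
      also have "\<dots> \<le> B' z"
        unfolding B'_def using i p S(3) \<delta> by (intro member_le_sum mult_nonneg_nonneg) auto
      also have "\<dots> \<le> A' z"
        unfolding A'_def S(5)[OF w1] using S(3)[of "w z"] \<delta> ge\<Phi>[of z] by simp
      finally show "p i * (?q z / \<delta>) \<le> A' z" .
    qed simp
    finally show ?thesis .
  next
    case False
    hence "(\<Sum>j=3..k. sqrt (p j / \<delta>) * (indicator (E j) z * ?q z)) = 0" by (intro sum.neutral) auto
    thus ?thesis using A'nn[of z] by simp
  qed
  have iE: "integrable lborel (\<lambda>z. indicator (E j) z * ?q z)" for j
    using set_integrable_of_integrable[OF integrable_normal_density[OF \<sigma>], of "E j" \<mu>]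
    by (simp add: set_integrable_def E_def)
  have "(1 - 2 * \<eta>) * (\<Sum>j=3..k. sqrt (p j * \<delta>)) = (\<Sum>j=3..k. sqrt (p j / \<delta>) * ((1 - 2 * \<eta>) * \<delta>))"
  proof -
    have "sqrt (p j / \<delta>) * ((1 - 2 * \<eta>) * \<delta>) = (1 - 2 * \<eta>) * sqrt (p j * \<delta>)" for j
    proof -
      have "sqrt (p j / \<delta>) * \<delta> = sqrt (p j * \<delta>)"
        using \<delta> real_div_sqrt[of \<delta>] by (simp add: real_sqrt_mult real_sqrt_divide field_simps)
      thus ?thesis by (simp add: algebra_simps)
    qed
    thus ?thesis by (simp only: sum_distrib_left)
  qed
  also have "\<dots> = (\<Sum>j=3..k. sqrt (p j / \<delta>) * (LINT z|lborel. indicator (E j) z * ?q z))"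
  proof (intro sum.cong refl arg_cong2[where f = "(*)"])
    fix j assume j: "j \<in> {3..k}"
    have "y (real j - 2 + \<eta>) \<le> y (real j - 1 - \<eta>)"
      using yl[OF j] yr[OF j] \<eta> by (subst w_le[symmetric]) simp
    hence "(LINT z:E j|lborel. ?q z) = normal_cdf \<mu> \<sigma> (y (real j - 1 - \<eta>)) - normal_cdf \<mu> \<sigma> (y (real j - 2 + \<eta>))"
      unfolding E_def by (rule normal_density_integrals(1)[OF \<sigma>])
    also have "\<dots> = (w (y (real j - 1 - \<eta>)) - w (y (real j - 2 + \<eta>))) * \<delta>"
      using \<delta> by (simp add: w_def left_diff_distrib)
    also have "\<dots> = (1 - 2 * \<eta>) * \<delta>" using yl[OF j] yr[OF j] by simp
    finally show "(1 - 2 * \<eta>) * \<delta> = (LINT z|lborel. indicator (E j) z * ?q z)"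
      by (simp add: set_lebesgue_integral_def)
  qed
  also have "\<dots> = (LINT z|lborel. (\<Sum>j=3..k. sqrt (p j / \<delta>) * (indicator (E j) z * ?q z)))"
    using iE by simp
  also have "\<dots> \<le> (LINT z|lborel. sqrt (A' z * ?q z))"
    using iE int lb by (intro integral_mono) auto
  also have "\<dots> = density_fidelity (deriv A) ?q" by (simp add: density_fidelity_def dA)
  finally show ?thesis using adm by (auto simp: p_def)
qed

text \<open>Index 0 would stand for minus infinity, so the grid starts at 1, and the profiles and
  level sets built on it get their value at 0 by hand.\<close>

lemma normal_grid:
  assumes "\<sigma> > 0" "k \<ge> 1"
  obtains x :: "nat \<Rightarrow> real" where "x k = s"
    "\<And>j. 1 \<le> j \<Longrightarrow> j \<le> k \<Longrightarrow> normal_cdf \<mu> \<sigma> (x j) = real j * (normal_cdf \<mu> \<sigma> s / real k)"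
proof -
  define \<delta> where "\<delta> = normal_cdf \<mu> \<sigma> s / real k"
  note b = normal_cdf_bounds[OF assms(1), of \<mu> s]
  have "\<exists>y. normal_cdf \<mu> \<sigma> y = real j * \<delta> \<and> (j = k \<longrightarrow> y = s)" if "1 \<le> j" "j \<le> k" for j
  proof (cases "j = k")
    case True
    thus ?thesis using assms(2) by (auto simp: \<delta>_def)
  next
    case False
    have d: "0 < \<delta>" using b assms(2) by (simp add: \<delta>_def)
    have "real j * \<delta> \<le> real k * \<delta>" using that d by (intro mult_right_mono) auto
    also have "\<dots> = normal_cdf \<mu> \<sigma> s" using assms(2) by (simp add: \<delta>_def)
    finally have "real j * \<delta> < 1" using b by simp
    moreover have "0 < real j * \<delta>" using that d by simp
    ultimately show ?thesis using normal_quantile[OF assms(1)] False by metis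
  qed
  hence "\<forall>j. \<exists>y. 1 \<le> j \<and> j \<le> k \<longrightarrow> normal_cdf \<mu> \<sigma> y = real j * \<delta> \<and> (j = k \<longrightarrow> y = s)" by blast
  then obtain x where "\<And>j. 1 \<le> j \<Longrightarrow> j \<le> k \<Longrightarrow> normal_cdf \<mu> \<sigma> (x j) = real j * \<delta> \<and> (j = k \<longrightarrow> x j = s)"
    by metis
  thus ?thesis using that[of x] assms(2) by (simp add: \<delta>_def)
qed

section \<open>The supremum behind the Rayleigh-normal function\<close>

text \<open>The upper bound is the discretization with a single bin.\<close>

lemma density_fidelity_bounds:
  assumes "\<sigma> > 0" "A \<in> admissible s"
  shows "0 \<le> density_fidelity (deriv A) (normal_density \<mu> \<sigma>)"
    and "density_fidelity (deriv A) (normal_density \<mu> \<sigma>) \<le> 1"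
proof -
  note AD = admissibleD[OF assms(2)]
  have "0 \<le> deriv A x" for x by (rule mono_deriv_integrals(1)[OF AD(1,3,5,6,7)])
  thus "0 \<le> density_fidelity (deriv A) (normal_density \<mu> \<sigma>)"
    unfolding density_fidelity_def by (intro Bochner_Integration.integral_nonneg) simp
  note b = normal_cdf_bounds[OF assms(1), of \<mu> s]
  have "density_fidelity (deriv A) (normal_density \<mu> \<sigma>) \<le> sqrt (A s * normal_cdf \<mu> \<sigma> s)"
    using density_fidelity_le_discrete[OF assms, where k = 1 and \<delta> = "normal_cdf \<mu> \<sigma> s"
        and \<mu> = \<mu> and x = "\<lambda>_. s"] b by simp
  also have "\<dots> \<le> 1" using b AD(2) by simp
  finally show "density_fidelity (deriv A) (normal_density \<mu> \<sigma>) \<le> 1" .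
qed

text \<open>The witness comes from smoothing the constant profile 1 on two bins. It is needed
  because the supremum of an empty set of reals is unspecified.\<close>

lemma admissible_nonempty: "admissible s \<noteq> {}"
proof -
  have "(0::real) < 1" "(1::nat) \<le> 2" by simp_all
  from normal_grid[OF this, of s 0] obtain x where x: "x 2 = s"
    "\<And>j. 1 \<le> j \<Longrightarrow> j \<le> 2 \<Longrightarrow> normal_cdf 0 1 (x j) = real j * (normal_cdf 0 1 s / real 2)"
    by (metis (no_types, lifting))
  have "\<exists>A\<in>admissible s. (1 - 2 * (1 / 4)) * (\<Sum>j=3..(2::nat). sqrt ((1 - 1) * (normal_cdf 0 1 s / real 2)))
           \<le> density_fidelity (deriv A) (normal_density 0 1)"
    by (rule discrete_le_density_fidelity[where x = x and a = "\<lambda>_. 1"])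
       (use x normal_cdf_bounds[of 1 0 s] std_normal_cdf_le_1 in auto)
  thus ?thesis by blast
qed

text \<open>\<open>rayleigh_normal\<close> involves a supremum of squares. As fidelities are
  nonnegative and bounded, its root has the two characteristic properties of the supremum of the
  fidelities themselves.\<close>

lemma rayleigh_normal_sup:
  fixes v s \<mu> :: real
  assumes v: "v > 0"
  defines "S \<equiv> sqrt (1 - rayleigh_normal v s \<mu>)"
    and "F \<equiv> \<lambda>A. density_fidelity (deriv A) (normal_density \<mu> (sqrt v))"
  shows "\<And>A. A \<in> admissible s \<Longrightarrow> F A \<le> S"
    and "\<And>e. e > 0 \<Longrightarrow> \<exists>A\<in>admissible s. S - e < F A"
proof -
  have \<sigma>: "sqrt v > 0" using v by simp
  have b: "0 \<le> F A" "F A \<le> 1" if "A \<in> admissible s" for A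
    unfolding F_def using density_fidelity_bounds[OF \<sigma> that] by auto
  have S: "S = sqrt (SUP A\<in>admissible s. (F A)\<^sup>2)"
    by (simp add: S_def rayleigh_normal_def F_def)
  have bdd: "bdd_above ((\<lambda>A. (F A)\<^sup>2) ` admissible s)"
  proof (rule bdd_aboveI2)
    show "(F A)\<^sup>2 \<le> 1" if "A \<in> admissible s" for A
      using b[OF that] by (simp add: power_le_one)
  qed
  show le: "F A \<le> S" if "A \<in> admissible s" for A
    unfolding S using cSUP_upper[OF that bdd] by (rule real_le_rsqrt)
  show "\<exists>A\<in>admissible s. S - e < F A" if e: "e > 0" for e
  \<comment> \<open>Squaring preserves the order only among nonnegative numbers; a negative bound is
    beaten by any admissible function.\<close>
  proof (cases "S - e < 0")
    case True
    obtain A where "A \<in> admissible s" using admissible_nonempty by blast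
    thus ?thesis using b(1)[of A] True by (intro bexI[of _ A]) auto
  next
    case False
    hence "(S - e)\<^sup>2 < S\<^sup>2" using e by (intro power_strict_mono) auto
    also have "S\<^sup>2 = (SUP A\<in>admissible s. (F A)\<^sup>2)"
    proof -
      obtain A where A: "A \<in> admissible s" using admissible_nonempty by blast
      have "0 \<le> (F A)\<^sup>2" by simp
      also have "\<dots> \<le> (SUP A\<in>admissible s. (F A)\<^sup>2)" by (rule cSUP_upper[OF A bdd])
      finally show ?thesis by (simp add: S)
    qed
    finally obtain A where "A \<in> admissible s" "(S - e)\<^sup>2 < (F A)\<^sup>2"
      using less_cSUP_iff[OF admissible_nonempty bdd] by blast
    thus ?thesis using b(1)[of A] by (intro bexI[of _ A]) (auto intro: power2_less_imp_less)
  qed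
qed

text \<open>The loss factor \<open>1 - 2 * \<eta>\<close> of the smoothing runs through all
  \<open>z\<close> in (0, 1), while the right-hand side stays fixed; letting \<open>z\<close> tend
  to 1 removes it.\<close>

lemma discrete_sum_le_rayleigh_normal:
  fixes x a :: "nat \<Rightarrow> real"
  assumes v: "v > 0" and k: "k \<ge> 2" and \<delta>: "\<delta> > 0"
    and x: "\<And>j. 1 \<le> j \<Longrightarrow> j \<le> k \<Longrightarrow> normal_cdf \<mu> (sqrt v) (x j) = real j * \<delta>" "x k = s"
    and a: "\<And>i j. i \<le> j \<Longrightarrow> j \<le> k \<Longrightarrow> a i \<le> a j" "a k = 1"
      "\<And>j. 1 \<le> j \<Longrightarrow> j \<le> k \<Longrightarrow> std_normal_cdf (x j) \<le> a j"
  shows "(\<Sum>j=3..k. sqrt ((a j - a (j - 1)) * \<delta>)) \<le> sqrt (1 - rayleigh_normal v s \<mu>)"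
proof (rule field_le_mult_one_interval)
  fix z :: real assume z: "0 < z" "z < 1"
  have "sqrt v > 0" using v by simp
  from discrete_le_density_fidelity[OF this k \<delta> x a, of "(1 - z) / 2"] z
  obtain A where A: "A \<in> admissible s"
    "(1 - 2 * ((1 - z) / 2)) * (\<Sum>j=3..k. sqrt ((a j - a (j - 1)) * \<delta>)) \<le> density_fidelity (deriv A) (normal_density \<mu> (sqrt v))"
    by auto
  have z2: "1 - 2 * ((1 - z) / 2) = z" by (simp add: field_simps)
  show "z * (\<Sum>j=3..k. sqrt ((a j - a (j - 1)) * \<delta>)) \<le> sqrt (1 - rayleigh_normal v s \<mu>)"
    using A(2)[unfolded z2] rayleigh_normal_sup(1)[OF v A(1), of \<mu>] by (rule order_trans)
qed

section \<open>One-shot bounds\<close>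

lemma sum_pmf_le_1: "finite Y \<Longrightarrow> sum (pmf P) Y \<le> 1"
  by (metis measure_measure_pmf_finite measure_pmf.prob_le_1)

lemma fidelity_le_1:
  assumes "finite Y"
  shows "fidelity Y P Q \<le> 1"
proof -
  have "fidelity Y P Q \<le> (\<Sum>y\<in>Y. (pmf P y + pmf Q y) / 2)"
    unfolding fidelity_def
    using arith_geo_mean_sqrt by (intro sum_mono) (simp add: real_sqrt_mult[symmetric])
  also have "\<dots> = (sum (pmf P) Y + sum (pmf Q) Y) / 2"
    by (simp add: sum.distrib sum_divide_distrib[symmetric])
  also have "\<dots> \<le> 1" using sum_pmf_le_1[OF assms, of P] sum_pmf_le_1[OF assms, of Q] by simp
  finally show ?thesis .
qed

section \<open>Deterministic conversions\<close>

text \<open>The storage limits only the number of values of the composite map; an enumeration of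
  \<open>I\<close> serves as the code.\<close>

lemma fid_det_ge_map:
  assumes Y: "finite Y" and I: "range g \<subseteq> I" "I \<subseteq> Y" "card I \<le> nat \<lfloor>2 powr N\<rfloor>"
  shows "fidelity Y (map_pmf g P) Q \<le> fid_det X Y P Q N"
proof -
  have fI: "finite I" using I(2) Y finite_subset by blast
  obtain e where e: "bij_betw e I {0..<card I}" using ex_bij_betw_finite_nat[OF fI] by blast
  define f where "f = e \<circ> g"
  \<comment> \<open>Storage cells outside the code must be sent into \<open>Y\<close> as well; some
    value of \<open>g\<close> is used for them.\<close>
  define f' where "f' i = (if i \<in> e ` I then inv_into I e i else g undefined)" for i
  have gI: "g x \<in> I" for x using I(1) by auto
  have "f x < card I" for x using gI[of x] e by (auto simp: f_def bij_betw_def)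
  hence "f \<in> X \<rightarrow> storage N" using I(3) by (auto simp: storage_def intro: less_le_trans)
  moreover have "f' i \<in> I" for i using gI inv_into_into[of i e I] by (auto simp: f'_def)
  hence "f' \<in> storage N \<rightarrow> Y" using I(2) by auto
  moreover have "f' (f x) = g x" for x
    using gI[of x] e by (auto simp: f'_def f_def bij_betw_def)
  hence "map_pmf f' (map_pmf f P) = map_pmf g P" by (simp add: pmf.map_comp comp_def)
  ultimately have "fidelity Y (map_pmf g P) Q \<in>
      {fidelity Y (map_pmf f' (map_pmf f P)) Q | f f'. f \<in> X \<rightarrow> storage N \<and> f' \<in> storage N \<rightarrow> Y}"
    by (smt (verit) mem_Collect_eq)
  thus ?thesis unfolding fid_det_def
    by (rule cSup_upper) (use fidelity_le_1[OF Y] in \<open>auto intro!: bdd_aboveI[of _ 1]\<close>)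
qed

text \<open>Each stage of a deterministic conversion leads to a majorizing distribution.
  Nonemptiness is recorded for the suprema over reals; \<open>0 \<le> N\<close> provides a storage
  cell.\<close>

lemma fid_det_le_fid_maj:
  assumes X: "set_pmf P \<subseteq> X" "finite (set_pmf P)" and Y: "finite Y" "Y \<noteq> {}" and N: "0 \<le> N"
  shows "fid_det X Y P Q N \<le> fid_maj Y P Q N"
    and "{fidelity Y P'' Q | P''. P'' \<in> dists_on Y \<and>
            (\<exists>P'\<in>dists_on (storage N). majorized P P' \<and> majorized P' P'')} \<noteq> {}" (is "?M \<noteq> {}")
proof -
  let ?D = "{fidelity Y (map_pmf f' (map_pmf f P)) Q | f f'. f \<in> X \<rightarrow> storage N \<and> f' \<in> storage N \<rightarrow> Y}"
  have "1 \<le> (2::real) powr N" using N by (simp add: ge_one_powr_ge_zero)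
  hence "0 < nat \<lfloor>2 powr N\<rfloor>" by simp
  moreover obtain y where y: "y \<in> Y" using Y(2) by blast
  ultimately have "fidelity Y (map_pmf (\<lambda>_. y) (map_pmf (\<lambda>_. 0) P)) Q \<in> ?D"
    unfolding mem_Collect_eq by (intro exI[of _ "\<lambda>_. 0 :: nat"] exI[of _ "\<lambda>_. y"]) (auto simp: storage_def)
  hence ne: "?D \<noteq> {}" by blast
  have sub: "?D \<subseteq> ?M"
  proof
    fix v assume "v \<in> ?D"
    then obtain f f' where v: "v = fidelity Y (map_pmf f' (map_pmf f P)) Q"
      and f: "f \<in> X \<rightarrow> storage N" "f' \<in> storage N \<rightarrow> Y" by blast
    have "map_pmf f P \<in> dists_on (storage N)" "map_pmf f' (map_pmf f P) \<in> dists_on Y"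
      using f X(1) by (auto simp: dists_on_def)
    moreover have "majorized P (map_pmf f P)" "majorized (map_pmf f P) (map_pmf f' (map_pmf f P))"
      using X(2) by (auto intro!: majorized_map_pmf simp del: map_pmf_comp)
    ultimately show "v \<in> ?M" unfolding v by blast
  qed
  show "?M \<noteq> {}" using ne sub by blast
  show "fid_det X Y P Q N \<le> fid_maj Y P Q N"
    unfolding fid_det_def fid_maj_def
    by (rule cSup_subset_mono[OF ne _ sub]) (use fidelity_le_1[OF Y(1)] in \<open>auto intro!: bdd_aboveI[of _ 1]\<close>)
qed

text \<open>Bin \<open>B j\<close> is to receive mass \<open>d j\<close> from source outcomes of
  probability at most \<open>\<kappa> j\<close>, while its own outcomes have probability at least
  \<open>\<rho> j\<close>. Filling an outcome misses its share by at most \<open>\<kappa> j\<close>,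
  which costs at most sqrt (\<open>\<kappa> j / \<rho> j\<close>) over the whole bin. The thresholds
  decrease in \<open>j\<close>, so the last bin is served first and the supply condition concerns
  tails of \<open>d\<close>.\<close>

lemma fid_det_ge_bins:
  fixes d \<kappa> \<rho> :: "nat \<Rightarrow> real" and B :: "nat \<Rightarrow> 'b set"
  assumes P: "finite (set_pmf P)" and Y: "finite Y" "set_pmf Q \<subseteq> Y"
    and B: "disjoint_family_on B {1..K}" "\<And>j. j \<in> {1..K} \<Longrightarrow> B j \<subseteq> set_pmf Q" "(\<Union>j\<in>{1..K}. B j) \<noteq> {}"
      "card (\<Union>j\<in>{1..K}. B j) \<le> nat \<lfloor>2 powr N\<rfloor>"
    and \<rho>: "\<And>j y. j \<in> {1..K} \<Longrightarrow> y \<in> B j \<Longrightarrow> \<rho> j \<le> pmf Q y" "\<And>j. j \<in> {1..K} \<Longrightarrow> 0 < \<rho> j"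
    and \<kappa>: "\<And>j. j \<in> {1..K} \<Longrightarrow> 0 < \<kappa> j" "\<And>i j. i \<in> {1..K} \<Longrightarrow> j \<in> {1..K} \<Longrightarrow> i < j \<Longrightarrow> \<kappa> j < \<kappa> i"
    and d: "\<And>j. j \<in> {1..K} \<Longrightarrow> 0 \<le> d j"
      "\<And>j. j \<in> {1..K} \<Longrightarrow> (\<Sum>i=j..K. d i) \<le> measure P {x. pmf P x \<le> \<kappa> j}"
  shows "(\<Sum>j=1..K. sqrt (d j * measure Q (B j)) - sqrt (\<kappa> j / \<rho> j)) \<le> fid_det X Y P Q N"
proof -
  define T where "T = (\<Union>j\<in>{1..K}. B j)"
  define idx where "idx y = (SOME j. j \<in> {1..K} \<and> y \<in> B j)" for y
  have idx: "idx y = j" if "j \<in> {1..K}" "y \<in> B j" for y j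
  proof -
    have *: "idx y \<in> {1..K} \<and> y \<in> B (idx y)"
      unfolding idx_def by (rule someI[of _ j]) (use that in simp)
    show ?thesis
    proof (rule ccontr)
      assume "idx y \<noteq> j"
      hence "B (idx y) \<inter> B j = {}" using disjoint_family_onD[OF B(1)] * that(1) by simp
      thus False using * that(2) by blast
    qed
  qed
  have finQ: "finite (set_pmf Q)" using Y finite_subset by blast
  have finB: "finite (B j)" if "j \<in> {1..K}" for j using B(2)[OF that] finQ finite_subset by blast
  have finT: "finite T" using finB by (auto simp: T_def)
  have mB: "measure Q (B j) = sum (pmf Q) (B j)" if "j \<in> {1..K}" for j
    using finB[OF that] by (rule measure_measure_pmf_finite)
  \<comment> \<open>Inside a bin the mass is split in proportion to \<open>Q\<close>, the case of
    equality in Cauchy-Schwarz.\<close>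
  define \<tau> where "\<tau> y = d (idx y) * pmf Q y / measure Q (B (idx y))" for y
  have sumT: "sum F T = (\<Sum>j=1..K. \<Sum>y\<in>B j. F y)" for F :: "'b \<Rightarrow> real"
    unfolding T_def using finB B(1) by (intro sum.UNION_disjoint_family) auto
  have idxT: "idx y \<in> {1..K}" "y \<in> B (idx y)" if "y \<in> T" for y
    using that idx by (auto simp: T_def)
  have "\<exists>S. (\<forall>y\<in>T. S y \<subseteq> set_pmf P \<and> sum (pmf P) (S y) \<le> \<tau> y \<and> \<tau> y - \<kappa> (idx y) \<le> sum (pmf P) (S y))
           \<and> disjoint_family_on S T"
  proof (rule greedy_allocation[OF finT P])
    fix y assume y: "y \<in> T"
    show "0 \<le> \<tau> y" using d(1)[OF idxT(1)[OF y]] by (simp add: \<tau>_def)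
    show "0 \<le> \<kappa> (idx y)" using \<kappa>(1)[OF idxT(1)[OF y]] by simp
    define j where "j = idx y"
    have j: "j \<in> {1..K}" using idxT[OF y] by (simp add: j_def)
    have eq: "{z \<in> T. \<kappa> (idx z) \<le> \<kappa> (idx y)} = (\<Union>i\<in>{j..K}. B i)"
    proof (intro equalityI subsetI)
      fix z assume z: "z \<in> {z \<in> T. \<kappa> (idx z) \<le> \<kappa> (idx y)}"
      hence "\<not> idx z < j" using \<kappa>(2)[of "idx z" j] idxT[of z] j by (auto simp: j_def)
      thus "z \<in> (\<Union>i\<in>{j..K}. B i)" using idxT[of z] z by auto
    next
      fix z assume "z \<in> (\<Union>i\<in>{j..K}. B i)"
      then obtain i where i: "i \<in> {j..K}" "z \<in> B i" by blast
      hence "i \<in> {1..K}" using j by auto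
      hence "idx z = i" "z \<in> T" using idx i by (auto simp: T_def)
      moreover have "\<kappa> i \<le> \<kappa> j" using \<kappa>(2)[of j i] i j \<open>i \<in> {1..K}\<close> by (cases "i = j") auto
      ultimately show "z \<in> {z \<in> T. \<kappa> (idx z) \<le> \<kappa> (idx y)}" by (simp add: j_def)
    qed
    have "(\<Sum>z\<in>{z \<in> T. \<kappa> (idx z) \<le> \<kappa> (idx y)}. \<tau> z) = (\<Sum>i=j..K. \<Sum>z\<in>B i. \<tau> z)"
      unfolding eq using finB j B(1)
      by (intro sum.UNION_disjoint_family) (auto simp: disjoint_family_on_def)
    also have "\<dots> \<le> (\<Sum>i=j..K. d i)"
    proof (rule sum_mono)
      fix i assume "i \<in> {j..K}"
      hence i: "i \<in> {1..K}" using j by auto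
      have "(\<Sum>z\<in>B i. \<tau> z) = (\<Sum>z\<in>B i. d i / measure Q (B i) * pmf Q z)"
        using idx[OF i] by (intro sum.cong refl) (simp add: \<tau>_def)
      also have "\<dots> = d i / measure Q (B i) * measure Q (B i)"
        by (simp only: sum_distrib_left[symmetric] mB[OF i, symmetric])
      also have "\<dots> \<le> d i" using d(1)[OF i] by simp
      finally show "(\<Sum>z\<in>B i. \<tau> z) \<le> d i" .
    qed
    also have "\<dots> \<le> measure P {x. pmf P x \<le> \<kappa> j}" by (rule d(2)[OF j])
    also have "\<dots> = measure P {x \<in> set_pmf P. pmf P x \<le> \<kappa> j}"
      by (intro measure_pmf.finite_measure_eq_AE) (auto simp: AE_measure_pmf_iff)
    also have "\<dots> = (\<Sum>x\<in>{x \<in> set_pmf P. pmf P x \<le> \<kappa> j}. pmf P x)"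
      using P by (intro measure_measure_pmf_finite) auto
    finally show "(\<Sum>z\<in>{z \<in> T. \<kappa> (idx z) \<le> \<kappa> (idx y)}. \<tau> z) \<le>
        (\<Sum>x\<in>{x \<in> set_pmf P. pmf P x \<le> \<kappa> (idx y)}. pmf P x)" by (simp add: j_def)
  qed simp
  then obtain S where S: "\<And>y. y \<in> T \<Longrightarrow> S y \<subseteq> set_pmf P"
    "\<And>y. y \<in> T \<Longrightarrow> \<tau> y - \<kappa> (idx y) \<le> sum (pmf P) (S y)" "disjoint_family_on S T" by blast
  obtain y\<^sub>0 where y0: "y\<^sub>0 \<in> T" using B(3) by (auto simp: T_def)
  \<comment> \<open>Source outcomes that are not allotted all go to one target outcome; extra mass
    can only help the lower bound.\<close>
  define g where "g x = (if \<exists>y\<in>T. x \<in> S y then SOME y. y \<in> T \<and> x \<in> S y else y\<^sub>0)" for x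
  have g: "g x = y" if "y \<in> T" "x \<in> S y" for x y
  proof -
    have "g x = (SOME y. y \<in> T \<and> x \<in> S y)" using that by (auto simp: g_def)
    moreover have "(SOME y. y \<in> T \<and> x \<in> S y) \<in> T \<and> x \<in> S (SOME y. y \<in> T \<and> x \<in> S y)"
      by (rule someI[of _ y]) (use that in simp)
    ultimately have *: "g x \<in> T \<and> x \<in> S (g x)" by simp
    show ?thesis
    proof (rule ccontr)
      assume "g x \<noteq> y"
      hence "S (g x) \<inter> S y = {}" using disjoint_family_onD[OF S(3)] * that(1) by simp
      thus False using * that(2) by blast
    qed
  qed
  have gT: "g x \<in> T" for x
  proof (cases "\<exists>y\<in>T. x \<in> S y")
    case True
    then obtain y where "y \<in> T" "x \<in> S y" by blast
    thus ?thesis using g by simp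
  next
    case False
    thus ?thesis using y0 by (simp add: g_def)
  qed
  have TQ: "T \<subseteq> set_pmf Q" unfolding T_def using B(2) by (intro UN_least)
  have push: "\<tau> y - \<kappa> (idx y) \<le> pmf (map_pmf g P) y" if y: "y \<in> T" for y
  proof -
    have "sum (pmf P) (S y) = measure P (S y)"
      using finite_subset[OF S(1)[OF y] P] by (rule measure_measure_pmf_finite[symmetric])
    also have "\<dots> \<le> measure P (g -` {y})"
      using g y by (intro measure_pmf.finite_measure_mono) auto
    also have "\<dots> = pmf (map_pmf g P) y" by (simp add: pmf_map)
    finally show ?thesis using S(2)[OF y] by simp
  qed
  have "(\<Sum>j=1..K. sqrt (d j * measure Q (B j)) - sqrt (\<kappa> j / \<rho> j)) \<le>
      (\<Sum>j=1..K. \<Sum>y\<in>B j. (sqrt (\<tau> y) - sqrt (\<kappa> (idx y))) * sqrt (pmf Q y))"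
  proof (rule sum_mono)
    fix j assume j: "j \<in> {1..K}"
    have "(\<Sum>y\<in>B j. sqrt (\<tau> y) * sqrt (pmf Q y)) = (\<Sum>y\<in>B j. sqrt (d j / measure Q (B j)) * pmf Q y)"
    proof (intro sum.cong refl)
      fix y assume "y \<in> B j"
      hence "sqrt (\<tau> y) * sqrt (pmf Q y) = sqrt (d j / measure Q (B j)) * (sqrt (pmf Q y) * sqrt (pmf Q y))"
        using idx[OF j] by (simp add: \<tau>_def real_sqrt_mult real_sqrt_divide)
      thus "sqrt (\<tau> y) * sqrt (pmf Q y) = sqrt (d j / measure Q (B j)) * pmf Q y" by simp
    qed
    also have "\<dots> = sqrt (d j / measure Q (B j)) * measure Q (B j)"
      by (simp only: sum_distrib_left[symmetric] mB[OF j, symmetric])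
    also have "\<dots> = sqrt (d j * measure Q (B j))"
    proof (cases "measure Q (B j) = 0")
      case False
      hence "sqrt (measure Q (B j)) * sqrt (measure Q (B j)) = measure Q (B j)" "sqrt (measure Q (B j)) \<noteq> 0"
        by simp_all
      thus ?thesis by (simp add: real_sqrt_mult real_sqrt_divide field_simps)
    qed simp
    finally have 1: "(\<Sum>y\<in>B j. sqrt (\<tau> y) * sqrt (pmf Q y)) = sqrt (d j * measure Q (B j))" .
    \<comment> \<open>The bound \<open>\<rho> j \<le> pmf Q y\<close> completes one root to a full
      \<open>pmf Q y\<close>, whose sum over the bin is at most 1; the number of outcomes in the bin
      drops out.\<close>
    have "(\<Sum>y\<in>B j. sqrt (\<kappa> (idx y)) * sqrt (pmf Q y)) \<le> (\<Sum>y\<in>B j. sqrt (\<kappa> j / \<rho> j) * pmf Q y)"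
    proof (rule sum_mono)
      fix y assume y: "y \<in> B j"
      have r: "0 < sqrt (\<rho> j)" "sqrt (\<rho> j) \<le> sqrt (pmf Q y)" using \<rho>(1)[OF j y] \<rho>(2)[OF j] by simp_all
      have "sqrt (\<kappa> (idx y)) * sqrt (pmf Q y) = sqrt (\<kappa> j) / sqrt (\<rho> j) * (sqrt (\<rho> j) * sqrt (pmf Q y))"
        using idx[OF j y] r by simp
      also have "\<dots> \<le> sqrt (\<kappa> j) / sqrt (\<rho> j) * (sqrt (pmf Q y) * sqrt (pmf Q y))"
        using r \<kappa>(1)[OF j] by (intro mult_left_mono mult_right_mono) auto
      also have "\<dots> = sqrt (\<kappa> j / \<rho> j) * pmf Q y" by (simp add: real_sqrt_divide)
      finally show "sqrt (\<kappa> (idx y)) * sqrt (pmf Q y) \<le> sqrt (\<kappa> j / \<rho> j) * pmf Q y" .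
    qed
    also have "\<dots> = sqrt (\<kappa> j / \<rho> j) * measure Q (B j)"
      by (simp only: sum_distrib_left[symmetric] mB[OF j, symmetric])
    also have "\<dots> \<le> sqrt (\<kappa> j / \<rho> j)" using \<kappa>(1)[OF j] \<rho>(2)[OF j] by (intro mult_left_le) auto
    finally have 2: "(\<Sum>y\<in>B j. sqrt (\<kappa> (idx y)) * sqrt (pmf Q y)) \<le> sqrt (\<kappa> j / \<rho> j)" .
    show "sqrt (d j * measure Q (B j)) - sqrt (\<kappa> j / \<rho> j) \<le>
        (\<Sum>y\<in>B j. (sqrt (\<tau> y) - sqrt (\<kappa> (idx y))) * sqrt (pmf Q y))"
      using 1 2 by (simp add: left_diff_distrib sum_subtractf)
  qed
  also have "\<dots> = (\<Sum>y\<in>T. (sqrt (\<tau> y) - sqrt (\<kappa> (idx y))) * sqrt (pmf Q y))" by (rule sumT[symmetric])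
  also have "\<dots> \<le> (\<Sum>y\<in>T. sqrt (pmf (map_pmf g P) y) * sqrt (pmf Q y))"
  proof (intro sum_mono mult_right_mono)
    fix y assume y: "y \<in> T"
    have k0: "0 \<le> \<kappa> (idx y)" using \<kappa>(1)[OF idxT(1)[OF y]] by simp
    have "sqrt (\<tau> y) \<le> sqrt (pmf (map_pmf g P) y + \<kappa> (idx y))" using push[OF y] by simp
    also have "\<dots> \<le> sqrt (pmf (map_pmf g P) y) + sqrt (\<kappa> (idx y))" by (rule sqrt_add_le_add_sqrt) (use k0 in auto)
    finally show "sqrt (\<tau> y) - sqrt (\<kappa> (idx y)) \<le> sqrt (pmf (map_pmf g P) y)" by simp
  qed simp
  also have "\<dots> \<le> fidelity Y (map_pmf g P) Q"
    unfolding fidelity_def using Y TQ by (intro sum_mono2) auto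
  also have "\<dots> \<le> fid_det X Y P Q N"
    using gT TQ Y B(4) by (intro fid_det_ge_map[of _ _ T]) (auto simp: T_def)
  finally show ?thesis .
qed

section \<open>Blocks of ranks and level sets\<close>

lemma sum_sqrt_mult_le:
  fixes a b :: "'i \<Rightarrow> real"
  assumes "\<And>i. i \<in> I \<Longrightarrow> 0 \<le> a i" "\<And>i. i \<in> I \<Longrightarrow> 0 \<le> b i"
  shows "(\<Sum>i\<in>I. sqrt (a i) * sqrt (b i)) \<le> sqrt (sum a I * sum b I)"
proof (rule le_sqrt_mult_of_AM_GM)
  show "0 \<le> sum a I" "0 \<le> sum b I" using assms by (auto intro: sum_nonneg)
  fix c :: real assume "c > 0"
  hence "(\<Sum>i\<in>I. sqrt (a i) * sqrt (b i)) \<le> (\<Sum>i\<in>I. (c * a i + b i / c) / 2)"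
    using sqrt_mult_le_AM_GM assms by (intro sum_mono) (simp add: real_sqrt_mult)
  also have "\<dots> = (c * sum a I + sum b I / c) / 2"
    by (simp add: sum.distrib sum_distrib_left flip: sum_divide_distrib)
  finally show "(\<Sum>i\<in>I. sqrt (a i) * sqrt (b i)) \<le> (c * sum a I + sum b I / c) / 2" .
qed

text \<open>Ranks are grouped into the blocks between consecutive \<open>L j\<close>, with
  Cauchy-Schwarz in each block. Ranks from \<open>L k\<close> on drop out because \<open>P\<close>
  has no mass left there.\<close>

lemma fidelity_le_bins:
  assumes "finite (set_pmf P)" "finite (set_pmf Q)" "finite Y" "top_sum P (L k) = 1"
    and L: "L 0 = 0" "\<And>j. j < k \<Longrightarrow> L j \<le> L (Suc j)"
  shows "fidelity Y P Q \<le> (\<Sum>j=1..k. sqrt ((top_sum P (L j) - top_sum P (L (j - 1)))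
            * (top_sum Q (L j) - top_sum Q (L (j - 1)))))"
proof -
  let ?F = "\<lambda>i. sqrt (sorted_prob P i) * sqrt (sorted_prob Q i)"
  define M where "M = max (L k) (card (set_pmf Q))"
  have zero: "sorted_prob P i = 0" if "L k \<le> i" for i
  proof -
    have "top_sum P (L k) + sorted_prob P i \<le> top_sum P (Suc i)"
      using top_sum_mono[OF that, of P] by (simp add: top_sum_def)
    thus ?thesis using assms(4) top_sum_le_1[OF assms(1), of "Suc i"] sorted_prob_nonneg[of P i] by simp
  qed
  have "fidelity Y P Q \<le> (\<Sum>i<M. ?F i)"
    by (rule fidelity_le_sorted) (use assms in \<open>auto simp: M_def\<close>)
  also have "\<dots> = (\<Sum>i<L k. ?F i)"
    by (intro sum.mono_neutral_right) (auto simp: M_def zero)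
  also have "(\<Sum>i<L n. ?F i) \<le> (\<Sum>j=1..n. sqrt ((top_sum P (L j) - top_sum P (L (j - 1)))
            * (top_sum Q (L j) - top_sum Q (L (j - 1)))))" if "n \<le> k" for n
    using that
  proof (induction n)
    case 0
    then show ?case using L by simp
  next
    case (Suc n)
    have le: "L n \<le> L (Suc n)" using Suc.prems by (intro L) simp
    hence split: "{..<L (Suc n)} = {..<L n} \<union> {L n..<L (Suc n)}" by auto
    have diff: "sum f {L n..<L (Suc n)} = sum f {..<L (Suc n)} - sum f {..<L n}" for f :: "nat \<Rightarrow> real"
      unfolding split by (subst sum.union_disjoint) auto
    have "(\<Sum>i<L (Suc n). ?F i) = (\<Sum>i<L n. ?F i) + (\<Sum>i\<in>{L n..<L (Suc n)}. ?F i)"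
      by (simp add: diff)
    also have "(\<Sum>i\<in>{L n..<L (Suc n)}. ?F i) \<le>
        sqrt (sum (sorted_prob P) {L n..<L (Suc n)} * sum (sorted_prob Q) {L n..<L (Suc n)})"
      by (rule sum_sqrt_mult_le) (auto simp: sorted_prob_nonneg)
    also have "\<dots> = sqrt ((top_sum P (L (Suc n)) - top_sum P (L n)) * (top_sum Q (L (Suc n)) - top_sum Q (L n)))"
      by (simp add: diff top_sum_def)
    finally show ?case using Suc by simp
  qed
  from this[OF order_refl] have "(\<Sum>i<L k. ?F i) \<le> (\<Sum>j=1..k. sqrt ((top_sum P (L j) - top_sum P (L (j - 1)))
            * (top_sum Q (L j) - top_sum Q (L (j - 1)))))" .
  finally show ?thesis .
qed

lemma finite_level_set:
  assumes "finite (set_pmf P)" "0 < c"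
  shows "{y. c \<le> pmf P y} \<subseteq> set_pmf P" "finite {y. c \<le> pmf P y}"
proof -
  show "{y. c \<le> pmf P y} \<subseteq> set_pmf P" using assms(2) by (auto simp: set_pmf_iff)
  thus "finite {y. c \<le> pmf P y}" using assms(1) finite_subset by blast
qed

lemma card_level_set:
  assumes "finite (set_pmf P)"
  shows "card {y. 2 powr - E \<le> pmf P y} \<le> nat \<lfloor>2 powr E\<rfloor>"
proof -
  let ?D = "{y. 2 powr - E \<le> pmf P y}"
  have "real (card ?D) * 2 powr - E \<le> sum (pmf P) ?D"
    using sum_bounded_below[of ?D "2 powr - E" "pmf P"] by simp
  also have "\<dots> \<le> 1" using finite_level_set[OF assms] by (intro sum_pmf_le_1) simp
  finally have "real (card ?D) \<le> 2 powr E" by (simp add: powr_minus field_simps)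
  thus ?thesis by (simp add: le_nat_iff le_floor_iff)
qed

lemma top_sum_ge_level:
  assumes "finite (set_pmf P)"
  shows "measure P {y. 2 powr - E \<le> pmf P y} \<le> top_sum P (nat \<lfloor>2 powr E\<rfloor>)"
proof -
  have "finite {y. 2 powr - E \<le> pmf P y}" using finite_level_set[OF assms] by simp
  thus ?thesis using sum_pmf_le_top_sum[OF assms _ card_level_set[OF assms]]
    by (simp add: measure_measure_pmf_finite)
qed

text \<open>Among at most \<open>2 powr E\<close> outcomes, those below the level
  \<open>2 powr - E'\<close> contribute at most \<open>2 powr (E - E')\<close>. Together with
  \<open>top_sum_ge_level\<close> this makes ranks and inverse probabilities interchangeable up to a
  gap in the exponent.\<close>

lemma top_sum_le_level:
  assumes "finite (set_pmf P)"
  shows "top_sum P (nat \<lfloor>2 powr E\<rfloor>) \<le> measure P {y. 2 powr - E' \<le> pmf P y} + 2 powr (E - E')"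
proof -
  let ?D = "{y. 2 powr - E' \<le> pmf P y}"
  obtain S where S: "S \<subseteq> set_pmf P" "card S \<le> nat \<lfloor>2 powr E\<rfloor>" "sum (pmf P) S = top_sum P (nat \<lfloor>2 powr E\<rfloor>)"
    using top_sum_attained[OF assms] by metis
  have fS: "finite S" using S(1) assms finite_subset by blast
  have fD: "finite ?D" using finite_level_set[OF assms] by simp
  have "real (card S) \<le> 2 powr E" using S(2) by (simp add: le_nat_iff le_floor_iff)
  have "sum (pmf P) S = sum (pmf P) (S \<inter> ?D) + sum (pmf P) (S - ?D)"
    by (rule sum.Int_Diff[OF fS])
  also have "sum (pmf P) (S \<inter> ?D) \<le> sum (pmf P) ?D" using fD by (intro sum_mono2) auto
  also have "sum (pmf P) (S - ?D) \<le> (\<Sum>y\<in>S - ?D. 2 powr - E')" by (intro sum_mono) auto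
  also have "\<dots> \<le> (\<Sum>y\<in>S. 2 powr - E')" using fS by (intro sum_mono2) auto
  also have "\<dots> = real (card S) * 2 powr - E'" by simp
  also have "\<dots> \<le> 2 powr E * 2 powr - E'" by (intro mult_right_mono) (fact, simp)
  also have "\<dots> = 2 powr (E - E')" by (simp add: powr_add[symmetric])
  finally show ?thesis using S(3) fD by (simp add: measure_measure_pmf_finite)
qed

lemma sqrt_perturbed_le:
  fixes p p' q \<delta> \<epsilon> :: real
  assumes "p' \<le> p + \<epsilon>" "0 \<le> p" "p \<le> 1" "q \<le> \<delta> + \<epsilon>" "0 \<le> q" "0 \<le> \<delta>" "\<delta> \<le> 1" "0 \<le> \<epsilon>" "\<epsilon> \<le> 1"
  shows "sqrt (p' * q) \<le> sqrt (p * \<delta>) + 2 * sqrt \<epsilon>"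
proof -
  have "p' * q \<le> (p + \<epsilon>) * q" using assms by (intro mult_right_mono) auto
  also have "\<dots> \<le> (p + \<epsilon>) * (\<delta> + \<epsilon>)" using assms by (intro mult_left_mono) auto
  also have "\<dots> = p * \<delta> + \<epsilon> * (p + \<delta> + \<epsilon>)" by (simp add: algebra_simps)
  \<comment> \<open>The bracket is at most 3; 4 is taken for its integer root.\<close>
  also have "\<epsilon> * (p + \<delta> + \<epsilon>) \<le> \<epsilon> * 4" using assms by (intro mult_left_mono) auto
  finally have "sqrt (p' * q) \<le> sqrt (p * \<delta> + \<epsilon> * 4)" by simp
  also have "\<dots> \<le> sqrt (p * \<delta>) + sqrt (\<epsilon> * 4)" using assms by (intro sqrt_add_le_add_sqrt) auto
  finally show ?thesis by (simp add: real_sqrt_mult)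
qed

text \<open>The price of giving up the first \<open>r\<close> bins: two in the converse, three in
  achievability.\<close>

lemma sum_first_terms_le:
  fixes p :: "nat \<Rightarrow> real"
  assumes "r \<le> k" "\<And>j. 1 \<le> j \<Longrightarrow> j \<le> r \<Longrightarrow> p j \<le> c"
  shows "(\<Sum>j=1..k. p j) \<le> real r * c + (\<Sum>j=Suc r..k. p j)"
proof -
  have "{1..k} = {1..r} \<union> {Suc r..k}" using assms(1) by auto
  hence "(\<Sum>j=1..k. p j) = (\<Sum>j=1..r. p j) + (\<Sum>j=Suc r..k. p j)"
    by (simp only:) (rule sum.union_disjoint, auto)
  moreover have "(\<Sum>j=1..r. p j) \<le> real r * c"
    using sum_bounded_above[of "{1..r}" p c] assms(2) by simp
  ultimately show ?thesis by simp
qed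

section \<open>Asymptotics\<close>

locale conversion =
  fixes P :: "'a pmf" and Q :: "'b pmf" and t :: real
  assumes finP: "finite (set_pmf P)" and finQ: "finite (set_pmf Q)"
    and nuP: "non_uniform P" and nuQ: "non_uniform Q"
begin

lemmas positive = varentropy_pos[OF finP nuP] varentropy_pos[OF finQ nuQ]
  entropy_pos[OF finP nuP] entropy_pos[OF finQ nuQ]

abbreviation \<mu> :: real where "\<mu> \<equiv> t * coeff_D P Q"
abbreviation \<sigma> :: real where "\<sigma> \<equiv> sqrt (coeff_C P Q)"

definition bits :: "real \<Rightarrow> nat \<Rightarrow> real" where
  "bits x n = pmf_entropy P * real n + x * (sqrt (pmf_varentropy P) * sqrt (real n))"

abbreviation Pn :: "nat \<Rightarrow> (nat \<Rightarrow> 'a) pmf" where "Pn n \<equiv> iid_pmf n P"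
abbreviation Qn :: "nat \<Rightarrow> (nat \<Rightarrow> 'b) pmf" where "Qn n \<equiv> iid_pmf (target_len P Q t n) Q"

lemma finPn: "finite (set_pmf (Pn n))" and finQn: "finite (set_pmf (Qn n))"
  using finP finQ by (auto intro: finite_set_iid_pmf)

lemma coeff_C_pos: "coeff_C P Q > 0"
  using positive by (simp add: coeff_C_def)

lemma \<sigma>_pos: "\<sigma> > 0"
  using coeff_C_pos by simp

lemma bits_mono: "x \<le> y \<Longrightarrow> bits x n \<le> bits y n"
  using positive unfolding bits_def by (intro add_left_mono mult_right_mono) auto

lemma bits_strict_mono: "x < y \<Longrightarrow> 0 < n \<Longrightarrow> bits x n < bits y n"
  using positive unfolding bits_def by (intro add_strict_left_mono mult_strict_right_mono) auto

text \<open>Any gap in \<open>x\<close>, however small, is a gap of order sqrt n in the exponent.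
  This makes rounding, and the passage between ranks and probabilities, negligible.\<close>

lemma bits_diff_at_bot:
  assumes "x < y"
  shows "(\<lambda>n. 2 powr (bits x n - bits y n)) \<longlonglongrightarrow> 0"
proof -
  define c where "c = (y - x) * sqrt (pmf_varentropy P)"
  have c: "c > 0" using assms positive by (simp add: c_def)
  have "bits x n - bits y n = - (c * sqrt (real n))" for n by (simp add: bits_def c_def algebra_simps)
  moreover have "(\<lambda>n. 2 powr (- (c * sqrt (real n)))) \<longlonglongrightarrow> 0" using c by real_asymp
  ultimately show ?thesis by simp
qed

lemma bits_at_top: "filterlim (bits x) at_top sequentially"
proof -
  have "filterlim (\<lambda>n. pmf_entropy P * real n + (x * sqrt (pmf_varentropy P)) * sqrt (real n)) at_top sequentially"
    using positive(3) by real_asymp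
  thus ?thesis unfolding bits_def[abs_def] by (simp add: mult.assoc)
qed

lemma level_mass_P:
  "(\<lambda>n. measure (Pn n) {y. 2 powr - bits x n \<le> pmf (Pn n) y}) \<longlonglongrightarrow> std_normal_cdf x"
proof (rule iid_pmf_mass_tendsto[OF finP positive(1), of "\<lambda>n. n"])
  show "filterlim (\<lambda>n::nat. n) at_top sequentially" by (rule filterlim_ident)
  have "eventually (\<lambda>n. x = (bits x n - real n * pmf_entropy P) / sqrt (real n * pmf_varentropy P)) sequentially"
    using eventually_gt_at_top[of 0]
  proof eventually_elim
    case (elim n)
    hence "sqrt (pmf_varentropy P) * sqrt (real n) \<noteq> 0" using positive by simp
    thus ?case by (simp add: bits_def real_sqrt_mult mult.commute)
  qed
  thus "(\<lambda>n. (bits x n - real n * pmf_entropy P) / sqrt (real n * pmf_varentropy P)) \<longlonglongrightarrow> x"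
    by (rule Lim_transform_eventually[OF tendsto_const])
qed

text \<open>The entropy of the target string is H(P) n + t H(Q) sqrt n up to a bounded error, so the
  leading orders cancel. In units of sqrt (V(P) n) the remaining shift is \<open>\<mu>\<close>, and
  the ratio of the variances tends to \<open>coeff_C P Q\<close>.\<close>

lemma level_mass_Q:
  "(\<lambda>n. measure (Qn n) {y. 2 powr - bits x n \<le> pmf (Qn n) y}) \<longlonglongrightarrow> normal_cdf \<mu> \<sigma> x"
proof -
  define h where "h = pmf_entropy P"
  define g where "g = pmf_entropy Q"
  define vP where "vP = pmf_varentropy P"
  define vQ where "vQ = pmf_varentropy Q"
  define c where "c = h / g"
  define r where "r n = c * real n + t * sqrt (real n)" for n :: nat
  define m where "m = target_len P Q t"
  have pos: "h > 0" "g > 0" "vP > 0" "vQ > 0" "c > 0"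
    using positive by (simp_all add: h_def g_def vP_def vQ_def c_def)
  have m: "m n = nat \<lfloor>r n\<rfloor>" for n by (simp add: m_def target_len_def r_def c_def h_def g_def)
  have r: "filterlim r at_top sequentially" unfolding r_def using pos(5) by real_asymp
  hence ev: "eventually (\<lambda>n. r n \<ge> 0) sequentially" by (simp add: filterlim_at_top)
  \<comment> \<open>The rounding error of the target length. It lies between 0 and 1 once
    \<open>r n\<close> is nonnegative, since \<open>nat\<close> truncates.\<close>
  define \<theta> where "\<theta> n = r n - real (m n)" for n
  have \<theta>: "eventually (\<lambda>n. 0 \<le> \<theta> n \<and> \<theta> n \<le> 1) sequentially"
    using ev by eventually_elim (simp add: \<theta>_def m, linarith)
  have small: "(\<lambda>n. \<theta> n / f n) \<longlonglongrightarrow> 0" if "filterlim f at_top sequentially" for f :: "nat \<Rightarrow> real"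
  proof (rule tendsto_sandwich)
    have f: "eventually (\<lambda>n. f n > 0) sequentially" using that by (simp add: filterlim_at_top_dense)
    show "eventually (\<lambda>n. 0 \<le> \<theta> n / f n) sequentially"
      using f \<theta> by eventually_elim simp
    show "eventually (\<lambda>n. \<theta> n / f n \<le> 1 / f n) sequentially"
      using f \<theta> by eventually_elim (simp add: divide_right_mono)
    show "(\<lambda>n. 1 / f n) \<longlonglongrightarrow> 0" using that by (intro tendsto_divide_0[OF tendsto_const] filterlim_at_top_imp_at_infinity)
  qed simp
  have sq: "filterlim (\<lambda>n. sqrt (real n)) at_top sequentially" by real_asymp
  have mtop: "filterlim m at_top sequentially"
  proof (rule filterlim_at_top_mono[of "\<lambda>n. nat \<lfloor>r n\<rfloor>"])
    show "filterlim (\<lambda>n. nat \<lfloor>r n\<rfloor>) at_top sequentially"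
      by (intro filterlim_compose[OF filterlim_nat_sequentially] filterlim_compose[OF filterlim_floor_sequentially] r)
  qed (simp add: m)
  have ratio: "(\<lambda>n. real (m n) / real n) \<longlonglongrightarrow> c"
  proof -
    have "(\<lambda>n. c + t / sqrt (real n) - \<theta> n / real n) \<longlonglongrightarrow> c + 0 - 0"
      by (intro tendsto_intros small filterlim_real_sequentially tendsto_divide_0[OF tendsto_const] filterlim_at_top_imp_at_infinity sq)
    moreover have "eventually (\<lambda>n. c + t / sqrt (real n) - \<theta> n / real n = real (m n) / real n) sequentially"
      using eventually_gt_at_top[of 0]
    proof eventually_elim
      case (elim n)
      have "t / sqrt (real n) = t * sqrt (real n) / real n"
        using elim by (simp add: field_simps flip: real_sqrt_mult)
      thus ?case using elim by (simp add: \<theta>_def r_def field_simps)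
    qed
    ultimately show ?thesis by (auto intro: Lim_transform_eventually)
  qed
  have "(\<lambda>n. (x * sqrt vP - g * t + g * (\<theta> n / sqrt (real n))) / sqrt (real (m n) / real n * vQ))
      \<longlonglongrightarrow> (x * sqrt vP - g * t + g * 0) / sqrt (c * vQ)"
    using pos by (intro tendsto_intros small sq ratio) auto
  moreover have "eventually (\<lambda>n. (x * sqrt vP - g * t + g * (\<theta> n / sqrt (real n))) / sqrt (real (m n) / real n * vQ)
      = (bits x n - real (m n) * g) / sqrt (real (m n) * vQ)) sequentially"
    using eventually_gt_at_top[of 0]
  proof eventually_elim
    case (elim n)
    have s: "sqrt (real n) > 0" using elim by simp
    have "bits x n - real (m n) * g = (x * sqrt vP - g * t) * sqrt (real n) + g * \<theta> n"
      using pos by (simp add: bits_def \<theta>_def r_def c_def h_def vP_def algebra_simps)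
    also have "\<dots> = (x * sqrt vP - g * t + g * (\<theta> n / sqrt (real n))) * sqrt (real n)"
      using s by (simp add: field_simps)
    finally have num: "bits x n - real (m n) * g = (x * sqrt vP - g * t + g * (\<theta> n / sqrt (real n))) * sqrt (real n)" .
    have den: "sqrt (real (m n) * vQ) = sqrt (real (m n) / real n * vQ) * sqrt (real n)"
      using elim by (simp flip: real_sqrt_mult)
    show ?case unfolding num den using s by simp
  qed
  ultimately have "(\<lambda>n. (bits x n - real (m n) * g) / sqrt (real (m n) * vQ))
      \<longlonglongrightarrow> (x * sqrt vP - g * t + g * 0) / sqrt (c * vQ)"
    by (rule Lim_transform_eventually)
  from iid_pmf_mass_tendsto[OF finQ positive(2) mtop this[unfolded g_def vQ_def]]
  have "(\<lambda>n. measure (Qn n) {y. 2 powr - bits x n \<le> pmf (Qn n) y})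
      \<longlonglongrightarrow> std_normal_cdf ((x * sqrt vP - g * t + g * 0) / sqrt (c * vQ))"
    by (simp add: m_def g_def vQ_def)
  moreover have "(x * sqrt vP - g * t + g * 0) / sqrt (c * vQ) = (x - \<mu>) / \<sigma>"
  proof -
    have "coeff_C P Q = c * vQ / vP"
      by (simp add: coeff_C_def c_def h_def g_def vP_def vQ_def)
    hence sig: "\<sigma> = sqrt (c * vQ) / sqrt vP" by (simp add: real_sqrt_divide)
    have mu: "\<mu> = g * t / sqrt vP" by (simp add: coeff_D_def g_def vP_def)
    show ?thesis unfolding sig mu using pos by (simp add: field_simps)
  qed
  ultimately show ?thesis by (simp add: normal_cdf_def)
qed

text \<open>Level sets at \<open>x\<close> give the lower bound. For the upper bound the level moves
  to some \<open>u > x\<close>, which makes the correction term vanish, and continuity of the limit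
  absorbs the move.\<close>

lemma top_sum_Q:
  "(\<lambda>n. top_sum (Qn n) (nat \<lfloor>2 powr bits x n\<rfloor>)) \<longlonglongrightarrow> normal_cdf \<mu> \<sigma> x"
proof (rule order_tendstoI)
  fix a assume "a < normal_cdf \<mu> \<sigma> x"
  hence "eventually (\<lambda>n. a < measure (Qn n) {y. 2 powr - bits x n \<le> pmf (Qn n) y}) sequentially"
    by (rule order_tendstoD(1)[OF level_mass_Q])
  thus "eventually (\<lambda>n. a < top_sum (Qn n) (nat \<lfloor>2 powr bits x n\<rfloor>)) sequentially"
    by eventually_elim (rule less_le_trans[OF _ top_sum_ge_level[OF finQn]])
next
  fix a assume a: "normal_cdf \<mu> \<sigma> x < a"
  have "eventually (\<lambda>u. normal_cdf \<mu> \<sigma> u < a) (at_right x)"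
    using isCont_normal_cdf[OF \<sigma>_pos, of x \<mu>] a
    by (intro order_tendstoD) (auto simp: isCont_def intro: tendsto_mono[OF at_le])
  moreover have "eventually (\<lambda>u. u > x) (at_right x)" by (simp add: eventually_at_filter)
  ultimately obtain u where u: "normal_cdf \<mu> \<sigma> u < a" "u > x"
    using eventually_happens[OF eventually_conj] trivial_limit_at_right_real by blast
  have "(\<lambda>n. measure (Qn n) {y. 2 powr - bits u n \<le> pmf (Qn n) y} + 2 powr (bits x n - bits u n))
      \<longlonglongrightarrow> normal_cdf \<mu> \<sigma> u + 0"
    by (intro tendsto_add level_mass_Q bits_diff_at_bot u)
  hence "eventually (\<lambda>n. measure (Qn n) {y. 2 powr - bits u n \<le> pmf (Qn n) y} + 2 powr (bits x n - bits u n) < a) sequentially"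
    by (rule order_tendstoD(2)) (use u in simp)
  thus "eventually (\<lambda>n. top_sum (Qn n) (nat \<lfloor>2 powr bits x n\<rfloor>) < a) sequentially"
    by eventually_elim (rule le_less_trans[OF top_sum_le_level[OF finQn]])
qed

abbreviation opt_value :: "real \<Rightarrow> real" where
  "opt_value s \<equiv> sqrt (1 - rayleigh_normal (coeff_C P Q) s \<mu>)"

section \<open>Converse\<close>

text \<open>One \<open>n\<close> and one output \<open>R\<close>: the limit theorems enter only as
  inequalities at finitely many grid points. Giving up two bins costs 2 / sqrt k, and replacing the
  actual masses by the ideal ones costs 2 sqrt \<epsilon> in each of the k bins.\<close>

lemma fid_maj_single_le:
  fixes x :: "nat \<Rightarrow> real"
  assumes Y: "finite Y" and k: "k \<ge> 2"
    and x: "x k = s" "\<And>j. 1 \<le> j \<Longrightarrow> j \<le> k \<Longrightarrow> normal_cdf \<mu> \<sigma> (x j) = real j * \<delta>"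
    and \<delta>: "\<delta> = normal_cdf \<mu> \<sigma> s / real k" and \<epsilon>: "0 < \<epsilon>" "\<epsilon> \<le> 1"
    and P: "\<And>j. j \<in> {1..k} \<Longrightarrow> std_normal_cdf (x j) - \<epsilon> \<le> top_sum (Pn n) (nat \<lfloor>2 powr bits (x j) n\<rfloor>)"
  defines "L \<equiv> \<lambda>j. if j = 0 then 0 else nat \<lfloor>2 powr bits (x j) n\<rfloor>"
  assumes Q: "\<And>j. j \<in> {1..k} \<Longrightarrow> top_sum (Qn n) (L j) - top_sum (Qn n) (L (j - 1)) \<le> \<delta> + \<epsilon>"
    and R: "finite (set_pmf R)" "majorized (Pn n) P'" "P' \<in> dists_on (storage (bits s n))" "majorized P' R"
  shows "fidelity Y R (Qn n) \<le> opt_value s + 2 / sqrt (real k) + 2 * real k * sqrt \<epsilon>"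
proof -
  note b = normal_cdf_bounds[OF \<sigma>_pos, of \<mu> s]
  have d: "0 < \<delta>" "\<delta> \<le> 1 / real k" "\<delta> \<le> 1" using b k by (simp_all add: \<delta> divide_right_mono divide_le_eq)
  have xmono: "x i \<le> x j" if "1 \<le> i" "i \<le> j" "j \<le> k" for i j
    using normal_cdf_le_iff[OF \<sigma>_pos, of \<mu> "x i" "x j"] x(2)[of i] x(2)[of j] that d by simp
  have Lmono: "L i \<le> L j" if "i \<le> j" "j \<le> k" for i j
    using xmono[of i j] that bits_mono[of "x i" "x j" n]
    by (auto simp: L_def intro!: nat_mono floor_mono)
  define \<alpha> where "\<alpha> j = top_sum R (L j)" for j
  \<comment> \<open>The masses \<open>\<alpha> j\<close> dominate \<Phi> only up to
    \<open>\<epsilon>\<close>. The maximum restores the exact domination that smoothing requires and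
    changes each value by at most \<open>\<epsilon>\<close>.\<close>
  define a where "a j = (if j = 0 then 0 else max (\<alpha> j) (std_normal_cdf (x j)))" for j
  have \<alpha>1: "\<alpha> k = 1"
  proof -
    have sub: "set_pmf P' \<subseteq> storage (bits s n)" using R(3) by (simp add: dists_on_def)
    have "finite (storage (bits s n))" by (simp add: storage_def)
    hence "finite (set_pmf P')" "card (set_pmf P') \<le> card (storage (bits s n))"
      using sub finite_subset card_mono by blast+
    \<comment> \<open>As \<open>x k = s\<close>, the last rank of the grid is exactly the storage
      size, so the intermediate distribution is exhausted there.\<close>
    moreover have "card (storage (bits s n)) = L k" using k x(1) by (simp add: storage_def L_def)
    ultimately have "top_sum P' (L k) = 1" by (intro top_sum_eq_1) auto
    hence "1 \<le> \<alpha> k" using R(4) unfolding majorized_iff_top_sum \<alpha>_def by metis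
    thus ?thesis using top_sum_le_1[OF R(1), of "L k"] by (simp add: \<alpha>_def)
  qed
  have L0: "L 0 = 0" by (simp add: L_def)
  hence \<alpha>0: "\<alpha> 0 = 0" by (simp add: \<alpha>_def top_sum_def)
  have \<alpha>_ge: "std_normal_cdf (x j) - \<epsilon> \<le> \<alpha> j" if "j \<in> {1..k}" for j
  proof -
    have "std_normal_cdf (x j) - \<epsilon> \<le> top_sum (Pn n) (L j)" using P[OF that] that by (simp add: L_def)
    also have "\<dots> \<le> top_sum P' (L j)" using R(2) by (simp add: majorized_iff_top_sum)
    also have "\<dots> \<le> \<alpha> j" using R(4) by (simp add: majorized_iff_top_sum \<alpha>_def)
    finally show ?thesis .
  qed
  have \<alpha>nn: "0 \<le> \<alpha> j" "\<alpha> j \<le> 1" for j using top_sum_nonneg top_sum_le_1[OF R(1)] by (auto simp: \<alpha>_def)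
  have amono: "a i \<le> a j" if "i \<le> j" "j \<le> k" for i j
  proof (cases "i = 0")
    case True
    thus ?thesis using \<alpha>nn(1)[of j] by (simp add: a_def le_max_iff_disj)
  next
    case False
    have "\<alpha> i \<le> \<alpha> j" unfolding \<alpha>_def by (intro top_sum_mono Lmono that)
    moreover have "std_normal_cdf (x i) \<le> std_normal_cdf (x j)"
      using False that by (intro std_normal_cdf_mono xmono) auto
    ultimately show ?thesis using False that by (simp add: a_def max_def)
  qed
  have a1: "a k = 1" using k \<alpha>1 std_normal_cdf_le_1[of "x k"] by (simp add: a_def max_def)
  have a01: "0 \<le> a j" "a j \<le> 1" if "j \<le> k" for j using amono[of 0 j] amono[of j k] a1 that by (simp_all add: a_def)
  have close: "\<alpha> j \<le> a j" "a j \<le> \<alpha> j + \<epsilon>" if "j \<le> k" for j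
    using \<alpha>_ge[of j] that \<epsilon> \<alpha>0 by (auto simp: a_def)
  have "fidelity Y R (Qn n) \<le> (\<Sum>j=1..k. sqrt ((\<alpha> j - \<alpha> (j - 1)) * (top_sum (Qn n) (L j) - top_sum (Qn n) (L (j - 1)))))"
    unfolding \<alpha>_def
    by (rule fidelity_le_bins[OF R(1) finQn Y]) (use \<alpha>1[unfolded \<alpha>_def] L0 Lmono in auto)
  also have "\<dots> \<le> (\<Sum>j=1..k. sqrt ((a j - a (j - 1)) * \<delta>) + 2 * sqrt \<epsilon>)"
  proof (rule sum_mono, rule sqrt_perturbed_le)
    fix j assume j: "j \<in> {1..k}"
    hence jk: "j \<le> k" "j - 1 \<le> k" "j - 1 \<le> j" by auto
    show "\<alpha> j - \<alpha> (j - 1) \<le> a j - a (j - 1) + \<epsilon>"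
      using close(1)[OF jk(1)] close(2)[OF jk(2)] by linarith
    show "0 \<le> a j - a (j - 1)" using amono[OF jk(3,1)] by simp
    show "a j - a (j - 1) \<le> 1" using a01(2)[OF jk(1)] a01(1)[OF jk(2)] by linarith
    show "top_sum (Qn n) (L j) - top_sum (Qn n) (L (j - 1)) \<le> \<delta> + \<epsilon>" by (rule Q[OF j])
    show "0 \<le> top_sum (Qn n) (L j) - top_sum (Qn n) (L (j - 1))"
      using top_sum_mono[OF Lmono[of "j - 1" j], of "Qn n"] j by simp
  qed (use d \<epsilon> in auto)
  also have "\<dots> = (\<Sum>j=1..k. sqrt ((a j - a (j - 1)) * \<delta>)) + 2 * real k * sqrt \<epsilon>"
    by (simp add: sum.distrib)
  also have "(\<Sum>j=1..k. sqrt ((a j - a (j - 1)) * \<delta>)) \<le> real 2 * (1 / sqrt (real k)) + (\<Sum>j=Suc 2..k. sqrt ((a j - a (j - 1)) * \<delta>))"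
  proof (rule sum_first_terms_le[OF k])
    fix j :: nat assume "1 \<le> j" "j \<le> 2"
    hence "a j \<le> 1" "0 \<le> a (j - 1)" using k by (auto intro!: a01)
    hence "(a j - a (j - 1)) * \<delta> \<le> 1 * (1 / real k)"
      using d by (intro mult_mono) auto
    thus "sqrt ((a j - a (j - 1)) * \<delta>) \<le> 1 / sqrt (real k)"
      by (metis mult_1 real_sqrt_divide real_sqrt_le_mono real_sqrt_one)
  qed
  also have "(\<Sum>j=Suc 2..k. sqrt ((a j - a (j - 1)) * \<delta>)) = (\<Sum>j=3..k. sqrt ((a j - a (j - 1)) * \<delta>))"
    by (simp add: numeral_3_eq_3 numeral_2_eq_2)
  also have "\<dots> \<le> opt_value s"
    by (rule discrete_sum_le_rayleigh_normal[where a = a and x = x, OF coeff_C_pos k d(1) x(2) x(1) amono a1]) (auto simp: a_def)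
  finally show ?thesis by simp
qed

lemma converse:
  assumes X: "set_pmf P \<subseteq> X" and Y: "finite Y" "set_pmf Q \<subseteq> Y" and e: "e > 0"
  shows "eventually (\<lambda>n. fid_maj (iid_carrier (target_len P Q t n) Y) (Pn n) (Qn n) (bits s n) \<le> opt_value s + e) sequentially"
proof -
  \<comment> \<open>The constant 16 makes 2 / sqrt k at most e / 2; \<open>\<epsilon>\<close> is
    then chosen depending on \<open>k\<close>, so that the other error term is at most e /
    2.\<close>
  obtain k0 :: nat where k0: "16 / e\<^sup>2 \<le> real k0" using real_arch_simple by blast
  define k where "k = max 2 k0"
  have k: "k \<ge> 2" "16 / e\<^sup>2 \<le> real k" using k0 by (auto simp: k_def)
  have "4 / e \<le> sqrt (real k)"
    using real_sqrt_le_mono[OF k(2)] e by (simp add: real_sqrt_divide)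
  hence ke: "2 / sqrt (real k) \<le> e / 2" using e k by (simp add: field_simps)
  define \<epsilon> where "\<epsilon> = min 1 ((e / (4 * real k))\<^sup>2)"
  have \<epsilon>: "0 < \<epsilon>" "\<epsilon> \<le> 1" using e k by (auto simp: \<epsilon>_def)
  have "sqrt \<epsilon> \<le> sqrt ((e / (4 * real k))\<^sup>2)" by (rule real_sqrt_le_mono) (simp add: \<epsilon>_def)
  also have "\<dots> = e / (4 * real k)" using e by simp
  finally have \<epsilon>e: "2 * real k * sqrt \<epsilon> \<le> e / 2" using k by (simp add: field_simps)
  define \<delta> where "\<delta> = normal_cdf \<mu> \<sigma> s / real k"
  obtain x where x: "x k = s" "\<And>j. 1 \<le> j \<Longrightarrow> j \<le> k \<Longrightarrow> normal_cdf \<mu> \<sigma> (x j) = real j * \<delta>"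
    unfolding \<delta>_def using normal_grid[OF \<sigma>_pos, of k s \<mu>] k by auto
  define L where "L n j = (if j = 0 then 0 else nat \<lfloor>2 powr bits (x j) n\<rfloor>)" for n j
  have top: "(\<lambda>n. top_sum (Qn n) (L n j)) \<longlonglongrightarrow> real j * \<delta>" if "j \<le> k" for j
  proof (cases "j = 0")
    case False
    thus ?thesis using top_sum_Q[of "x j"] x(2)[of j] that by (simp add: L_def)
  qed (simp add: L_def top_sum_def)
  have "eventually (\<lambda>n. \<forall>j\<in>{1..k}. top_sum (Qn n) (L n j) - top_sum (Qn n) (L n (j - 1)) \<le> \<delta> + \<epsilon>) sequentially"
  proof (rule eventually_ball_finite, simp, intro ballI)
    fix j assume j: "j \<in> {1..k}"
    have "(\<lambda>n. top_sum (Qn n) (L n j) - top_sum (Qn n) (L n (j - 1))) \<longlonglongrightarrow> real j * \<delta> - real (j - 1) * \<delta>"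
      using j by (intro tendsto_diff top) auto
    moreover have "real j * \<delta> - real (j - 1) * \<delta> < \<delta> + \<epsilon>" using j \<epsilon> by (simp add: of_nat_diff algebra_simps)
    ultimately have "eventually (\<lambda>n. top_sum (Qn n) (L n j) - top_sum (Qn n) (L n (j - 1)) < \<delta> + \<epsilon>) sequentially"
      by (rule order_tendstoD(2))
    thus "eventually (\<lambda>n. top_sum (Qn n) (L n j) - top_sum (Qn n) (L n (j - 1)) \<le> \<delta> + \<epsilon>) sequentially"
      by eventually_elim simp
  qed
  moreover have "eventually (\<lambda>n. \<forall>j\<in>{1..k}. std_normal_cdf (x j) - \<epsilon> \<le> top_sum (Pn n) (nat \<lfloor>2 powr bits (x j) n\<rfloor>)) sequentially"
  proof (rule eventually_ball_finite, simp, intro ballI)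
    fix j
    have "eventually (\<lambda>n. std_normal_cdf (x j) - \<epsilon> < measure (Pn n) {y. 2 powr - bits (x j) n \<le> pmf (Pn n) y}) sequentially"
      by (rule order_tendstoD(1)[OF level_mass_P]) (use \<epsilon> in simp)
    thus "eventually (\<lambda>n. std_normal_cdf (x j) - \<epsilon> \<le> top_sum (Pn n) (nat \<lfloor>2 powr bits (x j) n\<rfloor>)) sequentially"
      by eventually_elim (rule order_trans[OF less_imp_le top_sum_ge_level[OF finPn]])
  qed
  moreover have "eventually (\<lambda>n. 0 \<le> bits s n) sequentially"
    using bits_at_top[of s] by (simp add: filterlim_at_top)
  ultimately show ?thesis
  proof eventually_elim
    case (elim n)
    let ?Y = "iid_carrier (target_len P Q t n) Y"
    have fY: "finite ?Y" using Y(1) by (simp add: iid_carrier_def finite_PiE)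
    have "set_pmf (Qn n) \<subseteq> ?Y" using set_iid_subset[OF Y(2)] .
    hence "?Y \<noteq> {}" using set_pmf_not_empty[of "Qn n"] by blast
    note ne = fid_det_le_fid_maj(2)[OF set_iid_subset[OF X] finPn fY this elim(3)]
    show ?case unfolding fid_maj_def
    proof (rule cSup_least[OF ne])
      fix v assume "v \<in> {fidelity ?Y P'' (Qn n) | P''. P'' \<in> dists_on ?Y \<and>
            (\<exists>P'\<in>dists_on (storage (bits s n)). majorized (Pn n) P' \<and> majorized P' P'')}"
      then obtain R P' where v: "v = fidelity ?Y R (Qn n)" "R \<in> dists_on ?Y" "P' \<in> dists_on (storage (bits s n))"
        "majorized (Pn n) P'" "majorized P' R" by blast
      have "finite (set_pmf R)" using v(2) fY finite_subset by (auto simp: dists_on_def)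
      have "fidelity ?Y R (Qn n) \<le> opt_value s + 2 / sqrt (real k) + 2 * real k * sqrt \<epsilon>"
        by (rule fid_maj_single_le[where x = x and P' = P', OF fY k(1) x \<delta>_def \<epsilon>])
           (use elim(1)[unfolded L_def] elim(2) v \<open>finite (set_pmf R)\<close> in blast)+
      thus "v \<le> opt_value s + e" using ke \<epsilon>e v(1) by simp
    qed
  qed
qed

section \<open>Achievability\<close>

text \<open>The error \<open>e\<close> is spent in thirds: on approximating the supremum by one
  \<open>A\<close>, on the three bins given up (hence 81 = 9 * 9 in the choice of \<open>k\<close>),
  and on the limit in \<open>n\<close>.\<close>

lemma achievability:
  assumes Y: "finite Y" "set_pmf Q \<subseteq> Y" and e: "e > 0"
  shows "eventually (\<lambda>n. opt_value s - e \<le> fid_det (X n) (iid_carrier (target_len P Q t n) Y) (Pn n) (Qn n) (bits s n)) sequentially"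
proof -
  obtain A where A: "A \<in> admissible s" "opt_value s - e / 3 < density_fidelity (deriv A) (normal_density \<mu> \<sigma>)"
    using rayleigh_normal_sup(2)[OF coeff_C_pos, of "e / 3" s \<mu>] e by auto
  note AD = admissibleD[OF A(1)]
  obtain k0 :: nat where k0: "81 / e\<^sup>2 \<le> real k0" using real_arch_simple by blast
  define K where "K = Suc k0"
  \<comment> \<open>Only the first \<open>K\<close> bins are filled, so that the shifted profile
    stays on the grid.\<close>
  define k where "k = K + 3"
  have k: "k \<ge> 1" "81 / e\<^sup>2 \<le> real k" "3 \<le> k" using k0 by (auto simp: k_def K_def)
  have "9 / e \<le> sqrt (real k)"
    using real_sqrt_le_mono[OF k(2)] e by (simp add: real_sqrt_divide)
  hence ke: "3 / sqrt (real k) \<le> e / 3" using e k by (simp add: field_simps)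
  define \<delta> where "\<delta> = normal_cdf \<mu> \<sigma> s / real k"
  note b = normal_cdf_bounds[OF \<sigma>_pos, of \<mu> s]
  have d: "0 < \<delta>" "\<delta> \<le> 1 / real k" using b k by (simp_all add: \<delta>_def divide_right_mono)
  obtain x where x: "x k = s" "\<And>j. 1 \<le> j \<Longrightarrow> j \<le> k \<Longrightarrow> normal_cdf \<mu> \<sigma> (x j) = real j * \<delta>"
    unfolding \<delta>_def using normal_grid[OF \<sigma>_pos, of k s \<mu>] k by auto
  have xmono: "x i < x j" if "1 \<le> i" "i < j" "j \<le> k" for i j
    using normal_cdf_less_iff[OF \<sigma>_pos, of \<mu> "x i" "x j"] x(2)[of i] x(2)[of j] that d by simp
  define a where "a j = (if j = 0 then 0 else A (x j))" for j
  have amono: "a i \<le> a j" if "i \<le> j" "j \<le> k" for i j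
  proof (cases "i = 0 \<or> i = j")
    case True
    thus ?thesis using AD(3) by (auto simp: a_def)
  next
    case False
    hence "x i \<le> x j" using xmono[of i j] that by simp
    thus ?thesis using False that monoD[OF AD(1)] by (auto simp: a_def)
  qed
  have a01: "0 \<le> a j" "a j \<le> 1" for j using AD by (auto simp: a_def)
  \<comment> \<open>Bin \<open>j\<close> receives the increment that the profile assigns to bin
    \<open>j + 3\<close>. The form \<open>j - 1 + 3\<close> matches \<open>sum_increments\<close>
    for the shifted sequence.\<close>
  define c where "c j = a (j + 3) - a (j - 1 + 3)" for j
  have "density_fidelity (deriv A) (normal_density \<mu> \<sigma>) \<le> (\<Sum>j=1..k. sqrt ((a j - a (j - 1)) * \<delta>))"
    unfolding a_def by (rule density_fidelity_le_discrete[OF \<sigma>_pos A(1) k(1) d(1)]) (use x in auto)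
  also have "\<dots> \<le> real 3 * (1 / sqrt (real k)) + (\<Sum>j=Suc 3..k. sqrt ((a j - a (j - 1)) * \<delta>))"
  proof (rule sum_first_terms_le[OF k(3)])
    fix j :: nat
    have "(a j - a (j - 1)) * \<delta> \<le> 1 * (1 / real k)"
      using a01[of j] a01[of "j - 1"] k d by (intro mult_mono) auto
    thus "sqrt ((a j - a (j - 1)) * \<delta>) \<le> 1 / sqrt (real k)"
      by (metis mult_1 real_sqrt_divide real_sqrt_le_mono real_sqrt_one)
  qed
  also have "(\<Sum>j=Suc 3..k. sqrt ((a j - a (j - 1)) * \<delta>)) = (\<Sum>j=1+3..K+3. sqrt ((a j - a (j - 1)) * \<delta>))"
    by (simp add: k_def)
  also have "\<dots> = (\<Sum>j=1..K. sqrt ((a (j + 3) - a (j + 3 - 1)) * \<delta>))"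
    by (rule sum.shift_bounds_cl_nat_ivl)
  also have "\<dots> = (\<Sum>j=1..K. sqrt (c j * \<delta>))"
  proof (rule sum.cong[OF refl])
    fix j assume "j \<in> {1..K}"
    hence "j + 3 - 1 = j - 1 + 3" by simp
    thus "sqrt ((a (j + 3) - a (j + 3 - 1)) * \<delta>) = sqrt (c j * \<delta>)" by (simp only: c_def)
  qed
  finally have target: "opt_value s - 2 * e / 3 < (\<Sum>j=1..K. sqrt (c j * \<delta>))" using A(2) ke by simp
  define D where "D n j = (if j = 0 then {} else {y. 2 powr - bits (x j) n \<le> pmf (Qn n) y})" for n j
  define B where "B n j = D n j - D n (j - 1)" for n j
  \<comment> \<open>One grid point lighter than the least probability \<open>\<rho> n j\<close>
    allowed in the bin, so that the ratio of the two tends to 0.\<close>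
  define \<kappa> where "\<kappa> n j = 2 powr - bits (x (j + 1)) n" for n j
  define \<rho> where "\<rho> n j = 2 powr - bits (x j) n" for n j
  have Dmono: "D n i \<subseteq> D n j" if "i \<le> j" "j \<le> k" for n i j
  proof (cases "i = 0 \<or> i = j")
    case False
    hence "bits (x i) n \<le> bits (x j) n" using xmono[of i j] that by (intro bits_mono) simp
    hence "2 powr - bits (x j) n \<le> 2 powr - bits (x i) n" by simp
    from order_trans[OF this] show ?thesis using False that by (auto simp: D_def)
  qed (auto simp: D_def)
  have Dlim: "(\<lambda>n. measure (Qn n) (D n j)) \<longlonglongrightarrow> real j * \<delta>" if "j \<le> k" for j
  proof (cases "j = 0")
    case False
    thus ?thesis using level_mass_Q[of "x j"] x(2)[of j] that by (simp add: D_def)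
  qed (simp add: D_def)
  have Blim: "(\<lambda>n. measure (Qn n) (B n j)) \<longlonglongrightarrow> \<delta>" if "j \<in> {1..K}" for j
  proof -
    have j: "1 \<le> j" "j \<le> k" using that by (auto simp: k_def)
    have "measure (Qn n) (B n j) = measure (Qn n) (D n j) - measure (Qn n) (D n (j - 1))" for n
      unfolding B_def using Dmono[of "j - 1" j n] j by (intro measure_pmf.finite_measure_Diff) auto
    moreover have "(\<lambda>n. measure (Qn n) (D n j) - measure (Qn n) (D n (j - 1))) \<longlonglongrightarrow> real j * \<delta> - real (j - 1) * \<delta>"
      using j by (intro tendsto_diff Dlim) auto
    moreover have "real j * \<delta> - real (j - 1) * \<delta> = \<delta>" using j by (simp add: of_nat_diff algebra_simps)
    ultimately show ?thesis by simp
  qed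
  have \<kappa>\<rho>: "(\<lambda>n. \<kappa> n j / \<rho> n j) \<longlonglongrightarrow> 0" if "j \<in> {1..K}" for j
  proof -
    have "\<kappa> n j / \<rho> n j = 2 powr (bits (x j) n - bits (x (j + 1)) n)" for n
      by (simp add: \<kappa>_def \<rho>_def flip: powr_diff)
    moreover have "x j < x (j + 1)" using that by (intro xmono) (auto simp: k_def)
    ultimately show ?thesis using bits_diff_at_bot by simp
  qed
  have "(\<lambda>n. \<Sum>j=1..K. sqrt (c j * measure (Qn n) (B n j)) - sqrt (\<kappa> n j / \<rho> n j))
      \<longlonglongrightarrow> (\<Sum>j=1..K. sqrt (c j * \<delta>) - sqrt 0)"
    by (intro tendsto_sum tendsto_diff tendsto_real_sqrt tendsto_mult tendsto_const Blim \<kappa>\<rho>)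
  hence "eventually (\<lambda>n. opt_value s - e < (\<Sum>j=1..K. sqrt (c j * measure (Qn n) (B n j)) - sqrt (\<kappa> n j / \<rho> n j))) sequentially"
    by (rule order_tendstoD(1)) (use target e in simp)
  \<comment> \<open>The strict increase of \<Phi> from grid point \<open>j + 1\<close> to
    \<open>j + 2\<close> is the slack that turns the limit into an inequality for large
    \<open>n\<close>.\<close>
  moreover have "eventually (\<lambda>n. \<forall>j\<in>{1..K}. measure (Pn n) {y. \<kappa> n j \<le> pmf (Pn n) y} \<le> a (j + 2)) sequentially"
  proof (rule eventually_ball_finite, simp, intro ballI)
    fix j assume j: "j \<in> {1..K}"
    have "x (j + 1) < x (j + 2)" using j by (intro xmono) (auto simp: k_def)
    hence "normal_cdf 0 1 (x (j + 1)) < normal_cdf 0 1 (x (j + 2))" by (intro normal_cdf_strict_mono) auto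
    hence "std_normal_cdf (x (j + 1)) < a (j + 2)" using AD(4)[of "x (j + 2)"] by (simp add: normal_cdf_def a_def)
    hence "eventually (\<lambda>n. measure (Pn n) {y. \<kappa> n j \<le> pmf (Pn n) y} < a (j + 2)) sequentially"
      unfolding \<kappa>_def by (rule order_tendstoD(2)[OF level_mass_P])
    thus "eventually (\<lambda>n. measure (Pn n) {y. \<kappa> n j \<le> pmf (Pn n) y} \<le> a (j + 2)) sequentially"
      by eventually_elim simp
  qed
  moreover have "eventually (\<lambda>n. 0 < measure (Qn n) (D n K)) sequentially"
    by (rule order_tendstoD(1)[OF Dlim]) (use d in \<open>auto simp: k_def K_def\<close>)
  moreover have "eventually (\<lambda>n. n > 0) sequentially" by (rule eventually_gt_at_top)
  ultimately show ?thesis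
  proof eventually_elim
    case (elim n)
    let ?Y = "iid_carrier (target_len P Q t n) Y"
    have union: "(\<Union>j\<in>{1..i}. B n j) = D n i" if "i \<le> k" for i
      using that
    proof (induction i)
      case 0
      thus ?case by (simp add: D_def)
    next
      case (Suc i)
      have "{1..Suc i} = insert (Suc i) {1..i}" by auto
      hence "(\<Union>j\<in>{1..Suc i}. B n j) = (\<Union>j\<in>{1..i}. B n j) \<union> B n (Suc i)"
        by (simp add: Un_commute)
      thus ?case using Suc Dmono[of i "Suc i" n] by (auto simp: B_def)
    qed
    have UB: "(\<Union>j\<in>{1..K}. B n j) = D n K" by (rule union) (simp add: k_def)
    have "(\<Sum>j=1..K. sqrt (c j * measure (Qn n) (B n j)) - sqrt (\<kappa> n j / \<rho> n j))
        \<le> fid_det (X n) ?Y (Pn n) (Qn n) (bits s n)"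
    proof (rule fid_det_ge_bins[OF finPn])
      show "finite ?Y" using Y(1) by (simp add: iid_carrier_def finite_PiE)
      show "set_pmf (Qn n) \<subseteq> ?Y" using set_iid_subset[OF Y(2)] .
      have disj: "B n i \<inter> B n j = {}" if "i < j" "j \<in> {1..K}" for i j
      proof -
        have "D n i \<subseteq> D n (j - 1)" by (rule Dmono) (use that in \<open>auto simp: k_def\<close>)
        thus ?thesis by (auto simp: B_def)
      qed
      show "disjoint_family_on (B n) {1..K}"
        unfolding disjoint_family_on_def using disj by (metis Int_commute linorder_neqE_nat)
      have D: "D n j \<subseteq> set_pmf (Qn n)" for j
        using finite_level_set(1)[OF finQn, of "2 powr - bits (x j) n"] by (auto simp: D_def)
      thus "B n j \<subseteq> set_pmf (Qn n)" for j by (auto simp: B_def)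
      show "(\<Union>j\<in>{1..K}. B n j) \<noteq> {}" unfolding UB using elim(3) by auto
      \<comment> \<open>All images lie in the level set that belongs to \<open>s\<close>, whose size
        is at most that of the storage.\<close>
      have "card (D n K) \<le> card (D n k)"
        by (intro card_mono finite_subset[OF D finQn] Dmono) (auto simp: k_def)
      also have "\<dots> \<le> nat \<lfloor>2 powr bits s n\<rfloor>"
        using card_level_set[OF finQn, of "bits s n"] k x(1) by (simp add: D_def)
      finally show "card (\<Union>j\<in>{1..K}. B n j) \<le> nat \<lfloor>2 powr bits s n\<rfloor>" unfolding UB .
      show "\<rho> n j \<le> pmf (Qn n) y" if "j \<in> {1..K}" "y \<in> B n j" for j y
        using that by (auto simp: B_def D_def \<rho>_def split: if_splits)
      show "0 < \<rho> n j" "0 < \<kappa> n j" for j by (simp_all add: \<rho>_def \<kappa>_def)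
      show "\<kappa> n j < \<kappa> n i" if "i \<in> {1..K}" "j \<in> {1..K}" "i < j" for i j
        using that xmono[of "i + 1" "j + 1"] bits_strict_mono[of "x (i + 1)" "x (j + 1)" n] elim(4)
        by (auto simp: \<kappa>_def k_def)
      show "0 \<le> c j" if "j \<in> {1..K}" for j using amono[of "j - 1 + 3" "j + 3"] that by (simp add: c_def k_def)
      show "(\<Sum>i=j..K. c i) \<le> measure (Pn n) {y. pmf (Pn n) y \<le> \<kappa> n j}" if j: "j \<in> {1..K}" for j
      proof -
        have "(\<Sum>i=Suc (j - 1)..K. c i) = a (K + 3) - a (j - 1 + 3)"
          unfolding c_def by (rule sum_increments) (use j in auto)
        moreover have "j - 1 + 3 = j + 2" "Suc (j - 1) = j" using j by auto
        \<comment> \<open>\<open>A s = 1\<close> enters here: the tail of the demand telescopes to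
          exactly \<open>1 - a (j + 2)\<close>.\<close>
        moreover have "a (K + 3) = 1" using x(1) AD(2) by (simp add: a_def k_def)
        ultimately have "(\<Sum>i=j..K. c i) = 1 - a (j + 2)" by simp
        also have "\<dots> \<le> 1 - measure (Pn n) {y. \<kappa> n j \<le> pmf (Pn n) y}" using elim(2) j by simp
        also have "\<dots> = measure (Pn n) (- {y. \<kappa> n j \<le> pmf (Pn n) y})"
          by (simp add: measure_pmf.prob_compl[of "{y. \<kappa> n j \<le> pmf (Pn n) y}", simplified] Compl_eq_Diff_UNIV)
        also have "\<dots> \<le> measure (Pn n) {y. pmf (Pn n) y \<le> \<kappa> n j}"
          by (intro measure_pmf.finite_measure_mono) auto
        finally show ?thesis .
      qed
    qed
    thus ?case using elim(1) by simp
  qed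
qed

end

lemma liminf_ereal_eq:
  fixes f :: "nat \<Rightarrow> real"
  assumes "\<And>e. e > 0 \<Longrightarrow> eventually (\<lambda>n. l - e \<le> f n) sequentially"
    and "\<And>e. e > 0 \<Longrightarrow> eventually (\<lambda>n. f n \<le> l + e) sequentially"
  shows "liminf (\<lambda>n. ereal (f n)) = ereal l"
proof -
  have "f \<longlonglongrightarrow> l"
  proof (rule tendstoI)
    fix e :: real assume e: "e > 0"
    have "eventually (\<lambda>n. l - e / 2 \<le> f n \<and> f n \<le> l + e / 2) sequentially"
      using assms[of "e / 2"] e by (simp add: eventually_conj)
    thus "eventually (\<lambda>n. dist (f n) l < e) sequentially"
      by eventually_elim (use e in \<open>simp add: dist_real_def abs_less_iff\<close>)
  qed
  thus ?thesis by (intro lim_imp_Liminf) auto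
qed

text \<open>Achievability bounds the deterministic values from below and the converse bounds the
  majorization values from above. As the former do not exceed the latter for large \<open>n\<close>,
  both sequences converge, and the limits inferior are limits.\<close>

theorem theorem26:
  fixes X :: "'a set" and Y :: "'b set"
    and P :: "'a pmf" and Q :: "'b pmf"
    and s\<^sub>2 t\<^sub>2 :: real
  assumes "finite X" and "finite Y"
    and "P \<in> dists_on X" and "Q \<in> dists_on Y"
    and "non_uniform P" and "non_uniform Q"
  shows "asym_fid_det X Y P Q s\<^sub>2 t\<^sub>2 = asym_fid_maj Y P Q s\<^sub>2 t\<^sub>2 \<and>
         asym_fid_maj Y P Q s\<^sub>2 t\<^sub>2 =
           ereal (sqrt (1 - rayleigh_normal (coeff_C P Q) (s\<^sub>2 / sqrt (pmf_varentropy P))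
                              (t\<^sub>2 * coeff_D P Q)))"
proof -
  have sX: "set_pmf P \<subseteq> X" and sY: "set_pmf Q \<subseteq> Y" using assms by (auto simp: dists_on_def)
  interpret conversion P Q t\<^sub>2
    using finite_subset[OF sX assms(1)] finite_subset[OF sY assms(2)] assms(5,6) by (rule conversion.intro)
  define s where "s = s\<^sub>2 / sqrt (pmf_varentropy P)"
  have bits: "storage_bits P s\<^sub>2 n = bits s n" for n
    using positive(1) by (simp add: storage_bits_def bits_def s_def)
  let ?Y = "\<lambda>n. iid_carrier (target_len P Q t\<^sub>2 n) Y"
  let ?det = "\<lambda>n. fid_det (iid_carrier n X) (?Y n) (Pn n) (Qn n) (bits s n)"
  let ?maj = "\<lambda>n. fid_maj (?Y n) (Pn n) (Qn n) (bits s n)"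
  have le: "eventually (\<lambda>n. ?det n \<le> ?maj n) sequentially"
  proof -
    have "eventually (\<lambda>n. 0 \<le> bits s n) sequentially"
      using bits_at_top[of s] by (simp add: filterlim_at_top)
    thus ?thesis
    proof eventually_elim
      case (elim n)
      have "set_pmf (Qn n) \<subseteq> ?Y n" using set_iid_subset[OF sY] .
      hence "?Y n \<noteq> {}" using set_pmf_not_empty[of "Qn n"] by blast
      moreover have "finite (?Y n)" using assms(2) by (simp add: iid_carrier_def finite_PiE)
      ultimately show ?case by (intro fid_det_le_fid_maj(1)[OF set_iid_subset[OF sX] finPn] elim)
    qed
  qed
  have upper: "eventually (\<lambda>n. ?maj n \<le> opt_value s + e) sequentially" if "e > 0" for e
    by (rule converse[OF sX assms(2) sY that])
  have lower: "eventually (\<lambda>n. opt_value s - e \<le> ?det n) sequentially" if "e > 0" for e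
    by (rule achievability[OF assms(2) sY that])
  have "liminf (\<lambda>n. ereal (?det n)) = ereal (opt_value s)"
  proof (rule liminf_ereal_eq)
    show "eventually (\<lambda>n. ?det n \<le> opt_value s + e) sequentially" if "e > 0" for e
      using upper[OF that] le by eventually_elim simp
  qed (rule lower)
  moreover have "liminf (\<lambda>n. ereal (?maj n)) = ereal (opt_value s)"
  proof (rule liminf_ereal_eq)
    show "eventually (\<lambda>n. opt_value s - e \<le> ?maj n) sequentially" if "e > 0" for e
      using lower[OF that] le by eventually_elim simp
  qed (rule upper)
  ultimately show ?thesis
    unfolding asym_fid_det_def asym_fid_maj_def bits s_def[symmetric] by simp
qed

end
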